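(* The following hold for families of languages generated by internal contextual grammars: Equalities: $\mathcal{IC}(\mathit{REG})=\mathcal{IC}(\mathit{UF})=\mathcal{IC}(\mathit{LCOM})=\mathcal{IC}(\mathit{RCOM})=\mathcal{IC}(\mathit{2COM})$. Proper inclusions: $\mathcal{IC}(\mathit{FIN})\subset\mathcal{IC}(\mathit{NIL})$, $\mathcal{IC}(\mathit{MON})\subset\mathcal{IC}(\mathit{NIL})$, $\mathcal{IC}(\mathit{MON})\subset\mathcal{IC}(\mathit{COMB})$, $\mathcal{IC}(\mathit{MON})\subset\mathcal{IC}(\mathit{STAR})$, $\mathcal{IC}(\mathit{MON})\subset\mathcal{IC}(\mathit{INF})$, $\mathcal{IC}(\mathit{MON})\subset\mathcal{IC}(\mathit{COMM})$, $\mathcal{IC}(\mathit{COMB})\subset\mathcal{IC}(\mathit{DEF})$, $\mathcal{IC}(\mathit{COMB})\subset\mathcal{IC}(\mathit{SYDEF})$, $\mathcal{IC}(\mathit{NIL})\subset\mathcal{IC}(\mathit{DEF})$, $\mathcal{IC}(\mathit{DEF})\subset\mathcal{IC}(\mathit{ORD})$, $\mathcal{IC}(\mathit{ORD})\subset\mathcal{IC}(\mathit{NC})$, $\mathcal{IC}(\mathit{NC})\subset\mathcal{IC}(\mathit{PS})$, $\mathcal{IC}(\mathit{SYDEF})\subset\mathcal{IC}(\mathit{PS})$, $\mathcal{IC}(\mathit{INF})\subset\mathcal{IC}(\mathit{SUF})$, $\mathcal{IC}(\mathit{INF})\subset\mathcal{IC}(\mathit{PRE})$, $\mathcal{IC}(\mathit{SUF})\subset\mathcal{IC}(\mathit{PS})$,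 $\mathcal{IC}(\mathit{PRE})\subset\mathcal{IC}(\mathit{PS})$, $\mathcal{IC}(\mathit{PS})\subset\mathcal{IC}(\mathit{REG})$, $\mathcal{IC}(\mathit{STAR})\subset\mathcal{IC}(\mathit{REG})$, $\mathcal{IC}(\mathit{COMM})\subset\mathcal{IC}(\mathit{CIRC})$, $\mathcal{IC}(\mathit{CIRC})\subset\mathcal{IC}(\mathit{REG})$. Furthermore, consider the directed graph whose nodes are $\mathcal{IC}(\mathcal F)$ for $\mathcal F\in\{\mathit{FIN},\mathit{MON},\mathit{COMB},\mathit{NIL},\mathit{DEF},\mathit{ORD},\mathit{SYDEF},\mathit{INF},\mathit{SUF},\mathit{PRE},\mathit{COMM},\mathit{STAR},\mathit{NC},\mathit{PS},\mathit{CIRC},\mathit{REG}\}$ and which has an edge $X\to Y$ for each proper inclusion $X\subset Y$ listed above. If $X$ and $Y$ are two different nodes such that there is no directed path from $X$ to $Y$ and none from $Y$ to $X$, then $X$ and $Y$ are incomparable, i.e. $X\not\subseteq Y$ and $Y\not\subseteq X$.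
   Context: An alphabet is a non-empty finite set; $\lambda$ is the empty word; between families of languages, $\subset$ denotes proper inclusion. Contextual grammars. Let $\mathcal F$ be a family of languages. A contextual grammar with selection in $\mathcal F$ is a triple $G=(V,\mathcal S,A)$ where $V$ is an alphabet, $A\subset V^*$ is a finite set of axioms, and $\mathcal S$ is a finite set of selection pairs $(S,C)$, where the selection language $S$ is a language in $\mathcal F$ with respect to some alphabet $U\subseteq V$, and $C\subset V^*\times V^*$ is a finite set of contexts $(u,v)$ with $uv\neq\lambda$. Internal derivation: $x\Longrightarrow_{\mathrm{in}}y$ iff there are words $x_1,x_2,x_3$ with $x=x_1x_2x_3$ and a pair $(S,C)\in\mathcal S$ and $(u,v)\in C$ with $x_2\in S$ and $y=x_1ux_2vx_3$. The internally generated language is $L_{\mathrm{in}}(G)=\{z: x\Longrightarrow_{\mathrm{in}}^* z\text{ for some }x\in A\}$, where $\Longrightarrow_{\mathrm{in}}^*$ is the reflexive and transitive closure of $\Longrightarrow_{\mathrm{in}}$. $\mathcal{IC}(\mathcal F)$ is the family of all languages generated internally by contextual grammars with selection in $\mathcal F$. Families. $\mathit{REG}$ is the family of regular languages, $\mathit{FIN}$ the family of finite languages. Each property below is a property of a regular language $L\subseteq V^*$ with respect to an alphabet $V$, and the abbreviation denotes the family of all regular languages having the property: - $\mathit{MON}$: $L=V^*$. - $\mathit{NIL}$: $L$ or $V^*\setminus L$ is finite. - $\mathit{COMB}$: $L=V^*X$ for some $X\subseteq V$. - $\mathit{DEF}$: $L=A\cup V^*B$ for finite $A,B\subseteq V^*$.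 - $\mathit{SYDEF}$: $L=EV^*H$ for regular languages $E,H$. - $\mathit{INF}$ (infix-closed): $xyz\in L$ implies $y\in L$, for all $x,y,z\in V^*$. - $\mathit{PRE}$ (prefix-closed): $xy\in L$ implies $x\in L$, for all $x,y\in V^*$. - $\mathit{SUF}$ (suffix-closed): $xy\in L$ implies $y\in L$, for all $x,y\in V^*$. - $\mathit{ORD}$: $L$ is accepted by a deterministic finite automaton $(V,Z,z_0,F,\delta)$ such that $Z$ carries a total order $\preceq$ for which $z\preceq z'$ implies $\delta(z,a)\preceq\delta(z',a)$ for every $a\in V$. - $\mathit{COMM}$: $L$ contains with each word all permutations of it. - $\mathit{CIRC}$: $L$ contains with each word all circular shifts of it. - $\mathit{NC}$ (non-counting): there is $k\ge 1$ such that for all $x,y,z\in V^*$: $xy^kz\in L$ iff $xy^{k+1}z\in L$. - $\mathit{PS}$ (power-separating): there is $m\ge1$ such that for every $x\in V^*$, with $J_x^m=\{x^n: n\ge m\}$, either $J_x^m\cap L=\emptyset$ or $J_x^m\subseteq L$. - $\mathit{UF}$ (union-free): $L$ is described by a regular expression built only by concatenation and Kleene closure. - $\mathit{STAR}$: $L=H^*$ for some regular $H\subseteq V^*$. - $\mathit{LCOM}$: $L=EG^*$ for some regular $E$ and regular $G\notin\{\emptyset,\{\lambda\}\}$. - $\mathit{RCOM}$: $L=G^*H$ for some regular $H$ and regular $G\notin\{\emptyset,\{\lambda\}\}$. - $\mathit{2COM}$: $L=EG^*H$ for regular $E,H$ and regular $G\notin\{\emptyset,\{\lambda\}\}$. 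*)

theory Defs
  imports "HOL-Library.Multiset"
begin

type_synonym 'a word = "'a list"
type_synonym 'a lang = "'a word set"

(* All families considered here speak about a language with respect to an alphabet:
   L \<in> F V means that L, as a language over the alphabet V, belongs to the family F. *)
type_synonym 'a family = "'a set \<Rightarrow> 'a lang set"

definition alphabet :: "'a set \<Rightarrow> bool" where
  "alphabet V \<longleftrightarrow> finite V \<and> V \<noteq> {}"

(* The set of all words over V is the library's lists V. *)

definition conc :: "'a lang \<Rightarrow> 'a lang \<Rightarrow> 'a lang"  (infixr \<open>@@\<close> 75) where
  "A @@ B = {x @ y | x y. x \<in> A \<and> y \<in> B}"

definition star :: "'a lang \<Rightarrow> 'a lang" where
  "star A = {concat ws | ws. ws \<in> lists A}"

definition wpow :: "'a word \<Rightarrow> nat \<Rightarrow> 'a word" where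
  "wpow x n = concat (replicate n x)"


datatype (atoms: 'a) rexp =
    Zero
  | One
  | Atom 'a
  | Plus "'a rexp" "'a rexp"
  | Times "'a rexp" "'a rexp"
  | Star "'a rexp"

primrec rlang :: "'a rexp \<Rightarrow> 'a lang" where
  "rlang Zero = {}"
| "rlang One = {[]}"
| "rlang (Atom a) = {[a]}"
| "rlang (Plus r s) = rlang r \<union> rlang s"
| "rlang (Times r s) = rlang r @@ rlang s"
| "rlang (Star r) = star (rlang r)"

primrec union_free :: "'a rexp \<Rightarrow> bool" where
  "union_free Zero = True"
| "union_free One = True"
| "union_free (Atom a) = True"
| "union_free (Plus r s) = False"
| "union_free (Times r s) = (union_free r \<and> union_free s)"
| "union_free (Star r) = union_free r"

(* A (complete) deterministic finite automaton over V with state set Z. *)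
definition is_dfa :: "'a set \<Rightarrow> 'q set \<Rightarrow> 'q \<Rightarrow> 'q set \<Rightarrow> ('q \<Rightarrow> 'a \<Rightarrow> 'q) \<Rightarrow> bool" where
  "is_dfa V Z z0 F \<delta> \<longleftrightarrow>
     finite Z \<and> z0 \<in> Z \<and> F \<subseteq> Z \<and> (\<forall>z\<in>Z. \<forall>a\<in>V. \<delta> z a \<in> Z)"

definition dfa_lang :: "'a set \<Rightarrow> 'q \<Rightarrow> 'q set \<Rightarrow> ('q \<Rightarrow> 'a \<Rightarrow> 'q) \<Rightarrow> 'a lang" where
  "dfa_lang V z0 F \<delta> = {w \<in> lists V. foldl \<delta> z0 w \<in> F}"


(* The prefix F_ is needed because INF is reserved syntax and 2COM is not an identifier. *)

definition F_REG :: "'a family" where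
  "F_REG V = {rlang r | r. atoms r \<subseteq> V}"

definition F_FIN :: "'a family" where
  "F_FIN V = {L. L \<subseteq> lists V \<and> finite L}"

definition F_MON :: "'a family" where
  "F_MON V = {L \<in> F_REG V. L = lists V}"

definition F_NIL :: "'a family" where
  "F_NIL V = {L \<in> F_REG V. finite L \<or> finite (lists V - L)}"

definition F_COMB :: "'a family" where
  "F_COMB V = {L \<in> F_REG V. \<exists>X. X \<subseteq> V \<and> L = lists V @@ {[a] | a. a \<in> X}}"

definition F_DEF :: "'a family" where
  "F_DEF V = {L \<in> F_REG V. \<exists>A B. finite A \<and> finite B \<and> A \<subseteq> lists V \<and> B \<subseteq> lists V \<and>
                                L = A \<union> lists V @@ B}"

definition F_SYDEF :: "'a family" where
  "F_SYDEF V = {L \<in> F_REG V. \<exists>E\<in>F_REG V. \<exists>H\<in>F_REG V. L = E @@ lists V @@ H}"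

definition F_INF :: "'a family" where
  "F_INF V = {L \<in> F_REG V. \<forall>x\<in>lists V. \<forall>y\<in>lists V. \<forall>z\<in>lists V. x @ y @ z \<in> L \<longrightarrow> y \<in> L}"

definition F_PRE :: "'a family" where
  "F_PRE V = {L \<in> F_REG V. \<forall>x\<in>lists V. \<forall>y\<in>lists V. x @ y \<in> L \<longrightarrow> x \<in> L}"

definition F_SUF :: "'a family" where
  "F_SUF V = {L \<in> F_REG V. \<forall>x\<in>lists V. \<forall>y\<in>lists V. x @ y \<in> L \<longrightarrow> y \<in> L}"

(* States are natural numbers without loss of generality, since Z is finite; the total
   order on Z is an arbitrary relation, unrelated to the order of the natural numbers. *)
definition F_ORD :: "'a family" where
  "F_ORD V = {L \<in> F_REG V. \<exists>(Z :: nat set) z0 F \<delta> ord.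
      is_dfa V Z z0 F \<delta> \<and> L = dfa_lang V z0 F \<delta> \<and> linear_order_on Z ord \<and>
      (\<forall>z z'. (z, z') \<in> ord \<longrightarrow> (\<forall>a\<in>V. (\<delta> z a, \<delta> z' a) \<in> ord))}"

definition F_COMM :: "'a family" where
  "F_COMM V = {L \<in> F_REG V. \<forall>w\<in>L. \<forall>w'. mset w' = mset w \<longrightarrow> w' \<in> L}"

definition F_CIRC :: "'a family" where
  "F_CIRC V = {L \<in> F_REG V. \<forall>w\<in>L. \<forall>n. rotate n w \<in> L}"

definition F_NC :: "'a family" where
  "F_NC V = {L \<in> F_REG V. \<exists>k\<ge>1. \<forall>x\<in>lists V. \<forall>y\<in>lists V. \<forall>z\<in>lists V.
      x @ wpow y k @ z \<in> L \<longleftrightarrow> x @ wpow y (k + 1) @ z \<in> L}"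

definition F_PS :: "'a family" where
  "F_PS V = {L \<in> F_REG V. \<exists>m\<ge>1. \<forall>x\<in>lists V.
      {wpow x n | n. n \<ge> m} \<inter> L = {} \<or> {wpow x n | n. n \<ge> m} \<subseteq> L}"

definition F_UF :: "'a family" where
  "F_UF V = {rlang r | r. atoms r \<subseteq> V \<and> union_free r}"

definition F_STAR :: "'a family" where
  "F_STAR V = {L \<in> F_REG V. \<exists>H\<in>F_REG V. L = star H}"

definition F_LCOM :: "'a family" where
  "F_LCOM V = {L \<in> F_REG V. \<exists>E\<in>F_REG V. \<exists>G\<in>F_REG V. G \<notin> {{}, {[]}} \<and> L = E @@ star G}"

definition F_RCOM :: "'a family" where
  "F_RCOM V = {L \<in> F_REG V. \<exists>G\<in>F_REG V. \<exists>H\<in>F_REG V. G \<notin> {{}, {[]}} \<and> L = star G @@ H}"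

definition F_2COM :: "'a family" where
  "F_2COM V = {L \<in> F_REG V. \<exists>E\<in>F_REG V. \<exists>G\<in>F_REG V. \<exists>H\<in>F_REG V.
      G \<notin> {{}, {[]}} \<and> L = E @@ star G @@ H}"


record 'a cgrammar =
  letters :: "'a set"
  selection :: "('a lang \<times> ('a word \<times> 'a word) set) set"
  axs :: "'a lang"

definition contextual_grammar :: "'a family \<Rightarrow> 'a cgrammar \<Rightarrow> bool" where
  "contextual_grammar \<F> G \<longleftrightarrow>
     alphabet (letters G) \<and>
     finite (axs G) \<and> axs G \<subseteq> lists (letters G) \<and>
     finite (selection G) \<and>
     (\<forall>(S, C) \<in> selection G.
        (\<exists>U. alphabet U \<and> U \<subseteq> letters G \<and> S \<in> \<F> U) \<and>
        finite C \<and> C \<subseteq> lists (letters G) \<times> lists (letters G) \<and>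
        (\<forall>(u, v) \<in> C. u @ v \<noteq> []))"

definition derives_in :: "'a cgrammar \<Rightarrow> 'a word \<Rightarrow> 'a word \<Rightarrow> bool" where
  "derives_in G x y \<longleftrightarrow>
     (\<exists>x1 x2 x3. x = x1 @ x2 @ x3 \<and>
        (\<exists>(S, C) \<in> selection G. \<exists>(u, v) \<in> C. x2 \<in> S \<and> y = x1 @ u @ x2 @ v @ x3))"

definition L_in :: "'a cgrammar \<Rightarrow> 'a lang" where
  "L_in G = {z. \<exists>x \<in> axs G. (derives_in G)\<^sup>*\<^sup>* x z}"

definition IC :: "'a family \<Rightarrow> 'a lang set" where
  "IC \<F> = {L_in G | G. contextual_grammar \<F> G}"


(* The node IC F of the graph is represented by its index F, and the edge from IC F to IC F'
   by the pair (F, F'). *)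

definition hierarchy_nodes :: "'a family set" where
  "hierarchy_nodes =
     {F_FIN, F_MON, F_COMB, F_NIL, F_DEF, F_ORD, F_SYDEF, F_INF,
      F_SUF, F_PRE, F_COMM, F_STAR, F_NC, F_PS, F_CIRC, F_REG}"

definition hierarchy_edges :: "('a family \<times> 'a family) set" where
  "hierarchy_edges =
     {(F_FIN, F_NIL), (F_MON, F_NIL), (F_MON, F_COMB), (F_MON, F_STAR), (F_MON, F_INF),
      (F_MON, F_COMM), (F_COMB, F_DEF), (F_COMB, F_SYDEF), (F_NIL, F_DEF), (F_DEF, F_ORD),
      (F_ORD, F_NC), (F_NC, F_PS), (F_SYDEF, F_PS), (F_INF, F_SUF), (F_INF, F_PRE),
      (F_SUF, F_PS), (F_PRE, F_PS), (F_PS, F_REG), (F_STAR, F_REG), (F_COMM, F_CIRC),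
      (F_CIRC, F_REG)}"

end

(* All inclusions but MON in COMB hold already for the families of selection languages. Every selection
   language of a grammar can be split into union-free parts, or padded with a power of a fresh letter,
   which gives the equalities.

   By monotonicity, 25 non-inclusions imply all others. For most of them a language S is encoded in a
   grammar with main selection pair (S, {(0,1)}), whose other contexts only allow words to grow in a
   balanced way. The balance makes 0 x 1 2^n with n = |x|, x in S, derivable only by inserting 0 and 1 around
   a large part y of x = p y q; hence if a family F suffices to generate the language, then S is up to
   finitely many words a finite union of languages p T q with T in F. For each pair of families some
   regular language S is not of this form, for instance the words over {5,6} that contain 6 for ORD and
   DEF. FIN and COMB on the left-hand side are treated with separate grammars. *)
theory Submission
  imports Defs
begin

text \<open>The grammar that encodes \<open>S\<close> has a pair selecting all words, so it lies in
  \<open>IC F\<close> only if \<open>F\<close> contains \<open>F_MON\<close>. Neither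
  \<open>F_FIN\<close> nor \<open>F_COMB\<close> does; combinational languages lack the empty word.
  Moreover, being covered by languages \<open>p T q\<close> says nothing about finite
  \<open>S\<close>, nor about combinational \<open>S\<close> against \<open>F_NIL\<close>: all words
  over \<open>V\<close> that end in \<open>a\<close> are \<open>p T q\<close> with
  \<open>T = lists V\<close>, \<open>p = []\<close> and \<open>q = [a]\<close>. So these two
  families need grammars of their own. Elsewhere a witness \<open>S\<close> has to resist what a
  grammar can hide: finitely many exceptions, finite unions, and short prefixes and suffixes moved
  from the selected word into the contexts. Its distinguishing feature must survive the removal of
  such ends. \<open>F_ORD\<close> is the hardest opponent, because several ordered automata may
  share the work. One \<open>T\<close> is singled out that stays responsible whatever is read, and
  monotonicity is exploited inside a strongly connected part of its automaton.\<close>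

lemma concI: "x \<in> A \<Longrightarrow> y \<in> B \<Longrightarrow> x @ y \<in> A @@ B"
  by (auto simp: conc_def)

lemma star_iff: "w \<in> star A \<longleftrightarrow> (\<exists>ws. set ws \<subseteq> A \<and> w = concat ws)"
  by (auto simp: star_def)

lemma Nil_in_star: "[] \<in> star A"
  unfolding star_iff by (intro exI[of _ "[]"]) auto

lemma star_step: "x \<in> A \<Longrightarrow> y \<in> star A \<Longrightarrow> x @ y \<in> star A"
  unfolding star_iff by (elim exE conjE, rule_tac x="x # ws" in exI) auto

lemma star_append: "x \<in> star A \<Longrightarrow> y \<in> star A \<Longrightarrow> x @ y \<in> star A"
  unfolding star_iff by (elim exE conjE, rule_tac x="ws @ wsa" in exI) auto

lemma star_induct [consumes 1, case_names Nil step]: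
  assumes "w \<in> star A" "P []" "\<And>x y. x \<in> A \<Longrightarrow> y \<in> star A \<Longrightarrow> P y \<Longrightarrow> P (x @ y)"
  shows "P w"
proof -
  have "set ws \<subseteq> A \<Longrightarrow> P (concat ws)" for ws
    by (induction ws) (use assms(2,3) in \<open>auto simp: star_iff\<close>)
  with assms(1) show ?thesis by (auto simp: star_iff)
qed

lemma star_letters: "star {[a] |a. a \<in> V} = lists V"
proof (intro equalityI subsetI)
  fix w assume "w \<in> star {[a] |a. a \<in> V}" then show "w \<in> lists V"
    by (induction rule: star_induct) auto
next
  fix w assume "w \<in> lists V" then show "w \<in> star {[a] |a. a \<in> V}"
  proof (induction w)
    case (Cons a w) then show ?case using star_step[of "[a]" _ w] by auto
  qed (simp add: Nil_in_star)
qed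

lemma star_mono_lists: "A \<subseteq> lists V \<Longrightarrow> star A \<subseteq> lists V"
proof
  fix w assume "A \<subseteq> lists V" "w \<in> star A"
  from this(2,1) show "w \<in> lists V" by (induction rule: star_induct) (auto dest: subsetD)
qed

lemma rlang_lists: "rlang r \<subseteq> lists (atoms r)"
proof (induction r)
  case (Star r) then show ?case using star_mono_lists by (metis rexp.set(6) rlang.simps(6))
next
  case (Times r s) then show ?case
    by (fastforce simp: conc_def dest: subsetD)
next
  case (Plus r s) then show ?case by (fastforce dest: subsetD)
qed auto

lemma REG_lists: "L \<in> F_REG V \<Longrightarrow> L \<subseteq> lists V"
  using rlang_lists unfolding F_REG_def by (fastforce dest: subsetD)

lemma REG_empty: "{} \<in> F_REG V"
  unfolding F_REG_def by (intro CollectI exI[of _ Zero]) auto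
lemma REG_Nil: "{[]} \<in> F_REG V"
  unfolding F_REG_def by (intro CollectI exI[of _ One]) auto
lemma REG_letter: "a \<in> V \<Longrightarrow> {[a]} \<in> F_REG V"
  unfolding F_REG_def by (intro CollectI exI[of _ "Atom a"]) auto
lemma REG_union: "A \<in> F_REG V \<Longrightarrow> B \<in> F_REG V \<Longrightarrow> A \<union> B \<in> F_REG V"
  unfolding F_REG_def by (elim CollectE exE conjE, intro CollectI, rule_tac x="Plus r ra" in exI) auto
lemma REG_conc: "A \<in> F_REG V \<Longrightarrow> B \<in> F_REG V \<Longrightarrow> A @@ B \<in> F_REG V"
  unfolding F_REG_def by (elim CollectE exE conjE, intro CollectI, rule_tac x="Times r ra" in exI) auto
lemma REG_star: "A \<in> F_REG V \<Longrightarrow> star A \<in> F_REG V"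
  unfolding F_REG_def by (elim CollectE exE conjE, intro CollectI, rule_tac x="Star r" in exI) auto
lemma REG_mono: "V \<subseteq> W \<Longrightarrow> F_REG V \<subseteq> F_REG W"
  unfolding F_REG_def by blast

lemma REG_word: "w \<in> lists V \<Longrightarrow> {w} \<in> F_REG V"
proof (induction w)
  case (Cons a w)
  have "{a # w} = {[a]} @@ {w}" by (auto simp: conc_def)
  with Cons show ?case using REG_conc REG_letter by (metis Cons_in_lists_iff)
qed (simp add: REG_Nil)

lemma REG_finite: "finite L \<Longrightarrow> L \<subseteq> lists V \<Longrightarrow> L \<in> F_REG V"
proof (induction rule: finite_induct)
  case (insert w L) then show ?case using REG_union[OF REG_word[of w] insert.IH] by simp
qed (simp add: REG_empty)

lemma REG_lists_full: assumes "finite V" shows "lists V \<in> F_REG V"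
proof -
  have "{[a] |a. a \<in> V} \<in> F_REG V"
    by (rule REG_finite) (use assms in auto)
  from REG_star[OF this] show ?thesis by (simp add: star_letters)
qed

lemma wpow_0: "wpow x 0 = []" and wpow_Suc: "wpow x (Suc n) = x @ wpow x n"
  by (simp_all add: wpow_def)

lemma wpow_add: "wpow x (m + n) = wpow x m @ wpow x n"
  by (simp add: wpow_def replicate_add)

lemma wpow_Suc2: "wpow x (Suc n) = wpow x n @ x"
  using wpow_add[of x n 1] by (simp add: wpow_def)

lemma wpow_letter: "wpow [a] n = replicate n a"
  by (induction n) (auto simp: wpow_def)

lemma wpow_Nil: "wpow [] n = []" by (simp add: wpow_def)

lemma wpow_lists: "x \<in> lists V \<Longrightarrow> wpow x n \<in> lists V"
  by (induction n) (auto simp: wpow_0 wpow_Suc)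

lemma star_singleton: "star {x} = {wpow x n |n. True}"
proof (intro equalityI subsetI)
  fix w assume "w \<in> star {x}" then show "w \<in> {wpow x n |n. True}"
  proof (induction rule: star_induct)
    case Nil then show ?case by (auto intro: exI[of _ 0] simp: wpow_0)
  next
    case (step x' y) then show ?case by (auto simp: wpow_Suc[symmetric])
  qed
next
  fix w assume "w \<in> {wpow x n |n. True}"
  then obtain n where "w = wpow x n" by auto
  moreover have "wpow x n \<in> star {x}"
    by (induction n) (auto simp: wpow_0 wpow_Suc Nil_in_star star_step)
  ultimately show "w \<in> star {x}" by simp
qed

subsection \<open>Left quotients of regular languages\<close>

text \<open>The Myhill-Nerode quotients. \<open>F_REG\<close> is given by expressions, and
  finiteness of the number of quotients yields pumping without the construction of an
  automaton.\<close>

definition quot :: "'a word \<Rightarrow> 'a lang \<Rightarrow> 'a lang" where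
  "quot u L = {w. u @ w \<in> L}"

text \<open>\<open>u\<close> either ends inside the factor from \<open>A\<close> or already contains
  all of it; in the latter case the rest of \<open>u\<close> is a prefix of the factor from
  \<open>B\<close>.\<close>

lemma quot_conc_cases:
  "quot u (A @@ B) = quot u A @@ B \<union> \<Union>{quot u2 B |u1 u2. u = u1 @ u2 \<and> u1 \<in> A}"
proof (intro equalityI subsetI)
  fix w assume "w \<in> quot u (A @@ B)"
  then obtain x y where "u @ w = x @ y" "x \<in> A" "y \<in> B" by (auto simp: quot_def conc_def)
  then show "w \<in> quot u A @@ B \<union> \<Union>{quot u2 B |u1 u2. u = u1 @ u2 \<and> u1 \<in> A}"
    by (auto simp: append_eq_append_conv2 quot_def conc_def) blast
next
  fix w assume "w \<in> quot u A @@ B \<union> \<Union>{quot u2 B |u1 u2. u = u1 @ u2 \<and> u1 \<in> A}"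
  then consider x y where "w = x @ y" "u @ x \<in> A" "y \<in> B"
    | u1 u2 where "u = u1 @ u2" "u1 \<in> A" "u2 @ w \<in> B"
    by (fastforce simp: quot_def conc_def)
  then show "w \<in> quot u (A @@ B)"
    by cases (use concI[of "u @ _" A] concI in \<open>fastforce simp: quot_def\<close>)+
qed

text \<open>\<open>u\<close> is cut at a block boundary: \<open>u1\<close> consists of completed
  blocks, and \<open>u2\<close> is the nonempty beginning of the block in which \<open>u\<close>
  ends.\<close>

lemma quot_star:
  "quot u (star A) =
     (if u = [] then star A else {}) \<union> \<Union>{quot u2 A @@ star A |u1 u2. u = u1 @ u2 \<and> u2 \<noteq> [] \<and> u1 \<in> star A}"
proof (intro equalityI subsetI)
  fix w assume "w \<in> quot u (star A)"
  then obtain ws where ws: "u @ w = concat ws" "set ws \<subseteq> A" by (auto simp: quot_def star_iff)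
  have "u = [] \<and> w \<in> star A \<or>
        (\<exists>u1 u2. u = u1 @ u2 \<and> u2 \<noteq> [] \<and> u1 \<in> star A \<and> w \<in> quot u2 A @@ star A)"
    using ws
  proof (induction ws arbitrary: u)
    case Nil then show ?case by (simp add: Nil_in_star)
  next
    case (Cons x ws)
    show ?case
    proof (cases "u = []")
      case True then show ?thesis using Cons.prems by (auto simp: star_iff intro!: exI[of _ "x # ws"])
    next
      case False
      from Cons.prems consider t where "u = x @ t" "t @ w = concat ws"
        | t where "x = u @ t" "w = t @ concat ws"
        by (auto simp: append_eq_append_conv2)
      then show ?thesis
      proof cases
        case 1
        from Cons.IH[OF 1(2)] Cons.prems consider "t = []" "w \<in> star A"
          | u1 u2 where "t = u1 @ u2" "u2 \<noteq> []" "u1 \<in> star A" "w \<in> quot u2 A @@ star A" by auto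
        then show ?thesis
        proof cases
          \<comment> \<open>\<open>u\<close> ends exactly between two blocks. As \<open>u2\<close>
            must not be empty, all of \<open>u\<close> is taken as the beginning of the block
            \<open>x\<close>.\<close>
          case a: 1
          have "w \<in> quot u A @@ star A"
            using 1 a Cons.prems concI[of "[]" "quot u A" w] by (auto simp: quot_def)
          then show ?thesis using False Nil_in_star by (metis append_Nil)
        next
          case a: 2
          then show ?thesis using 1 Cons.prems
            by (intro disjI2 exI[of _ "x @ u1"] exI[of _ u2]) (auto intro: star_step)
        qed
      next
        case 2
        then have "w \<in> quot u A @@ star A"
          using Cons.prems using concI[of t "quot u A" "concat ws" "star A"] by (auto simp: quot_def star_iff)
        then show ?thesis using False Nil_in_star by (metis append_Nil)
      qed
    qed
  qed
  then show "w \<in> (if u = [] then star A else {}) \<union> \<Union>{quot u2 A @@ star A |u1 u2. u = u1 @ u2 \<and> u2 \<noteq> [] \<and> u1 \<in> star A}"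
    by auto
next
  fix w assume "w \<in> (if u = [] then star A else {}) \<union> \<Union>{quot u2 A @@ star A |u1 u2. u = u1 @ u2 \<and> u2 \<noteq> [] \<and> u1 \<in> star A}"
  then consider "u = []" "w \<in> star A"
    | u1 u2 x y where "u = u1 @ u2" "u1 \<in> star A" "u2 @ x \<in> A" "y \<in> star A" "w = x @ y"
    by (fastforce simp: quot_def conc_def split: if_splits)
  then show "w \<in> quot u (star A)"
  proof cases
    case 2
    then show ?thesis using star_append[OF 2(2) star_step[OF 2(3,4)]] by (simp add: quot_def)
  qed (simp add: quot_def)
qed

text \<open>By the two decompositions a quotient of a compound expression is determined by
  quotients, or sets of quotients, of its parts, and a finite set has only finitely many
  subsets.\<close>

lemma finite_quots: "finite (range (\<lambda>u. quot u (rlang r)))"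
proof (induction r)
  case Zero
  have "range (\<lambda>u. quot u (rlang Zero)) \<subseteq> {{}}" by (auto simp: quot_def)
  then show ?case by (rule finite_subset) simp
next
  case One
  have "range (\<lambda>u. quot u (rlang One)) \<subseteq> {{}, {[]}}" by (auto simp: quot_def)
  then show ?case by (rule finite_subset) simp
next
  case (Atom a)
  have "range (\<lambda>u. quot u (rlang (Atom a))) \<subseteq> {{}, {[]}, {[a]}}"
    by (auto simp: quot_def append_eq_Cons_conv Cons_eq_append_conv)
  then show ?case by (rule finite_subset) simp
next
  case (Plus r s)
  have "range (\<lambda>u. quot u (rlang (Plus r s))) \<subseteq>
     (\<lambda>(A, B). A \<union> B) ` (range (\<lambda>u. quot u (rlang r)) \<times> range (\<lambda>u. quot u (rlang s)))"
  proof (intro image_subsetI)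
    fix u
    show "quot u (rlang (Plus r s)) \<in>
      (\<lambda>(A, B). A \<union> B) ` (range (\<lambda>u. quot u (rlang r)) \<times> range (\<lambda>u. quot u (rlang s)))"
      by (rule image_eqI[of _ _ "(quot u (rlang r), quot u (rlang s))"]) (auto simp: quot_def)
  qed
  then show ?case by (rule finite_subset) (use Plus in auto)
next
  case (Times r s)
  have "range (\<lambda>u. quot u (rlang (Times r s))) \<subseteq>
     (\<lambda>(A, BS). A @@ rlang s \<union> \<Union>BS) ` (range (\<lambda>u. quot u (rlang r)) \<times> Pow (range (\<lambda>u. quot u (rlang s))))"
  proof
    fix X assume "X \<in> range (\<lambda>u. quot u (rlang (Times r s)))"
    then obtain u where "X = quot u (rlang r @@ rlang s)" by auto
    then have "X = (\<lambda>(A, BS). A @@ rlang s \<union> \<Union>BS)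
       (quot u (rlang r), {quot u2 (rlang s) |u1 u2. u = u1 @ u2 \<and> u1 \<in> rlang r})"
      by (simp add: quot_conc_cases)
    then show "X \<in> (\<lambda>(A, BS). A @@ rlang s \<union> \<Union>BS) ` (range (\<lambda>u. quot u (rlang r)) \<times> Pow (range (\<lambda>u. quot u (rlang s))))"
      by (rule image_eqI) auto
  qed
  then show ?case by (rule finite_subset) (use Times in auto)
next
  case (Star r)
  let ?F = "\<lambda>(b, BS). (if b then star (rlang r) else {}) \<union> \<Union>((\<lambda>B. B @@ star (rlang r)) ` BS)"
  have "range (\<lambda>u. quot u (rlang (Star r))) \<subseteq> ?F ` (UNIV \<times> Pow (range (\<lambda>u. quot u (rlang r))))"
  proof
    fix X assume "X \<in> range (\<lambda>u. quot u (rlang (Star r)))"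
    then obtain u where "X = quot u (star (rlang r))" by auto
    then have "X = ?F (u = [], {quot u2 (rlang r) |u1 u2. u = u1 @ u2 \<and> u2 \<noteq> [] \<and> u1 \<in> star (rlang r)})"
      unfolding quot_star by fastforce
    then show "X \<in> ?F ` (UNIV \<times> Pow (range (\<lambda>u. quot u (rlang r))))"
      by (rule image_eqI) auto
  qed
  then show ?case by (rule finite_subset) (use Star in auto)
qed

text \<open>Pigeonhole: there are more exponents up to \<open>N\<close> than quotients. The bound is
  the same for all \<open>p\<close> and \<open>x\<close>.\<close>

lemma REG_pump_power:
  assumes "L \<in> F_REG V"
  shows "\<exists>N\<ge>1. \<forall>p x. \<exists>i j. i < j \<and> j \<le> N \<and>
           (\<forall>w. p @ wpow x i @ w \<in> L \<longleftrightarrow> p @ wpow x j @ w \<in> L)"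
proof -
  from assms obtain r where L: "L = rlang r" by (auto simp: F_REG_def)
  let ?Q = "range (\<lambda>u. quot u L)"
  have fin: "finite ?Q" unfolding L by (rule finite_quots)
  have "\<exists>i j. i < j \<and> j \<le> card ?Q \<and> (\<forall>w. p @ wpow x i @ w \<in> L \<longleftrightarrow> p @ wpow x j @ w \<in> L)" for p x
  proof -
    let ?f = "\<lambda>i. quot (p @ wpow x i) L"
    have "card (?f ` {..card ?Q}) \<le> card ?Q" by (rule card_mono[OF fin]) auto
    then have "\<not> inj_on ?f {..card ?Q}" by (auto dest: card_image)
    then obtain i j where ij: "i \<le> card ?Q" "j \<le> card ?Q" "?f i = ?f j" "i \<noteq> j" by (auto simp: inj_on_def)
    then have *: "p @ wpow x i @ w \<in> L \<longleftrightarrow> p @ wpow x j @ w \<in> L" for w by (auto simp: quot_def set_eq_iff)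
    show ?thesis
      using ij(1,2,4) * by (cases "i < j") (metis, metis linorder_neqE_nat)
  qed
  moreover have "card ?Q \<ge> 1" using fin by (simp add: Suc_leI card_gt_0_iff)
  ultimately show ?thesis by blast
qed

section \<open>Inclusions of families of regular languages\<close>

lemma FIN_NIL: "F_FIN V \<subseteq> F_NIL V"
  by (auto simp: F_FIN_def F_NIL_def REG_finite)

lemma MON_NIL: "F_MON V \<subseteq> F_NIL V"
  by (auto simp: F_MON_def F_NIL_def)

lemma MON_STAR: assumes "finite V" shows "F_MON V \<subseteq> F_STAR V"
proof -
  have "{[a] |a. a \<in> V} \<in> F_REG V" by (rule REG_finite) (use assms in auto)
  then show ?thesis unfolding F_MON_def F_STAR_def using star_letters by blast
qed

lemma MON_INF: "F_MON V \<subseteq> F_INF V"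
  by (auto simp: F_MON_def F_INF_def)

lemma MON_COMM: "F_MON V \<subseteq> F_COMM V"
  by (auto simp: F_MON_def F_COMM_def in_lists_conv_set dest: mset_eq_setD)

lemma COMB_DEF: assumes "finite V" shows "F_COMB V \<subseteq> F_DEF V"
proof
  fix L assume "L \<in> F_COMB V"
  then obtain X where X: "L \<in> F_REG V" "X \<subseteq> V" "L = lists V @@ {[a] |a. a \<in> X}"
    by (auto simp: F_COMB_def)
  moreover have "finite {[a] |a. a \<in> X}" using finite_subset[OF X(2) assms] by simp
  moreover have "{[a] |a. a \<in> X} \<subseteq> lists V" using X(2) by auto
  ultimately show "L \<in> F_DEF V"
    unfolding F_DEF_def by (intro CollectI conjI exI[of _ "{}"] exI[of _ "{[a] |a. a \<in> X}"]) auto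
qed

lemma conc_Nil_left: "{[]} @@ A = A" and conc_Nil_right: "A @@ {[]} = A"
  by (auto simp: conc_def)

lemma COMB_SYDEF: assumes "finite V" shows "F_COMB V \<subseteq> F_SYDEF V"
proof
  fix L assume "L \<in> F_COMB V"
  then obtain X where X: "L \<in> F_REG V" "X \<subseteq> V" "L = lists V @@ {[a] |a. a \<in> X}"
    by (auto simp: F_COMB_def)
  have "{[a] |a. a \<in> X} \<in> F_REG V"
    using finite_subset[OF X(2) assms] X(2) by (intro REG_finite) auto
  then show "L \<in> F_SYDEF V"
    unfolding F_SYDEF_def using X(1,3) REG_Nil[of V] conc_Nil_left by blast
qed

lemma NIL_DEF: assumes "finite V" shows "F_NIL V \<subseteq> F_DEF V"
proof
  fix L assume "L \<in> F_NIL V"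
  then have L: "L \<in> F_REG V" "finite L \<or> finite (lists V - L)" by (auto simp: F_NIL_def)
  note LV = REG_lists[OF L(1)]
  show "L \<in> F_DEF V"
  proof (cases "finite L")
    case True
    then show ?thesis using L LV unfolding F_DEF_def
      by (intro CollectI conjI exI[of _ L] exI[of _ "{}"]) (auto simp: conc_def)
  next
    case False
    \<comment> \<open>Exceeds the length of every missing word, so all words of length at least
      \<open>n\<close> are in \<open>L\<close>.\<close>
    define n where "n = Suc (\<Sum>w\<in>lists V - L. length w)"
    have n: "w \<in> L" if "w \<in> lists V" "length w \<ge> n" for w
    proof (rule ccontr)
      assume "w \<notin> L"
      then have "length w \<le> (\<Sum>w\<in>lists V - L. length w)"
        using False L that by (intro member_le_sum) auto
      with that(2) show False by (simp add: n_def)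
    qed
    let ?A = "{w \<in> L. length w < n}" and ?B = "{w. set w \<subseteq> V \<and> length w = n}"
    have "finite {w. set w \<subseteq> V \<and> length w \<le> n}" by (rule finite_lists_length_le[OF assms])
    then have "finite ?A" by (rule rev_finite_subset) (use LV in \<open>auto simp: subset_iff less_imp_le\<close>)
    moreover have "finite ?B" by (rule finite_lists_length_eq[OF assms])
    moreover have "L = ?A \<union> lists V @@ ?B"
    proof (intro equalityI subsetI)
      fix w assume w: "w \<in> L"
      show "w \<in> ?A \<union> lists V @@ ?B"
      proof (cases "length w < n")
        case False
        have "take (length w - n) w @ drop (length w - n) w \<in> lists V @@ ?B"
          using False w LV by (intro concI) (auto dest: in_set_takeD in_set_dropD)
        then show ?thesis by simp
      qed (use w in simp)
    next
      fix w assume "w \<in> ?A \<union> lists V @@ ?B"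
      then consider "w \<in> L" | x y where "w = x @ y" "x \<in> lists V" "y \<in> ?B" by (auto simp: conc_def)
      then show "w \<in> L" by cases (simp, rule n, auto)
    qed
    moreover have "?A \<subseteq> lists V" "?B \<subseteq> lists V" using LV by auto
    ultimately show ?thesis using L(1) unfolding F_DEF_def by blast
  qed
qed

section \<open>Definite languages are accepted by ordered automata\<close>

text \<open>The first \<open>n\<close> letters of \<open>r\<close> as digits of a number in base
  \<open>B\<close>, padded with zeros. A letter \<open>a\<close> becomes the digit
  \<open>a + 1\<close>, so that 0 stands for a missing letter and short words keep their
  length.\<close>

primrec code :: "nat \<Rightarrow> nat \<Rightarrow> nat word \<Rightarrow> nat" where
  "code B 0 r = 0"
| "code B (Suc n) r = (case r of [] \<Rightarrow> 0 | a # r' \<Rightarrow> Suc a * B ^ n + code B n r')"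

lemma code_bound: "\<forall>a\<in>set r. Suc a < B \<Longrightarrow> 0 < B \<Longrightarrow> code B n r < B ^ n"
proof (induction n arbitrary: r)
  case (Suc n)
  show ?case
  proof (cases r)
    case (Cons a r')
    have "code B n r' < B ^ n" using Suc.IH[of r'] Suc.prems Cons by simp
    then have "Suc a * B ^ n + code B n r' < Suc (Suc a) * B ^ n" by simp
    also have "\<dots> \<le> B * B ^ n" using Suc.prems Cons by (intro mult_right_mono) auto
    finally show ?thesis using Cons by simp
  qed (use Suc.prems in simp)
qed simp

text \<open>Division by \<open>B\<close> drops the last digit, which is the letter read longest ago
  if \<open>r\<close> is a reversed word.\<close>

lemma code_div: "\<forall>a\<in>set r. Suc a < B \<Longrightarrow> 0 < B \<Longrightarrow> code B (Suc n) r div B = code B n r"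
proof (induction n arbitrary: r)
  case 0 then show ?case using code_bound[of r B 1] by simp
next
  case (Suc n)
  show ?case
  proof (cases r)
    case (Cons a r')
    have "code B (Suc (Suc n)) r = (Suc a * B ^ n) * B + code B (Suc n) r'" using Cons by (simp add: algebra_simps)
    then have "code B (Suc (Suc n)) r div B = Suc a * B ^ n + code B (Suc n) r' div B"
      using Suc.prems by (simp del: code.simps)
    also have "code B (Suc n) r' div B = code B n r'" using Suc.IH[of r'] Suc.prems Cons by simp
    finally show ?thesis using Cons by simp
  qed simp
qed

text \<open>The remaining digits amount to less than \<open>B ^ n\<close> by
  \<open>code_bound\<close>, so division by \<open>B ^ n\<close> recovers the leading digit.\<close>

lemma code_inj:
  assumes "\<forall>a\<in>set r. Suc a < B" "\<forall>a\<in>set s. Suc a < B" "0 < B" "code B n r = code B n s"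
  shows "take n r = take n s"
  using assms
proof (induction n arbitrary: r s)
  case (Suc n)
  have lt: "code B n r' < B ^ n" if "set r' \<subseteq> set r \<union> set s" for r'
    using that Suc.prems by (intro code_bound) auto
  have pos: "B ^ n > 0" using Suc.prems by simp
  show ?case
  proof (cases r)
    case Nil
    then show ?thesis using Suc.prems(4) pos by (cases s) auto
  next
    case (Cons a r')
    show ?thesis
    proof (cases s)
      case Nil
      then show ?thesis using Suc.prems(4) pos Cons by auto
    next
      case (Cons b s')
      have eq: "Suc a * B ^ n + code B n r' = Suc b * B ^ n + code B n s'"
        using Suc.prems(4) \<open>r = a # r'\<close> Cons by simp
      have "(Suc a * B ^ n + code B n r') div B ^ n = Suc a"
        using lt[of r'] pos \<open>r = a # r'\<close> by (subst div_mult_self3) (auto simp: subset_iff)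
      moreover have "(Suc b * B ^ n + code B n s') div B ^ n = Suc b"
        using lt[of s'] pos Cons by (subst div_mult_self3) (auto simp: subset_iff)
      ultimately have "a = b" unfolding eq by simp
      with eq have "code B n r' = code B n s'" by simp
      then have "take n r' = take n s'" using Suc.prems \<open>r = a # r'\<close> Cons by (intro Suc.IH) auto
      then show ?thesis using \<open>a = b\<close> \<open>r = a # r'\<close> Cons by simp
    qed
  qed
qed simp

text \<open>A definite language is accepted by the automaton that remembers the last \<open>n\<close> letters as the
  digits of a number, the most recent letter being the leading digit. Reading \<open>a\<close> is the map
  \<open>s \<mapsto> s div B + (a + 1) B\<^sup>n\<^sup>-\<^sup>1\<close>, which is monotone.\<close>

lemma DEF_ORD: fixes V :: "nat set" assumes V: "finite V" shows "F_DEF V \<subseteq> F_ORD V"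
proof
  fix L assume "L \<in> F_DEF V"
  then obtain A C where L: "L \<in> F_REG V" "finite A" "finite C" "A \<subseteq> lists V" "C \<subseteq> lists V"
      "L = A \<union> lists V @@ C" by (auto simp: F_DEF_def)
  define n where "n = (\<Sum>w\<in>A \<union> C. length w)"
  have n: "length w \<le> n" if "w \<in> A \<union> C" for w
    using that L(2,3) unfolding n_def by (intro member_le_sum) auto
  define B where "B = Suc (Suc (\<Sum>a\<in>V. a))"
  have B: "Suc a < B" if "a \<in> V" for a
    using member_le_sum[of a V "\<lambda>a. a"] that V by (simp add: B_def)
  have B0: "0 < B" by (simp add: B_def)
  define \<delta> where "\<delta> s a = s div B + Suc a * B ^ n" for s a
  \<comment> \<open>The window has \<open>n + 1\<close> letters, one more than the bound on the
    words of \<open>A\<close> and \<open>C\<close>, and so shows whether the whole word read has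
    length at most \<open>n\<close>.\<close>
  define st where "st w = code B (Suc n) (rev w)" for w
  have \<delta>_st: "\<delta> (st w) a = st (w @ [a])" if "set w \<subseteq> V" "a \<in> V" for w a
    using code_div[of "rev w" B n] that B B0 by (auto simp: \<delta>_def st_def)
  have fold: "foldl \<delta> 0 w = st w" if "set w \<subseteq> V" for w
    using that
  proof (induction w rule: rev_induct)
    case Nil then show ?case by (simp add: st_def)
  next
    case (snoc a w) then show ?case using \<delta>_st[of w a] by simp
  qed
  have st_eq: "w' \<in> L" if "w \<in> L" "set w \<subseteq> V" "set w' \<subseteq> V" "st w = st w'" for w w'
  proof -
    from code_inj[of "rev w" B "rev w'" "Suc n"] that B B0
    have tk: "take (Suc n) (rev w) = take (Suc n) (rev w')" by (auto simp: st_def)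
    show ?thesis
    proof (cases "length w \<le> n")
      case True
      then have "length (take (Suc n) (rev w')) \<le> n" by (subst tk[symmetric]) simp
      then have "length w' \<le> n" by simp
      then have "w = w'" using tk True by simp
      then show ?thesis using that(1) by simp
    next
      case False
      \<comment> \<open>A word longer than \<open>n\<close> is not in \<open>A\<close>, and its
        suffix in \<open>C\<close> is visible in the window.\<close>
      with that(1) n L(6) obtain p c where c: "w = p @ c" "c \<in> C" by (fastforce simp: conc_def)
      have "take (length c) (rev w') = take (length c) (take (Suc n) (rev w'))"
        using n[of c] c by (simp add: min_def)
      also have "\<dots> = rev c" unfolding tk[symmetric] using n[of c] c by (simp add: min_def)
      finally have "rev w' = rev c @ drop (length c) (rev w')" by (metis append_take_drop_id)
      then have "w' = rev (drop (length c) (rev w')) @ c" by (metis rev_append rev_rev_ident)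
      then show ?thesis
        using L(6) c(2) that(3) by (metis UnCI concI in_lists_conv_set le_sup_iff set_append subsetD)
    qed
  qed
  have Z: "\<delta> s a < B ^ Suc n" if "a \<in> V" "s < B ^ Suc n" for s a
  proof -
    have "s div B < B ^ n" using that(2) by (simp add: less_mult_imp_div_less mult.commute)
    then have "\<delta> s a < Suc (Suc a) * B ^ n" by (simp add: \<delta>_def)
    also have "\<dots> \<le> B * B ^ n" using B[OF that(1)] by (intro mult_right_mono) auto
    finally show ?thesis by simp
  qed
  have stZ: "st w < B ^ Suc n" if "set w \<subseteq> V" for w
    unfolding st_def using that B B0 by (intro code_bound) auto
  let ?Z = "{..<B ^ Suc n}"
  have "is_dfa V ?Z 0 (st ` L) \<delta>"
    unfolding is_dfa_def using Z stZ B0 REG_lists[OF L(1)]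
    by (auto simp: in_lists_conv_set subset_iff simp del: power_Suc)
  moreover have "L = dfa_lang V 0 (st ` L) \<delta>"
  proof (intro equalityI subsetI)
    fix w assume "w \<in> L"
    then show "w \<in> dfa_lang V 0 (st ` L) \<delta>"
      using REG_lists[OF L(1)] fold[of w] by (auto simp: dfa_lang_def in_lists_conv_set subset_iff)
  next
    fix w assume "w \<in> dfa_lang V 0 (st ` L) \<delta>"
    then have "set w \<subseteq> V" "foldl \<delta> 0 w \<in> st ` L" by (auto simp: dfa_lang_def)
    then have "set w \<subseteq> V" "st w \<in> st ` L" using fold[of w] by auto
    then show "w \<in> L" using st_eq[of _ w] REG_lists[OF L(1)] by fastforce
  qed
  moreover have "linear_order_on ?Z {(x, y). x \<le> y \<and> y \<in> ?Z}"
    by (auto simp: linear_order_on_def partial_order_on_def preorder_on_def refl_on_def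
        trans_def antisym_def total_on_def)
  moreover have "(\<delta> z a, \<delta> z' a) \<in> {(x, y). x \<le> y \<and> y \<in> ?Z}"
    if "(z, z') \<in> {(x, y). x \<le> y \<and> y \<in> ?Z}" "a \<in> V" for z z' a
    using that Z by (auto simp: \<delta>_def div_le_mono)
  ultimately show "L \<in> F_ORD V" using L(1) unfolding F_ORD_def by blast
qed

section \<open>Ordered automata and non-counting languages\<close>

text \<open>The rank of an element is the number of elements strictly below it. It turns an
  arbitrary order on the states into a comparison of numbers.\<close>

lemma linear_order_rank:
  assumes "finite Z" "linear_order_on Z r"
  obtains f :: "'a \<Rightarrow> nat" where "inj_on f Z" "\<And>x y. x \<in> Z \<Longrightarrow> y \<in> Z \<Longrightarrow> (x, y) \<in> r \<longleftrightarrow> f x \<le> f y"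
proof -
  define f where "f x = card {z \<in> Z. (z, x) \<in> r \<and> z \<noteq> x}" for x
  from assms(2) have r: "\<And>x. x \<in> Z \<Longrightarrow> (x, x) \<in> r" "trans r" "antisym r" "total_on Z r"
    by (auto simp: order_on_defs refl_on_def)
  have less: "f x < f y" if "x \<in> Z" "y \<in> Z" "(x, y) \<in> r" "x \<noteq> y" for x y
    unfolding f_def
  proof (rule psubset_card_mono)
    show "{z \<in> Z. (z, x) \<in> r \<and> z \<noteq> x} \<subset> {z \<in> Z. (z, y) \<in> r \<and> z \<noteq> y}"
      using that r(2,3) by (auto dest: transD antisymD)
  qed (use assms(1) in simp)
  have iff: "(x, y) \<in> r \<longleftrightarrow> f x \<le> f y" if "x \<in> Z" "y \<in> Z" for x y
    using less[OF that] less[OF that(2,1)] r(1)[OF that(1)] r(4) that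
    unfolding total_on_def by (metis leD less_imp_le order_refl)
  moreover have "inj_on f Z"
  proof (rule inj_onI, rule ccontr)
    fix x y assume "x \<in> Z" "y \<in> Z" "f x = f y" "x \<noteq> y"
    then show False using less[of x y] less[of y x] r(4) by (auto simp: total_on_def)
  qed
  ultimately show thesis using that by blast
qed

text \<open>\<open>f\<close> stands for the total order of \<open>F_ORD\<close>: states are compared
  by their ranks.\<close>

definition ordered_dfa :: "'a set \<Rightarrow> nat set \<Rightarrow> nat \<Rightarrow> nat set \<Rightarrow> (nat \<Rightarrow> 'a \<Rightarrow> nat) \<Rightarrow> (nat \<Rightarrow> nat) \<Rightarrow> bool" where
  "ordered_dfa V Z z0 F \<delta> f \<longleftrightarrow> is_dfa V Z z0 F \<delta> \<and> inj_on f Z \<and>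
     (\<forall>x\<in>Z. \<forall>y\<in>Z. \<forall>a\<in>V. f x \<le> f y \<longrightarrow> f (\<delta> x a) \<le> f (\<delta> y a))"

lemma ORD_ordered_dfa:
  assumes "L \<in> F_ORD V"
  obtains Z z0 F \<delta> f where "ordered_dfa V Z z0 F \<delta> f" "L = dfa_lang V z0 F \<delta>"
proof -
  from assms obtain Z :: "nat set" and z0 F \<delta> r where *: "is_dfa V Z z0 F \<delta>" "L = dfa_lang V z0 F \<delta>"
    "linear_order_on Z r" "\<forall>z z'. (z, z') \<in> r \<longrightarrow> (\<forall>a\<in>V. (\<delta> z a, \<delta> z' a) \<in> r)"
    unfolding F_ORD_def by blast
  then have "finite Z" by (simp add: is_dfa_def)
  from linear_order_rank[OF this *(3)] obtain f :: "nat \<Rightarrow> nat" where f: "inj_on f Z"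
    "\<And>x y. x \<in> Z \<Longrightarrow> y \<in> Z \<Longrightarrow> (x, y) \<in> r \<longleftrightarrow> f x \<le> f y" by blast
  have "ordered_dfa V Z z0 F \<delta> f"
    using * f unfolding ordered_dfa_def is_dfa_def by blast
  with *(2) show thesis using that by blast
qed

lemma dfa_foldl: "is_dfa V Z z0 F \<delta> \<Longrightarrow> z \<in> Z \<Longrightarrow> set w \<subseteq> V \<Longrightarrow> foldl \<delta> z w \<in> Z"
  by (induction w arbitrary: z) (auto simp: is_dfa_def)

lemma ordered_dfa_mono:
  assumes "ordered_dfa V Z z0 F \<delta> f" "x \<in> Z" "y \<in> Z" "f x \<le> f y" "set w \<subseteq> V"
  shows "f (foldl \<delta> x w) \<le> f (foldl \<delta> y w)"
  using assms(2-)
proof (induction w arbitrary: x y)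
  case (Cons a w)
  then show ?case using assms(1) by (auto simp: ordered_dfa_def is_dfa_def)
qed simp

text \<open>The iterates of a monotone map on a finite chain form a monotone sequence, which becomes
  stationary.\<close>

lemma ordered_dfa_stationary:
  assumes dfa: "ordered_dfa V Z z0 F \<delta> f" and z: "z \<in> Z" and y: "set y \<subseteq> V"
  shows "foldl \<delta> z (wpow y (Suc (card Z))) = foldl \<delta> z (wpow y (card Z))"
proof (rule ccontr)
  let ?s = "\<lambda>n. foldl \<delta> z (wpow y n)"
  assume ne: "?s (Suc (card Z)) \<noteq> ?s (card Z)"
  from dfa have Z: "finite Z" "inj_on f Z" and d: "is_dfa V Z z0 F \<delta>"
    by (auto simp: ordered_dfa_def is_dfa_def)
  have step: "?s (Suc n) = foldl \<delta> (?s n) y" for n by (simp add: wpow_Suc2)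
  \<comment> \<open>A fixed point of reading \<open>y\<close> is never left, so if the last of these
    steps moves, all earlier ones do.\<close>
  have ne': "?s (Suc n) \<noteq> ?s n" if "n \<le> card Z" for n
  proof
    assume eq: "?s (Suc n) = ?s n"
    have "?s (Suc m) = ?s m" if "m \<ge> n" for m
      using that by (induction m rule: dec_induct) (use eq step in metis)+
    with ne that show False by blast
  qed
  have sZ: "?s n \<in> Z" for n
    by (rule dfa_foldl[OF d z]) (use wpow_lists[of y V n] y in auto)
  have mono: "f (?s n) \<le> f (?s m) \<Longrightarrow> f (?s (Suc n)) \<le> f (?s (Suc m))" for n m
    unfolding step by (rule ordered_dfa_mono[OF dfa sZ sZ _ y])
  have f_ne: "f (?s (Suc n)) \<noteq> f (?s n)" if "n \<le> card Z" for n
    using ne'[OF that] Z(2) sZ by (auto dest: inj_onD)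
  \<comment> \<open>The first comparison fixes the direction of the whole sequence. It would be
    strictly monotone and visit \<open>card Z + 1\<close> states.\<close>
  have "inj_on ?s {..card Z}"
  proof (cases "f (?s 0) \<le> f (?s 1)")
    case True
    have "f (?s n) \<le> f (?s (Suc n))" for n by (induction n) (use True mono in auto)
    then have lt: "f (?s n) < f (?s (Suc n))" if "n \<le> card Z" for n
      using f_ne[OF that] by (metis le_neq_implies_less)
    have "f (?s i) < f (?s j)" if "i < j" "j \<le> card Z" for i j
      using that
    proof (induction j)
      case (Suc j) then show ?case using lt[of j] by (cases "i = j") auto
    qed simp
    then show ?thesis by (intro linorder_inj_onI) (metis atMost_iff less_irrefl, auto)
  next
    case False
    have "f (?s (Suc n)) \<le> f (?s n)" for n by (induction n) (use False mono in auto)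
    then have lt: "f (?s (Suc n)) < f (?s n)" if "n \<le> card Z" for n
      using f_ne[OF that] by (metis le_neq_implies_less)
    have "f (?s j) < f (?s i)" if "i < j" "j \<le> card Z" for i j
      using that
    proof (induction j)
      case (Suc j) then show ?case using lt[of j] by (cases "i = j") auto
    qed simp
    then show ?thesis by (intro linorder_inj_onI) (metis atMost_iff less_irrefl, auto)
  qed
  then have "card {..card Z} \<le> card Z" using sZ Z(1) by (intro card_inj_on_le) auto
  then show False by simp
qed

text \<open>Reading \<open>y\<close> as often as there are states leads from any state to a fixed
  point of reading \<open>y\<close>, so \<open>card Z\<close> serves as \<open>k\<close>.\<close>

lemma ORD_NC: "F_ORD V \<subseteq> F_NC V"
proof
  fix L assume L: "L \<in> F_ORD V"
  then obtain Z z0 F \<delta> f where dfa: "ordered_dfa V Z z0 F \<delta> f" and LD: "L = dfa_lang V z0 F \<delta>"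
    by (rule ORD_ordered_dfa)
  have d: "is_dfa V Z z0 F \<delta>" using dfa by (simp add: ordered_dfa_def)
  then have "z0 \<in> Z" "finite Z" by (auto simp: is_dfa_def)
  then have "card Z \<ge> 1" using card_gt_0_iff[of Z] by auto
  moreover have "x @ wpow y (card Z) @ z \<in> L \<longleftrightarrow> x @ wpow y (card Z + 1) @ z \<in> L"
    if "x \<in> lists V" "y \<in> lists V" "z \<in> lists V" for x y z
  proof -
    have "foldl \<delta> (foldl \<delta> z0 x) (wpow y (Suc (card Z))) = foldl \<delta> (foldl \<delta> z0 x) (wpow y (card Z))"
      using that by (intro ordered_dfa_stationary[OF dfa dfa_foldl[OF d \<open>z0 \<in> Z\<close>]]) auto
    then show ?thesis using that wpow_lists[OF that(2)] unfolding LD dfa_lang_def by auto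
  qed
  ultimately show "L \<in> F_NC V" using L unfolding F_NC_def F_ORD_def by blast
qed

text \<open>With \<open>x^(n-k)\<close> as left part and an empty right part, the equivalence links
  the exponents \<open>n\<close> and \<open>n + 1\<close>.\<close>

lemma NC_PS: "F_NC V \<subseteq> F_PS V"
proof
  fix L assume "L \<in> F_NC V"
  then obtain k where L: "L \<in> F_REG V" "k \<ge> 1"
    "\<And>x y z. x \<in> lists V \<Longrightarrow> y \<in> lists V \<Longrightarrow> z \<in> lists V \<Longrightarrow>
       x @ wpow y k @ z \<in> L \<longleftrightarrow> x @ wpow y (k + 1) @ z \<in> L"
    unfolding F_NC_def by blast
  have "wpow x n \<in> L \<longleftrightarrow> wpow x k \<in> L" if x: "x \<in> lists V" and "n \<ge> k" for x n
    using \<open>n \<ge> k\<close>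
  proof (induction n rule: dec_induct)
    case (step n)
    have "wpow x (n - k + k) \<in> L \<longleftrightarrow> wpow x (n - k + (k + 1)) \<in> L"
      using L(3)[of "wpow x (n - k)" x "[]"] wpow_lists[OF x] x unfolding wpow_add by simp
    with step show ?case by simp
  qed simp
  then have "{wpow x n |n. n \<ge> k} \<inter> L = {} \<or> {wpow x n |n. n \<ge> k} \<subseteq> L" if "x \<in> lists V" for x
    using that by blast
  then show "L \<in> F_PS V" using L(1,2) unfolding F_PS_def by blast
qed

section \<open>Power-separating languages\<close>

lemma PS_intro:
  assumes "L \<in> F_REG V" "m \<ge> 1"
    and "\<And>x n n'. x \<in> lists V \<Longrightarrow> n \<ge> m \<Longrightarrow> n' \<ge> m \<Longrightarrow> wpow x n \<in> L \<Longrightarrow> wpow x n' \<in> L"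
  shows "L \<in> F_PS V"
  unfolding F_PS_def using assms by blast

text \<open>Replacing \<open>x^i\<close> by \<open>x^j\<close> raises any exponent that is at least
  \<open>N\<close>. Hence arbitrarily high powers are in \<open>L\<close>, and the closure
  assumption fills in the lower ones.\<close>

lemma closed_PS:
  assumes L: "L \<in> F_REG V"
    and cl: "\<And>x m n. x \<in> lists V \<Longrightarrow> m \<le> n \<Longrightarrow> wpow x n \<in> L \<Longrightarrow> wpow x m \<in> L"
  shows "L \<in> F_PS V"
proof -
  from REG_pump_power[OF L] obtain N where N: "N \<ge> 1" "\<And>p x. \<exists>i j. i < j \<and> j \<le> N \<and>
      (\<forall>w. p @ wpow x i @ w \<in> L \<longleftrightarrow> p @ wpow x j @ w \<in> L)" by blast
  show ?thesis
  proof (rule PS_intro[OF L N(1)])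
    fix x n n' assume x: "x \<in> lists V" and n: "n \<ge> N" and "wpow x n \<in> L"
    from N(2)[of "[]" x] obtain i j where ij: "i < j" "j \<le> N"
      "\<And>w. wpow x i @ w \<in> L \<longleftrightarrow> wpow x j @ w \<in> L" by auto
    have "\<exists>k\<ge>t. wpow x k \<in> L" for t
    proof (induction t)
      case 0 then show ?case using \<open>wpow x n \<in> L\<close> by auto
    next
      case (Suc t)
      then obtain k where k: "k \<ge> t" "wpow x k \<in> L" by blast
      define k' where "k' = max k n"
      have k': "wpow x k' \<in> L" "k' \<ge> t" "k' \<ge> N" using k \<open>wpow x n \<in> L\<close> n by (auto simp: k'_def max_def)
      then have "wpow x i @ wpow x (k' - i) \<in> L" using ij by (simp add: wpow_add[symmetric])
      then have "wpow x (j + (k' - i)) \<in> L" using ij by (simp add: wpow_add)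
      then show ?case using ij k' by (intro exI[of _ "j + (k' - i)"]) auto
    qed
    then show "wpow x n' \<in> L" using cl[OF x] by blast
  qed
qed

lemma SUF_PS: "F_SUF V \<subseteq> F_PS V"
proof
  fix L assume "L \<in> F_SUF V"
  then have L: "L \<in> F_REG V" "\<And>x y. x \<in> lists V \<Longrightarrow> y \<in> lists V \<Longrightarrow> x @ y \<in> L \<Longrightarrow> y \<in> L"
    unfolding F_SUF_def by blast+
  show "L \<in> F_PS V"
  proof (rule closed_PS[OF L(1)])
    fix x and m n :: nat assume "x \<in> lists V" "m \<le> n" "wpow x n \<in> L"
    then show "wpow x m \<in> L"
      using L(2)[of "wpow x (n - m)" "wpow x m"] wpow_lists[of x V] by (simp add: wpow_add[symmetric])
  qed
qed

lemma PRE_PS: "F_PRE V \<subseteq> F_PS V"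
proof
  fix L assume "L \<in> F_PRE V"
  then have L: "L \<in> F_REG V" "\<And>x y. x \<in> lists V \<Longrightarrow> y \<in> lists V \<Longrightarrow> x @ y \<in> L \<Longrightarrow> x \<in> L"
    unfolding F_PRE_def by blast+
  show "L \<in> F_PS V"
  proof (rule closed_PS[OF L(1)])
    fix x and m n :: nat assume "x \<in> lists V" "m \<le> n" "wpow x n \<in> L"
    then show "wpow x m \<in> L"
      using L(2)[of "wpow x m" "wpow x (n - m)"] wpow_lists[of x V] by (simp add: wpow_add[symmetric])
  qed
qed

lemma prefix_of_wpow:
  assumes "wpow x n = u @ v"
  obtains i x1 x2 where "u = wpow x i @ x1" "x = x1 @ x2"
proof -
  have "\<exists>i x1 x2. u = wpow x i @ x1 \<and> x = x1 @ x2"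
    using assms
  proof (induction n arbitrary: u)
    case 0 then show ?case by (intro exI[of _ 0]) (auto simp: wpow_0)
  next
    case (Suc n)
    then consider t where "u = x @ t" "wpow x n = t @ v" | t where "x = u @ t"
      by (auto simp: wpow_Suc append_eq_append_conv2)
    then show ?case
    proof cases
      case 1
      from Suc.IH[OF 1(2)] obtain i x1 x2 where "t = wpow x i @ x1" "x = x1 @ x2" by blast
      then show ?thesis using 1(1) by (intro exI[of _ "Suc i"]) (auto simp: wpow_Suc)
    next
      case 2 then show ?thesis by (intro exI[of _ 0]) (auto simp: wpow_0)
    qed
  qed
  then show thesis using that by blast
qed

lemma suffix_of_wpow:
  assumes "wpow x n = u @ v"
  obtains i x1 x2 where "v = x2 @ wpow x i" "x = x1 @ x2"
proof -
  have "\<exists>i x1 x2. v = x2 @ wpow x i \<and> x = x1 @ x2"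
    using assms
  proof (induction n arbitrary: v)
    case 0 then show ?case by (intro exI[of _ 0]) (auto simp: wpow_0)
  next
    case (Suc n)
    then have "wpow x n @ x = u @ v" by (simp add: wpow_Suc2)
    then consider t where "v = t @ x" "wpow x n = u @ t" | t where "x = t @ v"
      by (auto simp: append_eq_append_conv2)
    then show ?case
    proof cases
      case 1
      from Suc.IH[OF 1(2)] obtain i x1 x2 where "t = x2 @ wpow x i" "x = x1 @ x2" by blast
      then show ?thesis using 1(1) by (intro exI[of _ "Suc i"]) (auto simp: wpow_Suc2)
    next
      case 2 then show ?thesis by (intro exI[of _ 0]) (auto simp: wpow_0)
    qed
  qed
  then show thesis using that by blast
qed

text \<open>An exponent above \<open>N\<close> can be lowered by replacing \<open>x^j\<close> with
  an equivalent \<open>x^i\<close>, where \<open>i < j\<close>. The bound does not depend on the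
  surrounding words.\<close>

lemma REG_reduce_power:
  assumes "L \<in> F_REG V"
  shows "\<exists>N. \<forall>p x i w. p @ wpow x i @ w \<in> L \<longrightarrow> (\<exists>i'\<le>N. p @ wpow x i' @ w \<in> L)"
proof -
  from REG_pump_power[OF assms] obtain N where N: "\<And>p x. \<exists>i j. i < j \<and> j \<le> N \<and>
      (\<forall>w. p @ wpow x i @ w \<in> L \<longleftrightarrow> p @ wpow x j @ w \<in> L)" by blast
  have "\<exists>i'\<le>N. p @ wpow x i' @ w \<in> L" if "p @ wpow x k @ w \<in> L" for p x k w
    using that
  proof (induction k rule: less_induct)
    case (less k)
    show ?case
    proof (cases "k \<le> N")
      case False
      from N[of p x] obtain i j where ij: "i < j" "j \<le> N"
        "\<And>w. p @ wpow x i @ w \<in> L \<longleftrightarrow> p @ wpow x j @ w \<in> L" by blast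
      have "p @ wpow x j @ wpow x (k - j) @ w \<in> L"
        using less.prems ij False by (simp add: wpow_add[symmetric] flip: append_assoc)
      then have "p @ wpow x i @ wpow x (k - j) @ w \<in> L" using ij(3) by blast
      then have "p @ wpow x (i + (k - j)) @ w \<in> L" by (simp add: wpow_add)
      moreover have "i + (k - j) < k" using ij False by simp
      ultimately show ?thesis using less.IH by blast
    qed (use less.prems in blast)
  qed
  then show ?thesis by blast
qed

text \<open>In a factorization of \<open>x^n\<close> the parts from \<open>E\<close> and
  \<open>H\<close> are \<open>x^i x1\<close> and \<open>x4 x^k\<close>. Their exponents can be
  lowered to at most \<open>M\<close> and \<open>N\<close>, and the unrestricted middle part makes
  up for any other exponent.\<close>

lemma SYDEF_PS: "F_SYDEF V \<subseteq> F_PS V"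
proof
  fix L assume "L \<in> F_SYDEF V"
  then obtain E H where L: "L \<in> F_REG V" "E \<in> F_REG V" "H \<in> F_REG V" "L = E @@ lists V @@ H"
    unfolding F_SYDEF_def by blast
  from REG_reduce_power[OF L(2)] obtain M where
    M: "\<And>p x i w. p @ wpow x i @ w \<in> E \<Longrightarrow> \<exists>i'\<le>M. p @ wpow x i' @ w \<in> E" by blast
  from REG_reduce_power[OF L(3)] obtain N where
    N: "\<And>p x i w. p @ wpow x i @ w \<in> H \<Longrightarrow> \<exists>i'\<le>N. p @ wpow x i' @ w \<in> H" by blast
  show "L \<in> F_PS V"
  proof (rule PS_intro[OF L(1), of "M + N + 2"])
    fix x n n' assume x: "x \<in> lists V" and n': "M + N + 2 \<le> n'" and "wpow x n \<in> L"
    then obtain e w h where e: "wpow x n = e @ (w @ h)" "e \<in> E" "h \<in> H"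
      using L(4) by (auto simp: conc_def)
    from prefix_of_wpow[OF e(1)] obtain i x1 x2 where i: "e = wpow x i @ x1" "x = x1 @ x2" by blast
    from M[of "[]" x i x1] e i obtain i' where i': "i' \<le> M" "wpow x i' @ x1 \<in> E" by auto
    from e(1) have "wpow x n = (e @ w) @ h" by simp
    from suffix_of_wpow[OF this] obtain k x3 x4 where k: "h = x4 @ wpow x k" "x = x3 @ x4" by blast
    from N[of x4 x k "[]"] e k obtain k' where k': "k' \<le> N" "x4 @ wpow x k' \<in> H" by auto
    \<comment> \<open>One copy of \<open>x\<close> completes \<open>x1\<close> and another one
      completes \<open>x4\<close>; hence the summand 2 in the bound
      \<open>M + N + 2\<close>.\<close>
    have "wpow x n' = wpow x (i' + 1 + (n' - i' - k' - 2) + 1 + k')" using n' i' k' by (intro arg_cong[of _ _ "wpow x"]) linarith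
    also have "\<dots> = (wpow x i' @ x1) @ (x2 @ wpow x (n' - i' - k' - 2) @ x3) @ (x4 @ wpow x k')"
      using i(2) k(2) by (simp add: wpow_add wpow_Suc wpow_0 del: add_Suc_right)
    also have "\<dots> \<in> L"
      unfolding L(4) using i' k' x i(2) k(2) wpow_lists[OF x] by (intro concI) (simp_all, metis append_in_lists_conv)
    finally show "wpow x n' \<in> L" .
  qed simp
qed

lemma PS_REG: "F_PS V \<subseteq> F_REG V" by (auto simp: F_PS_def)
lemma STAR_REG: "F_STAR V \<subseteq> F_REG V" by (auto simp: F_STAR_def)
lemma CIRC_REG: "F_CIRC V \<subseteq> F_REG V" by (auto simp: F_CIRC_def)
lemma mset_rotate: "mset (rotate n w) = mset w"
  by (metis append_take_drop_id mset_append rotate_drop_take union_commute)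

lemma COMM_CIRC: "F_COMM V \<subseteq> F_CIRC V" by (auto simp: F_COMM_def F_CIRC_def mset_rotate)

lemma INF_SUF: "F_INF V \<subseteq> F_SUF V"
proof
  fix L assume "L \<in> F_INF V"
  then have L: "L \<in> F_REG V" "\<And>x y z. x \<in> lists V \<Longrightarrow> y \<in> lists V \<Longrightarrow> z \<in> lists V \<Longrightarrow>
    x @ y @ z \<in> L \<Longrightarrow> y \<in> L" unfolding F_INF_def by blast+
  have "y \<in> L" if "x \<in> lists V" "y \<in> lists V" "x @ y \<in> L" for x y
    using L(2)[of x y "[]"] that by simp
  then show "L \<in> F_SUF V" using L(1) unfolding F_SUF_def by blast
qed

lemma INF_PRE: "F_INF V \<subseteq> F_PRE V"
proof
  fix L assume "L \<in> F_INF V"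
  then have L: "L \<in> F_REG V" "\<And>x y z. x \<in> lists V \<Longrightarrow> y \<in> lists V \<Longrightarrow> z \<in> lists V \<Longrightarrow>
    x @ y @ z \<in> L \<Longrightarrow> y \<in> L" unfolding F_INF_def by blast+
  have "x \<in> L" if "x \<in> lists V" "y \<in> lists V" "x @ y \<in> L" for x y
    using L(2)[of "[]" x y] that by simp
  then show "L \<in> F_PRE V" using L(1) unfolding F_PRE_def by blast
qed

section \<open>Contextual grammars\<close>

lemma derives_inI:
  "(S, C) \<in> selection G \<Longrightarrow> (u, v) \<in> C \<Longrightarrow> x2 \<in> S \<Longrightarrow> derives_in G (x1 @ x2 @ x3) (x1 @ u @ x2 @ v @ x3)"
  unfolding derives_in_def by blast

lemma derives_inE:
  assumes "derives_in G x y"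
  obtains S C u v x1 x2 x3 where "(S, C) \<in> selection G" "(u, v) \<in> C" "x2 \<in> S"
    "x = x1 @ x2 @ x3" "y = x1 @ u @ x2 @ v @ x3"
  using assms unfolding derives_in_def by blast

lemma L_in_axs: "x \<in> axs G \<Longrightarrow> x \<in> L_in G"
  unfolding L_in_def by blast

lemma L_in_step:
  "x1 @ x2 @ x3 \<in> L_in G \<Longrightarrow> (S, C) \<in> selection G \<Longrightarrow> (u, v) \<in> C \<Longrightarrow> x2 \<in> S \<Longrightarrow>
   x1 @ u @ x2 @ v @ x3 \<in> L_in G"
  unfolding L_in_def using derives_inI[of S C G u v x2 x1 x3]
  by (auto intro: rtranclp.rtrancl_into_rtrancl)

lemma L_in_induct [consumes 1, case_names axs step]:
  assumes "w \<in> L_in G" "\<And>x. x \<in> axs G \<Longrightarrow> P x"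
    "\<And>x1 x2 x3 S C u v. x1 @ x2 @ x3 \<in> L_in G \<Longrightarrow> P (x1 @ x2 @ x3) \<Longrightarrow> (S, C) \<in> selection G \<Longrightarrow>
       (u, v) \<in> C \<Longrightarrow> x2 \<in> S \<Longrightarrow> P (x1 @ u @ x2 @ v @ x3)"
  shows "P w"
proof -
  from assms(1) obtain x where x: "x \<in> axs G" "(derives_in G)\<^sup>*\<^sup>* x w" by (auto simp: L_in_def)
  from x(2) have "w \<in> L_in G \<and> P w"
  proof induction
    case base then show ?case using x(1) assms(2) L_in_axs by blast
  next
    case (step y z)
    then show ?case using assms(3) L_in_step by (elim derives_inE) blast
  qed
  then show ?thesis ..
qed

lemma L_in_cases:
  assumes "w \<in> L_in G"
  obtains "w \<in> axs G"
  | S C u v x1 x2 x3 where "(S, C) \<in> selection G" "(u, v) \<in> C" "x2 \<in> S"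
      "w = x1 @ u @ x2 @ v @ x3" "x1 @ x2 @ x3 \<in> L_in G"
  using assms
proof (induction rule: L_in_induct)
  case (step x1 x2 x3 S C u v)
  then show ?case by blast
qed blast

lemma grammarD:
  assumes "contextual_grammar F G"
  shows "finite (axs G)" "finite (selection G)" "axs G \<subseteq> lists (letters G)"
    "(S, C) \<in> selection G \<Longrightarrow> finite C"
    "(S, C) \<in> selection G \<Longrightarrow> \<exists>U. alphabet U \<and> U \<subseteq> letters G \<and> S \<in> F U"
    "(S, C) \<in> selection G \<Longrightarrow> (u, v) \<in> C \<Longrightarrow> u @ v \<noteq> []"
    "(S, C) \<in> selection G \<Longrightarrow> (u, v) \<in> C \<Longrightarrow> set u \<subseteq> letters G \<and> set v \<subseteq> letters G"
proof -
  have *: "(\<exists>U. alphabet U \<and> U \<subseteq> letters G \<and> S \<in> F U) \<and> finite C \<and>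
      C \<subseteq> lists (letters G) \<times> lists (letters G) \<and> (\<forall>(u, v)\<in>C. u @ v \<noteq> [])"
    if "(S, C) \<in> selection G" for S C
    using assms that unfolding contextual_grammar_def by (elim conjE, drule_tac bspec) (assumption, unfold prod.case, assumption)
  show "finite (axs G)" "finite (selection G)" "axs G \<subseteq> lists (letters G)"
    using assms unfolding contextual_grammar_def by - (elim conjE, assumption)+
  show "(S, C) \<in> selection G \<Longrightarrow> finite C"
    "(S, C) \<in> selection G \<Longrightarrow> \<exists>U. alphabet U \<and> U \<subseteq> letters G \<and> S \<in> F U"
    "(S, C) \<in> selection G \<Longrightarrow> (u, v) \<in> C \<Longrightarrow> u @ v \<noteq> []"
    using *[of S C] by auto
  show "(S, C) \<in> selection G \<Longrightarrow> (u, v) \<in> C \<Longrightarrow> set u \<subseteq> letters G \<and> set v \<subseteq> letters G"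
    using *[of S C] by (fastforce simp: lists_eq_set)
qed

lemma grammarI:
  assumes "alphabet (letters G)" "finite (axs G)" "axs G \<subseteq> lists (letters G)" "finite (selection G)"
    and "\<And>S C. (S, C) \<in> selection G \<Longrightarrow> \<exists>U. alphabet U \<and> U \<subseteq> letters G \<and> S \<in> F U"
    and "\<And>S C. (S, C) \<in> selection G \<Longrightarrow> finite C"
    and "\<And>S C u v. (S, C) \<in> selection G \<Longrightarrow> (u, v) \<in> C \<Longrightarrow>
      set u \<subseteq> letters G \<and> set v \<subseteq> letters G \<and> u @ v \<noteq> []"
  shows "contextual_grammar F G"
proof -
  have "(\<exists>U. alphabet U \<and> U \<subseteq> letters G \<and> S \<in> F U) \<and> finite C \<and>
      C \<subseteq> lists (letters G) \<times> lists (letters G) \<and> (\<forall>(u, v)\<in>C. u @ v \<noteq> [])"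
    if "(S, C) \<in> selection G" for S C
    using assms(5-7)[OF that] by (fastforce simp: lists_eq_set)
  then show ?thesis unfolding contextual_grammar_def using assms(1-4) by blast
qed

lemma L_in_lists:
  assumes "contextual_grammar F G" "w \<in> L_in G"
  shows "w \<in> lists (letters G)"
  using assms(2)
proof (induction rule: L_in_induct)
  case (axs x) then show ?case using grammarD(3)[OF assms(1)] by blast
next
  case (step x1 x2 x3 S C u v)
  then show ?case using grammarD(7)[OF assms(1), of S C u v] by (auto dest: subsetD)
qed

lemma IC_I: "contextual_grammar F G \<Longrightarrow> L_in G \<in> IC F"
  unfolding IC_def by blast

lemma IC_mono:
  assumes "\<And>U. alphabet U \<Longrightarrow> F U \<subseteq> F' U"
  shows "IC F \<subseteq> IC F'"
proof -
  have "contextual_grammar F' G" if G: "contextual_grammar F G" for G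
  proof (rule grammarI)
    show "alphabet (letters G)" using G by (simp add: contextual_grammar_def)
    fix S C assume SC: "(S, C) \<in> selection G"
    show "\<exists>U. alphabet U \<and> U \<subseteq> letters G \<and> S \<in> F' U" using grammarD(5)[OF G SC] assms by blast
    fix u v assume "(u, v) \<in> C"
    then show "set u \<subseteq> letters G \<and> set v \<subseteq> letters G \<and> u @ v \<noteq> []"
      using grammarD(6,7)[OF G SC] by simp
  qed (use grammarD[OF G] in auto)
  then show ?thesis unfolding IC_def by blast
qed

text \<open>The induction supplies membership of the current word in both languages, so properties
  of the words of one grammar are at hand when a step of the other is simulated.\<close>

lemma L_in_eqI:
  assumes "\<And>w. w \<in> axs G \<Longrightarrow> w \<in> L_in H" "\<And>w. w \<in> axs H \<Longrightarrow> w \<in> L_in G"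
    and "\<And>x1 x2 x3 S C u v. x1 @ x2 @ x3 \<in> L_in G \<Longrightarrow> x1 @ x2 @ x3 \<in> L_in H \<Longrightarrow>
       (S, C) \<in> selection G \<Longrightarrow> (u, v) \<in> C \<Longrightarrow> x2 \<in> S \<Longrightarrow> x1 @ u @ x2 @ v @ x3 \<in> L_in H"
    and "\<And>x1 x2 x3 S C u v. x1 @ x2 @ x3 \<in> L_in H \<Longrightarrow> x1 @ x2 @ x3 \<in> L_in G \<Longrightarrow>
       (S, C) \<in> selection H \<Longrightarrow> (u, v) \<in> C \<Longrightarrow> x2 \<in> S \<Longrightarrow> x1 @ u @ x2 @ v @ x3 \<in> L_in G"
  shows "L_in G = L_in H"
proof (intro equalityI subsetI)
  fix w assume "w \<in> L_in G"
  then show "w \<in> L_in H" by (induction rule: L_in_induct) (use assms(1,3) in blast)+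
next
  fix w assume "w \<in> L_in H"
  then show "w \<in> L_in G" by (induction rule: L_in_induct) (use assms(2,4) in blast)+
qed

text \<open>A nonempty word contains a letter next to any given gap, so that inserting at a gap can be
  replaced by inserting next to a letter; the empty word is treated through additional axioms.\<close>

lemma IC_MON_COMB: "IC (F_MON :: 'a family) \<subseteq> IC F_COMB"
proof
  fix L :: "'a lang" assume "L \<in> IC F_MON"
  then obtain G where G: "contextual_grammar F_MON G" and L: "L = L_in G" by (auto simp: IC_def)
  note g = grammarD[OF G]
  let ?V = "letters G"
  define K where "K = \<Union>(snd ` selection G)"
  define plus where "plus U = {w \<in> lists U. w \<noteq> []}" for U :: "'a set"
  \<comment> \<open>The pair for a letter \<open>a\<close> inserts \<open>u v\<close> beside a
    nonempty power of \<open>a\<close>. The additional axioms replace steps from the empty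
    word.\<close>
  define H where "H = \<lparr>letters = ?V,
    selection = (\<lambda>(S, C). (S - {[]}, C)) ` selection G \<union>
      (\<lambda>a. (plus {a}, (\<lambda>(u, v). ([], u @ v)) ` K \<union> (\<lambda>(u, v). (u @ v, [])) ` K)) ` ?V,
    axs = axs G \<union> (if [] \<in> axs G then (\<lambda>(u, v). u @ v) ` K else {})\<rparr>"
  have V: "alphabet ?V" using G by (simp add: contextual_grammar_def)
  have K: "finite K" unfolding K_def using g(2,4) by auto
  have K_iff: "(u, v) \<in> K \<longleftrightarrow> (\<exists>S C. (S, C) \<in> selection G \<and> (u, v) \<in> C)" for u v
    by (force simp: K_def)
  have sel: "\<exists>U. alphabet U \<and> U \<subseteq> ?V \<and> S = lists U" if "(S, C) \<in> selection G" for S C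
    using g(5)[OF that] by (auto simp: F_MON_def)
  have plus_COMB: "plus U \<in> F_COMB U" if "alphabet U" for U
  proof -
    have eq: "plus U = lists U @@ {[a] |a. a \<in> U}"
    proof (intro equalityI subsetI)
      fix w assume "w \<in> plus U"
      then have "butlast w @ [last w] \<in> lists U @@ {[a] |a. a \<in> U}"
        by (intro concI) (auto simp: plus_def dest: in_set_butlastD)
      then show "w \<in> lists U @@ {[a] |a. a \<in> U}" using \<open>w \<in> plus U\<close> by (simp add: plus_def)
    qed (auto simp: plus_def conc_def)
    moreover have "lists U @@ {[a] |a. a \<in> U} \<in> F_REG U"
      using that by (intro REG_conc REG_lists_full REG_finite) (auto simp: alphabet_def)
    ultimately show ?thesis unfolding F_COMB_def by auto
  qed
  have minus: "lists U - {[]} = plus U" for U by (auto simp: plus_def)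
  have "contextual_grammar F_COMB H"
  proof (rule grammarI)
    have KV: "set u \<subseteq> ?V \<and> set v \<subseteq> ?V \<and> u @ v \<noteq> []" if "(u, v) \<in> K" for u v
      using that g(6,7) unfolding K_iff by blast
    show "alphabet (letters H)" "finite (axs H)" "finite (selection H)"
      using V g(1,2) K by (simp_all add: H_def alphabet_def)
    show "axs H \<subseteq> lists (letters H)" using g(3) KV by (fastforce simp: H_def lists_eq_set split: if_splits)
    fix S C assume "(S, C) \<in> selection H"
    then consider S' where "S = S' - {[]}" "(S', C) \<in> selection G"
      | a where "a \<in> ?V" "S = plus {a}" "C = (\<lambda>(u, v). ([], u @ v)) ` K \<union> (\<lambda>(u, v). (u @ v, [])) ` K"
      by (auto simp: H_def)
    note cases = this
    show "finite C" by (cases rule: cases) (use g(4) K in auto)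
    show "\<exists>U. alphabet U \<and> U \<subseteq> letters H \<and> S \<in> F_COMB U"
    proof (cases rule: cases)
      case 1 then show ?thesis using sel[OF 1(2)] plus_COMB minus by (force simp: H_def)
    next
      case 2
      have "alphabet {a}" by (simp add: alphabet_def)
      with 2 plus_COMB[OF this] show ?thesis by (intro exI[of _ "{a}"]) (simp add: H_def)
    qed
    show "set u \<subseteq> letters H \<and> set v \<subseteq> letters H \<and> u @ v \<noteq> []" if uv: "(u, v) \<in> C" for u v
    proof (cases rule: cases)
      case 1 then show ?thesis using g(6,7)[OF 1(2) uv] by (simp add: H_def)
    next
      case 2
      then obtain u' v' where "(u', v') \<in> K" "u = [] \<and> v = u' @ v' \<or> u = u' @ v' \<and> v = []"
        using uv by auto
      then show ?thesis using KV[of u' v'] by (auto simp: H_def)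
    qed
  qed
  moreover have "L_in G = L_in H"
  proof (rule L_in_eqI)
    fix w assume "w \<in> axs G" then show "w \<in> L_in H" by (intro L_in_axs) (simp add: H_def)
  next
    fix w assume "w \<in> axs H"
    then consider "w \<in> axs G" | u v S C where "[] \<in> axs G" "w = u @ v" "(S, C) \<in> selection G" "(u, v) \<in> C"
      by (auto simp: H_def K_iff split: if_splits)
    then show "w \<in> L_in G"
    proof cases
      case 2
      then show ?thesis using L_in_step[of "[]" "[]" "[]" G S C u v] sel[OF 2(3)] by (auto intro: L_in_axs)
    qed (rule L_in_axs)
  next
    fix x1 x2 x3 S C u v
    assume *: "x1 @ x2 @ x3 \<in> L_in G" "x1 @ x2 @ x3 \<in> L_in H" "(S, C) \<in> selection G" "(u, v) \<in> C" "x2 \<in> S"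
    have uvK: "(u, v) \<in> K" using * K_iff by blast
    have selH: "(plus {a}, (\<lambda>(u, v). ([], u @ v)) ` K \<union> (\<lambda>(u, v). (u @ v, [])) ` K) \<in> selection H"
      if "a \<in> ?V" for a using that by (simp add: H_def)
    show "x1 @ u @ x2 @ v @ x3 \<in> L_in H"
    proof (cases "x2 = []")
      case False
      then show ?thesis using * by (intro L_in_step[of x1 x2 x3 H "S - {[]}" C]) (force simp: H_def)+
    next
      case x2: True
      show ?thesis
      proof (cases x3)
        case (Cons a y)
        then have "a \<in> ?V" using L_in_lists[OF G *(1)] by simp
        from L_in_step[of x1 "[a]" y H, OF _ selH[OF this], of "u @ v" "[]"] show ?thesis
          using * x2 Cons uvK \<open>a \<in> ?V\<close> by (force simp: plus_def)
      next
        case x3: Nil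
        show ?thesis
        proof (cases x1 rule: rev_cases)
          case (snoc y a)
          then have "a \<in> ?V" using L_in_lists[OF G *(1)] by simp
          from L_in_step[of y "[a]" "[]" H, OF _ selH[OF this], of "[]" "u @ v"] show ?thesis
            using * x2 x3 snoc uvK \<open>a \<in> ?V\<close> by (force simp: plus_def)
        next
          case Nil
          \<comment> \<open>Contexts are nonempty, so the empty word can only be an axiom.\<close>
          have "[] \<in> axs G"
            using *(1) Nil x2 x3 by (cases rule: L_in_cases) (use g(6) in auto)
          then show ?thesis using uvK x2 x3 Nil by (intro L_in_axs) (force simp: H_def)
        qed
      qed
    qed
  next
    fix x1 x2 x3 S C u v
    assume *: "x1 @ x2 @ x3 \<in> L_in H" "x1 @ x2 @ x3 \<in> L_in G" "(S, C) \<in> selection H" "(u, v) \<in> C" "x2 \<in> S"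
    from *(3) consider S' where "S = S' - {[]}" "(S', C) \<in> selection G"
      | "C = (\<lambda>(u, v). ([], u @ v)) ` K \<union> (\<lambda>(u, v). (u @ v, [])) ` K"
      by (auto simp: H_def)
    then show "x1 @ u @ x2 @ v @ x3 \<in> L_in G"
    proof cases
      case 1
      then show ?thesis using * by (intro L_in_step[of x1 x2 x3 G S' C]) auto
    next
      case 2
      with *(4) obtain u' v' where uv: "(u', v') \<in> K" "u = [] \<and> v = u' @ v' \<or> u = u' @ v' \<and> v = []" by auto
      then obtain S' C' where S': "(S', C') \<in> selection G" "(u', v') \<in> C'" using K_iff by blast
      \<comment> \<open>Every monoidal language contains the empty word, so the original pair may
        insert \<open>u' v'\<close> at any gap.\<close>
      then have "[] \<in> S'" using sel by fastforce
      from uv(2) show ?thesis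
        using L_in_step[of "x1 @ x2" "[]" x3 G S' C' u' v'] L_in_step[of x1 "[]" "x2 @ x3" G S' C' u' v']
          *(2) S' \<open>[] \<in> S'\<close> by auto
    qed
  qed
  ultimately show "L \<in> IC F_COMB" using L IC_I by metis
qed

subsection \<open>Union-free languages and languages with a star factor\<close>

text \<open>Denesting: a union below a star is traded for a product of stars.\<close>

lemma star_union: "star (A \<union> B) = star (star A @@ star B)"
proof (intro equalityI subsetI)
  fix w assume "w \<in> star (A \<union> B)"
  then show "w \<in> star (star A @@ star B)"
  proof (induction rule: star_induct)
    case (step x y)
    have "x \<in> star A @@ star B"
      using step(1) concI[of x "star A" "[]" "star B"] concI[of "[]" "star A" x "star B"]
        star_step[of x A "[]"] star_step[of x B "[]"] by (auto simp: Nil_in_star)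
    then show ?case using step star_step by blast
  qed (rule Nil_in_star)
next
  have mono: "w \<in> star (A \<union> B)" if "w \<in> star C" "C \<subseteq> A \<union> B" for w C
    using that by (induction rule: star_induct) (auto intro: star_step Nil_in_star)
  fix w assume "w \<in> star (star A @@ star B)"
  then show "w \<in> star (A \<union> B)"
  proof (induction rule: star_induct)
    case (step x y)
    then obtain p q where "x = p @ q" "p \<in> star A" "q \<in> star B" by (auto simp: conc_def)
    then show ?case using step(3) mono[of p A] mono[of q B] star_append by (metis Un_upper1 Un_upper2)
  qed (rule Nil_in_star)
qed

lemma star_Union_union_free:
  "\<forall>r\<in>set rs. union_free r \<and> atoms r \<subseteq> V \<Longrightarrow>
   \<exists>r. union_free r \<and> atoms r \<subseteq> V \<and> rlang r = star (\<Union>(rlang ` set rs))"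
proof (induction rs)
  case Nil
  have "rlang One = star (\<Union>(rlang ` set []))" by (auto simp: star_iff intro: exI[of _ "[]"])
  then show ?case by (intro exI[of _ One]) auto
next
  case (Cons s rs)
  then obtain r where "union_free r" "atoms r \<subseteq> V" "rlang r = star (\<Union>(rlang ` set rs))" by auto
  moreover have "star X = star (star X)" for X :: "'a lang"
    using star_union[of "{}" X] star_singleton[of "[]"]
    by (auto simp: star_iff wpow_Nil conc_def star_def)
  ultimately show ?case
    using Cons.prems star_union[of "rlang s" "\<Union>(rlang ` set rs)"]
    by (intro exI[of _ "Star (Times (Star s) r)"]) auto
qed

text \<open>Unions are distributed out of products, and \<open>star_Union_union_free\<close> removes
  them below stars; only an outer finite union is left.\<close>

lemma union_free_decomposition:
  "atoms r \<subseteq> V \<Longrightarrow>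
   \<exists>rs. (\<forall>r\<in>set rs. union_free r \<and> atoms r \<subseteq> V) \<and> rlang r = \<Union>(rlang ` set rs)"
proof (induction r)
  case (Plus r s)
  then obtain rs ss where "\<forall>r\<in>set rs. union_free r \<and> atoms r \<subseteq> V" "rlang r = \<Union>(rlang ` set rs)"
    "\<forall>r\<in>set ss. union_free r \<and> atoms r \<subseteq> V" "rlang s = \<Union>(rlang ` set ss)" by auto
  then show ?case by (intro exI[of _ "rs @ ss"]) auto
next
  case (Times r s)
  then obtain rs ss where *: "\<forall>r\<in>set rs. union_free r \<and> atoms r \<subseteq> V" "rlang r = \<Union>(rlang ` set rs)"
    "\<forall>r\<in>set ss. union_free r \<and> atoms r \<subseteq> V" "rlang s = \<Union>(rlang ` set ss)" by auto
  then have "rlang (Times r s) = \<Union>(rlang ` set [Times r' s'. r' \<leftarrow> rs, s' \<leftarrow> ss])"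
    by (auto simp: conc_def)
  then show ?case using * by (intro exI[of _ "[Times r' s'. r' \<leftarrow> rs, s' \<leftarrow> ss]"]) auto
next
  case (Star r)
  then obtain rs where rs: "\<forall>r\<in>set rs. union_free r \<and> atoms r \<subseteq> V" "rlang r = \<Union>(rlang ` set rs)" by auto
  from star_Union_union_free[OF rs(1)] rs(2) show ?case
    by (elim exE, intro exI[of _ "[_]"]) auto
next
  case Zero then show ?case by (intro exI[of _ "[Zero]"]) auto
next
  case One then show ?case by (intro exI[of _ "[One]"]) auto
next
  case (Atom a) then show ?case by (intro exI[of _ "[Atom a]"]) auto
qed

text \<open>A step depends on a selection language only through membership of one word. Hence a
  finite union may be split into separate pairs with the same contexts, and even the derivation
  relation is unchanged.\<close>

lemma IC_REG_UF: "IC F_REG = IC F_UF"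
proof
  show "IC F_REG \<subseteq> IC F_UF"
  proof
    fix L assume "L \<in> IC F_REG"
    then obtain G where G: "contextual_grammar F_REG G" and L: "L = L_in G" by (auto simp: IC_def)
    note g = grammarD[OF G]
    have "\<exists>U RS. alphabet U \<and> U \<subseteq> letters G \<and> finite RS \<and> RS \<subseteq> F_UF U \<and> fst p = \<Union>RS"
      if "p \<in> selection G" for p
    proof -
      from g(5)[of "fst p" "snd p"] that obtain U r
        where U: "alphabet U" "U \<subseteq> letters G" "atoms r \<subseteq> U" "fst p = rlang r" by (auto simp: F_REG_def)
      from union_free_decomposition[OF U(3)] obtain rs where
        "\<forall>r\<in>set rs. union_free r \<and> atoms r \<subseteq> U" "rlang r = \<Union>(rlang ` set rs)" by blast
      with U show ?thesis
        by (intro exI[of _ U] exI[of _ "rlang ` set rs"]) (auto simp: F_UF_def)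
    qed
    then obtain RS where RS: "\<And>p. p \<in> selection G \<Longrightarrow>
        \<exists>U. alphabet U \<and> U \<subseteq> letters G \<and> finite (RS p) \<and> RS p \<subseteq> F_UF U \<and> fst p = \<Union>(RS p)"
      by metis
    define H where "H = G\<lparr>selection := \<Union>p\<in>selection G. (\<lambda>S. (S, snd p)) ` RS p\<rparr>"
    have "contextual_grammar F_UF H"
    proof (rule grammarI)
      show "alphabet (letters H)" "finite (axs H)" "axs H \<subseteq> lists (letters H)" "finite (selection H)"
        using G RS by (auto simp: H_def contextual_grammar_def)
      fix S C assume "(S, C) \<in> selection H"
      then obtain p where p: "p \<in> selection G" "S \<in> RS p" "C = snd p" by (auto simp: H_def)
      then show "\<exists>U. alphabet U \<and> U \<subseteq> letters H \<and> S \<in> F_UF U" using RS[OF p(1)] by (auto simp: H_def)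
      have p': "(fst p, C) \<in> selection G" using p by simp
      show "finite C" using g(4)[OF p'] .
      show "set u \<subseteq> letters H \<and> set v \<subseteq> letters H \<and> u @ v \<noteq> []" if "(u, v) \<in> C" for u v
        using g(6,7)[OF p' that] by (simp add: H_def)
    qed
    moreover have "derives_in G = derives_in H"
    proof (intro ext iffI)
      fix x y assume "derives_in G x y"
      then show "derives_in H x y"
      proof (cases rule: derives_inE)
        case (1 S C u v x1 x2 x3)
        with RS[of "(S, C)"] obtain S' where S': "S' \<in> RS (S, C)" "x2 \<in> S'" by fastforce
        then have "(S', C) \<in> selection H" using 1 by (force simp: H_def)
        with 1 S' show ?thesis by (auto intro: derives_inI)
      qed
    next
      fix x y assume "derives_in H x y"
      then show "derives_in G x y"
      proof (cases rule: derives_inE)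
        case (1 S C u v x1 x2 x3)
        then obtain p where "p \<in> selection G" "S \<in> RS p" "C = snd p" by (auto simp: H_def)
        with RS[of p] 1 show ?thesis by (auto intro!: derives_inI[of "fst p" C])
      qed
    qed
    moreover have "axs H = axs G" by (simp add: H_def)
    ultimately have "L_in G = L_in H" by (simp add: L_in_def)
    then show "L \<in> IC F_UF" using L IC_I[OF \<open>contextual_grammar F_UF H\<close>] by simp
  qed
  show "IC F_UF \<subseteq> IC F_REG" by (rule IC_mono) (auto simp: F_UF_def F_REG_def)
qed

text \<open>A letter that occurs in no word of the language may be appended to the selected words at will.\<close>

lemma IC_REG_fresh:
  fixes F :: "nat family"
  assumes pad: "\<And>U S c. alphabet U \<Longrightarrow> S \<in> F_REG U \<Longrightarrow> c \<notin> U \<Longrightarrow>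
    \<exists>S'\<in>F (insert c U). S' \<inter> {w. c \<notin> set w} = S"
  shows "IC F_REG \<subseteq> IC F"
proof
  fix L :: "nat lang" assume "L \<in> IC F_REG"
  then obtain G where G: "contextual_grammar F_REG G" and L: "L = L_in G" by (auto simp: IC_def)
  note g = grammarD[OF G]
  have "finite (letters G)" using G by (simp add: contextual_grammar_def alphabet_def)
  \<comment> \<open>The supply of symbols is infinite and \<open>letters G\<close> finite;
    \<open>c\<close> joins the alphabet of the new grammar.\<close>
  from ex_new_if_finite[OF infinite_UNIV_nat this] obtain c where c: "c \<notin> letters G" ..
  have "\<exists>U S'. alphabet U \<and> U \<subseteq> insert c (letters G) \<and> S' \<in> F U \<and> S' \<inter> {w. c \<notin> set w} = fst p"
    if "p \<in> selection G" for p
  proof -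
    from g(5)[of "fst p" "snd p"] that obtain U
      where U: "alphabet U" "U \<subseteq> letters G" "fst p \<in> F_REG U" by auto
    with pad[OF U(1,3), of c] c obtain S' where "S' \<in> F (insert c U)" "S' \<inter> {w. c \<notin> set w} = fst p" by blast
    then show ?thesis using U(1,2)
      by (intro exI[of _ "insert c U"] exI[of _ S']) (auto simp: alphabet_def)
  qed
  then obtain f where f: "\<And>p. p \<in> selection G \<Longrightarrow>
      \<exists>U. alphabet U \<and> U \<subseteq> insert c (letters G) \<and> f p \<in> F U \<and> f p \<inter> {w. c \<notin> set w} = fst p"
    by metis
  define H where "H = \<lparr>letters = insert c (letters G), selection = (\<lambda>p. (f p, snd p)) ` selection G, axs = axs G\<rparr>"
  have "contextual_grammar F H"
  proof (rule grammarI)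
    show "alphabet (letters H)" "finite (axs H)" "axs H \<subseteq> lists (letters H)" "finite (selection H)"
      using G g(3) by (auto simp: H_def contextual_grammar_def alphabet_def)
    fix S C assume "(S, C) \<in> selection H"
    then obtain p where p: "p \<in> selection G" "S = f p" "C = snd p" by (auto simp: H_def)
    then show "\<exists>U. alphabet U \<and> U \<subseteq> letters H \<and> S \<in> F U" using f[OF p(1)] by (auto simp: H_def)
    have p': "(fst p, C) \<in> selection G" using p by simp
    show "finite C" using g(4)[OF p'] .
    show "set u \<subseteq> letters H \<and> set v \<subseteq> letters H \<and> u @ v \<noteq> []" if "(u, v) \<in> C" for u v
      using g(6,7)[OF p' that] by (auto simp: H_def)
  qed
  moreover have "L_in G = L_in H"
  proof (rule L_in_eqI)
    fix x1 x2 x3 S C u v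
    assume *: "x1 @ x2 @ x3 \<in> L_in G" "x1 @ x2 @ x3 \<in> L_in H" "(S, C) \<in> selection G" "(u, v) \<in> C" "x2 \<in> S"
    then show "x1 @ u @ x2 @ v @ x3 \<in> L_in H"
      using f[OF *(3)] by (intro L_in_step[of x1 x2 x3 H "f (S, C)" C]) (force simp: H_def)+
  next
    fix x1 x2 x3 S C u v
    assume *: "x1 @ x2 @ x3 \<in> L_in H" "x1 @ x2 @ x3 \<in> L_in G" "(S, C) \<in> selection H" "(u, v) \<in> C" "x2 \<in> S"
    then obtain p where p: "p \<in> selection G" "S = f p" "C = snd p" by (auto simp: H_def)
    \<comment> \<open>The word derived so far belongs to \<open>L_in G\<close> and has no
      \<open>c\<close>, so on its factors the padded language agrees with the original one.\<close>
    have "c \<notin> set x2" using L_in_lists[OF G *(2)] c by auto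
    then have "x2 \<in> fst p" using f[OF p(1)] p(2) *(5) by auto
    then show "x1 @ u @ x2 @ v @ x3 \<in> L_in G"
      using p * by (intro L_in_step[of x1 x2 x3 G "fst p" C]) auto
  qed (auto simp: H_def intro: L_in_axs)
  ultimately show "L \<in> IC F" using L IC_I by metis
qed

lemma star_letter: "star {[c]} = {replicate n c |n. True}"
  by (auto simp: star_singleton wpow_letter)

text \<open>Padding with \<open>star {[c]}\<close> adds only words that contain \<open>c\<close>.
  The starred language \<open>{[c]}\<close> is neither empty nor \<open>{[]}\<close>, and for
  \<open>F_2COM\<close> the right factor is \<open>{[]}\<close>.\<close>

lemma IC_LCOM: "IC (F_LCOM :: nat family) = IC F_REG"
  and IC_RCOM: "IC (F_RCOM :: nat family) = IC F_REG"
  and IC_2COM: "IC (F_2COM :: nat family) = IC F_REG"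
proof -
  note mono = REG_mono[OF subset_insertI]
  have *: "star {[c]} \<in> F_REG (insert c U)" "{[c]} \<in> F_REG (insert c U)" for c :: nat and U
    by (auto intro: REG_star REG_letter)
  have fresh: "c \<notin> set w" if "S \<in> F_REG U" "c \<notin> U" "w \<in> S" for c :: nat and U S w
    using REG_lists[OF that(1)] that by auto
  have left: "S @@ star {[c]} \<inter> {w. c \<notin> set w} = S" if "S \<in> F_REG U" "c \<notin> U" for c :: nat and U S
  proof (intro equalityI subsetI)
    fix w assume "w \<in> S" then show "w \<in> S @@ star {[c]} \<inter> {w. c \<notin> set w}"
      using fresh[OF that] concI[of w S "[]" "star {[c]}"] by (simp add: Nil_in_star)
  qed (auto simp: star_letter conc_def in_set_replicate)
  have right: "star {[c]} @@ S \<inter> {w. c \<notin> set w} = S" if "S \<in> F_REG U" "c \<notin> U" for c :: nat and U S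
  proof (intro equalityI subsetI)
    fix w assume "w \<in> S" then show "w \<in> star {[c]} @@ S \<inter> {w. c \<notin> set w}"
      using fresh[OF that] concI[of "[]" "star {[c]}" w S] by (simp add: Nil_in_star)
  qed (auto simp: star_letter conc_def in_set_replicate)
  have "S @@ star {[c]} \<in> F_LCOM (insert c U)" "star {[c]} @@ S \<in> F_RCOM (insert c U)"
    "S @@ star {[c]} \<in> F_2COM (insert c U)" if "S \<in> F_REG U" for c :: nat and U S
  proof -
    have S: "S \<in> F_REG (insert c U)" by (rule subsetD[OF mono that])
    show "S @@ star {[c]} \<in> F_LCOM (insert c U)"
      unfolding F_LCOM_def
      by (intro CollectI conjI bexI[of _ S] bexI[of _ "{[c]}"] REG_conc S *) simp_all
    show "star {[c]} @@ S \<in> F_RCOM (insert c U)"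
      unfolding F_RCOM_def
      by (intro CollectI conjI bexI[of _ S] bexI[of _ "{[c]}"] REG_conc S *) simp_all
    have "S @@ star {[c]} = S @@ star {[c]} @@ {[]}" by (simp add: conc_Nil_right)
    then show "S @@ star {[c]} \<in> F_2COM (insert c U)"
      unfolding F_2COM_def
      by (intro CollectI conjI bexI[of _ S] bexI[of _ "{[c]}"] bexI[of _ "{[]}"] REG_conc S * REG_Nil) simp_all
  qed
  then have "IC F_REG \<subseteq> IC (F_LCOM :: nat family)" "IC F_REG \<subseteq> IC (F_RCOM :: nat family)"
    "IC F_REG \<subseteq> IC (F_2COM :: nat family)"
    using left right by - (rule IC_REG_fresh, rule bexI, assumption, assumption)+
  moreover have "IC (F_LCOM :: nat family) \<subseteq> IC F_REG" "IC (F_RCOM :: nat family) \<subseteq> IC F_REG"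
    "IC (F_2COM :: nat family) \<subseteq> IC F_REG"
    by ((rule IC_mono, auto simp: F_LCOM_def F_RCOM_def F_2COM_def)[1])+
  ultimately show "IC (F_LCOM :: nat family) = IC F_REG" "IC (F_RCOM :: nat family) = IC F_REG"
    "IC (F_2COM :: nat family) = IC F_REG" by blast+
qed

section \<open>Separating languages\<close>

lemma finite_nat_bound: "finite A \<Longrightarrow> \<exists>K::nat. \<forall>x\<in>A. f x \<le> K"
  by (intro exI[of _ "\<Sum>x\<in>A. f x"] ballI member_le_sum) auto

text \<open>A word longer than \<open>K\<close> has a last derivation step, and the context inserted
  there is short.\<close>

lemma grammar_bound:
  assumes "contextual_grammar F G"
  obtains K where "\<And>x. x \<in> axs G \<Longrightarrow> length x \<le> K"
    "\<And>S C u v. (S, C) \<in> selection G \<Longrightarrow> (u, v) \<in> C \<Longrightarrow> length u \<le> K \<and> length v \<le> K"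
proof -
  note g = grammarD[OF assms]
  have fin: "finite (\<Union>(snd ` selection G))" using g(2,4) by auto
  from finite_nat_bound[OF g(1), of length] obtain K1 where K1: "\<forall>x\<in>axs G. length x \<le> K1" ..
  from finite_nat_bound[OF fin, of "\<lambda>(u, v). length u + length v"] obtain K2
    where K2: "\<forall>x\<in>\<Union>(snd ` selection G). (case x of (u, v) \<Rightarrow> length u + length v) \<le> K2" ..
  show thesis
  proof (rule that[of "K1 + K2"])
    show "length x \<le> K1 + K2" if "x \<in> axs G" for x using K1 that by auto
    show "length u \<le> K1 + K2 \<and> length v \<le> K1 + K2" if "(S, C) \<in> selection G" "(u, v) \<in> C" for S C u v
    proof -
      have "(u, v) \<in> \<Union>(snd ` selection G)" using that by force
      then have "length u + length v \<le> K2" using K2 by fastforce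
      then show ?thesis by simp
    qed
  qed
qed

section \<open>Factorizations around a marked letter\<close>

lemma split_letter [consumes 2, case_names before after]:
  assumes "x1 @ m @ x3 = \<alpha> @ s # \<beta>" "s \<notin> set m"
  obtains t where "\<alpha> = x1 @ m @ t" "x3 = t @ s # \<beta>" | t where "x1 = \<alpha> @ s # t" "\<beta> = t @ m @ x3"
proof -
  from assms(1) consider t where "x1 = \<alpha> @ t" "t @ m @ x3 = s # \<beta>"
    | t where "\<alpha> = x1 @ t" "m @ x3 = t @ s # \<beta>" by (auto simp: append_eq_append_conv2)
  then show thesis
  proof cases
    case (1 t)
    show ?thesis
    proof (cases t)
      case Nil
      then show ?thesis using 1 assms(2) that(1)[of "[]"] by (cases m) auto
    qed (use 1 that(2) in auto)
  next
    case (2 t)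
    from 2(2) consider t' where "m = t @ t'" "t' @ x3 = s # \<beta>" | t' where "t = m @ t'" "x3 = t' @ s # \<beta>"
      by (auto simp: append_eq_append_conv2)
    then show ?thesis
    proof cases
      case (1 t')
      then show ?thesis using 2 assms(2) that(1)[of "[]"] by (cases t') auto
    qed (use 2 that(1) in auto)
  qed
qed

lemma split_letter2 [consumes 3, case_names left inner right]:
  assumes "x1 @ u @ x2 @ v @ x3 = \<alpha> @ s # \<beta>" "s \<notin> set u" "s \<notin> set v"
  obtains t where "x1 = \<alpha> @ s # t" "\<beta> = t @ u @ x2 @ v @ x3"
  | t t' where "x2 = t @ s # t'" "\<alpha> = x1 @ u @ t" "\<beta> = t' @ v @ x3"
  | t where "x3 = t @ s # \<beta>" "\<alpha> = x1 @ u @ x2 @ v @ t"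
proof -
  from assms(1,2) show thesis
  proof (cases rule: split_letter)
    case (before t)
    from before(2) assms(3) show ?thesis
      by (cases rule: split_letter) (use before that in auto)
  qed (use that in auto)
qed

lemma append_Cons_cases:
  assumes "x1 @ a # x3 = w1 @ b # w2"
  obtains "x1 = w1" "a = b" "x3 = w2" | t where "x1 = w1 @ b # t" "w2 = t @ a # x3"
  | t where "w1 = x1 @ a # t" "x3 = t @ b # w2"
proof -
  from assms consider t where "x1 = w1 @ t" "t @ a # x3 = b # w2" | t where "x1 @ t = w1" "a # x3 = t @ b # w2"
    unfolding append_eq_append_conv2[of x1] by blast
  then show thesis
  proof cases
    case (1 t) then show ?thesis using that(1,2) by (cases t) auto
  next
    case (2 t) then show ?thesis using that(1,3) by (cases t) auto
  qed
qed

lemma append_eq_replicate: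
  assumes "xs @ ys = replicate n a"
  shows "xs = replicate (length xs) a" "ys = replicate (length ys) a"
proof -
  have "set (xs @ ys) \<subseteq> {a}" unfolding assms by auto
  then show "xs = replicate (length xs) a" "ys = replicate (length ys) a"
    by (intro replicate_eqI; auto)+
qed

lemma count_list_replicate: "count_list (replicate n a) b = (if a = b then n else 0)"
  by (induction n) auto

lemma count_eq_0: "count_list w a = 0 \<longleftrightarrow> a \<notin> set w"
  by (simp add: count_list_0_iff)

text \<open>Were both inserted pieces on one side of the core, they would consist of one letter only
  and violate the balance of \<open>a\<close> and \<open>b\<close>. Hence they enclose the core, and
  the shape of \<open>x2\<close> is known. The core is written \<open>c # m\<close> so that
  \<open>c\<close> can serve as a marker.\<close>

lemma balanced_removal:
  assumes eq: "replicate n a @ (c # m) @ replicate n b = x1 @ u @ x2 @ v @ x3"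
    and ne: "u @ v \<noteq> []" and cnt: "count_list (u @ v) a = count_list (u @ v) b"
    and core: "set (c # m) \<inter> set (u @ v) = {}" and ab: "a \<noteq> b" "a \<notin> set (c # m)" "b \<notin> set (c # m)"
  obtains i r s where "i \<ge> 1" "r \<le> n" "s \<le> n" "u = replicate i a" "v = replicate i b"
    "x2 = replicate r a @ (c # m) @ replicate s b"
proof -
  have eq': "x1 @ u @ x2 @ v @ x3 = replicate n a @ c # (m @ replicate n b)" using eq by simp
  have c: "c \<notin> set u" "c \<notin> set v" using core by auto
  from eq' c show thesis
  proof (cases rule: split_letter2)
    case (left t)
    have "set (u @ v) \<subseteq> set (m @ replicate n b)" unfolding left by auto
    then have *: "set (u @ v) \<subseteq> {b}" using core by auto
    then have "u @ v = replicate (length (u @ v)) b" by (intro replicate_eqI) auto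
    moreover have "count_list (u @ v) a = 0" using * ab by (auto simp: count_eq_0)
    ultimately show ?thesis using cnt ne by (metis count_list_replicate length_0_conv)
  next
    case (right t)
    have "set (u @ v) \<subseteq> set (replicate n a)" unfolding right by auto
    then have *: "set (u @ v) \<subseteq> {a}" by (auto split: if_splits)
    then have "u @ v = replicate (length (u @ v)) a" by (intro replicate_eqI) auto
    moreover have "count_list (u @ v) b = 0" using * ab by (auto simp: count_eq_0)
    ultimately show ?thesis using cnt ne by (metis count_list_replicate length_0_conv)
  next
    case (inner t t')
    note 2 = this
    have "x1 @ (u @ t) = replicate n a" using 2 by simp
    from append_eq_replicate(2)[OF this] have ut: "u @ t = replicate (length (u @ t)) a" .
    note u = append_eq_replicate(1)[OF ut] and t = append_eq_replicate(2)[OF ut]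
    have lt: "length t \<le> n" using arg_cong[OF 2(2), of length] by simp
    have "set v \<subseteq> set (m @ replicate n b)" unfolding 2 by auto
    then have "set v \<subseteq> {b}" using core by auto
    then have v: "v = replicate (length v) b" by (auto intro: replicate_eqI)
    have "count_list (u @ v) a = length u" "count_list (u @ v) b = length v"
      by (subst u, subst v, use ab in \<open>simp add: count_list_replicate\<close>)+
    with cnt have len: "length u = length v" by simp
    with ne have pos: "length u \<ge> 1" by (cases u) auto
    from 2(3) consider t2 where "m = t' @ t2" "v @ x3 = t2 @ replicate n b"
      | t2 where "t' = m @ t2" "replicate n b = t2 @ v @ x3"
      unfolding append_eq_append_conv2[of m] by metis
    then have "\<exists>s\<le>n. t' = m @ replicate s b"
    proof cases
      case 1
      \<comment> \<open>Otherwise \<open>v\<close> would begin with a letter of the core.\<close>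
      have "t2 = []"
      proof (rule ccontr)
        assume "t2 \<noteq> []"
        then have "hd v = hd t2" using 1(2) pos len by (cases v; cases t2) auto
        moreover have "hd v \<in> set v" "hd t2 \<in> set m" using \<open>t2 \<noteq> []\<close> pos len 1 by (cases v; auto)+
        ultimately show False using core by auto
      qed
      then show ?thesis using 1 by (intro exI[of _ 0]) simp
    next
      case 2
      from append_eq_replicate(1)[OF 2(2)[symmetric]] arg_cong[OF 2(2), of length]
      show ?thesis using 2(1) by (intro exI[of _ "length t2"]) auto
    qed
    then obtain s where s: "s \<le> n" "t' = m @ replicate s b" by blast
    show ?thesis
      by (rule that[of "length u" "length t" s]) (use pos lt s u v len t 2(1) in auto)
  qed
qed

subsection \<open>Finite and combinational selection\<close>

text \<open>For \<open>x = e w h\<close> the inner \<open>h e\<close> of \<open>x x\<close> is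
  absorbed by the unrestricted middle part.\<close>

lemma SYDEF_square:
  assumes "T \<in> F_SYDEF U" "x \<in> T" shows "x @ x \<in> T"
proof -
  from assms obtain E H where T: "T \<in> F_REG U" "E \<in> F_REG U" "H \<in> F_REG U" "T = E @@ lists U @@ H"
    unfolding F_SYDEF_def by blast
  with assms(2) obtain e w h where x: "x = e @ w @ h" "e \<in> E" "w \<in> lists U" "h \<in> H"
    by (auto simp: conc_def)
  then have "w @ h @ e @ w \<in> lists U" using T(2,3) by (auto dest!: REG_lists)
  from concI[OF x(2) concI[OF this x(4)]] show ?thesis unfolding T(4) x(1) by simp
qed

text \<open>The first pair wraps 1 and 2 around a single 0. The factors 31 and 24, inserted at gaps,
  supply surplus letters 1 and 2, so that a word containing \<open>x x\<close> with
  \<open>x = 1^r 0 2^s\<close> is derivable even if \<open>r\<close> and \<open>s\<close>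
  differ.\<close>

definition twin_grammar :: "nat cgrammar" where
  "twin_grammar = \<lparr>letters = {0,1,2,3,4},
     selection = {({[0]}, {([1], [2])}), ({[]}, {([3], [1]), ([2], [4])})}, axs = {[0], [0, 0]}\<rparr>"

lemma twin_grammar_FIN: "contextual_grammar F_FIN twin_grammar"
proof (rule grammarI)
  fix S C assume "(S, C) \<in> selection twin_grammar"
  then show "\<exists>U. alphabet U \<and> U \<subseteq> letters twin_grammar \<and> S \<in> F_FIN U"
    by (intro exI[of _ "{0}"]) (auto simp: twin_grammar_def alphabet_def F_FIN_def)
qed (auto simp: twin_grammar_def alphabet_def)

text \<open>With two letters 0, the 1s before the first are matched by the 2s between them, up to
  corrections for 31 and 24. A context 1, 2 around both letters 0 adds a 1 without its 2.\<close>

definition twin_inv :: "nat word \<Rightarrow> bool" where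
  "twin_inv w \<longleftrightarrow>
     count_list w 0 = 1 \<and> count_list w 1 + count_list w 4 = count_list w 2 + count_list w 3 \<or>
     (\<exists>w1 w2 w3. w = w1 @ 0 # w2 @ 0 # w3 \<and> 0 \<notin> set w1 \<and> 0 \<notin> set w2 \<and> 0 \<notin> set w3 \<and>
        count_list w1 1 + count_list w2 4 = count_list w2 2 + count_list w1 3)"

lemma twin_inv_step:
  assumes "twin_inv (x1 @ x2 @ x3)"
    and "x2 = [0] \<and> u = [1] \<and> v = [2] \<or> x2 = [] \<and> (u = [3] \<and> v = [1] \<or> u = [2] \<and> v = [4])"
  shows "twin_inv (x1 @ u @ x2 @ v @ x3)"
  using assms(1) unfolding twin_inv_def
proof (elim disjE exE conjE, goal_cases)
  case 1 then show ?case using assms(2) by (intro disjI1) auto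
next
  case (2 w1 w2 w3)
  have "\<exists>w1 w2 w3. x1 @ u @ x2 @ v @ x3 = w1 @ 0 # w2 @ 0 # w3 \<and> 0 \<notin> set w1 \<and> 0 \<notin> set w2 \<and> 0 \<notin> set w3 \<and>
        count_list w1 1 + count_list w2 4 = count_list w2 2 + count_list w1 3"
  proof (cases "x2 = []")
    case True
    with assms(2) have uv: "u = [3] \<and> v = [1] \<or> u = [2] \<and> v = [4]" by auto
    from 2(1) True have "x1 @ [] @ x3 = w1 @ 0 # (w2 @ 0 # w3)" by simp
    moreover have "0 \<notin> set ([] :: nat word)" by simp
    ultimately show ?thesis
    proof (cases rule: split_letter)
      case (before t)
      then show ?thesis using 2 uv True
        by (intro exI[of _ "x1 @ u @ v @ t"] exI[of _ w2] exI[of _ w3]) auto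
    next
      case t: (after t)
      then have "t @ [] @ x3 = w2 @ 0 # w3" by simp
      moreover have "0 \<notin> set ([] :: nat word)" by simp
      ultimately show ?thesis
      proof (cases rule: split_letter)
        case (before t')
        then show ?thesis using 2 t uv True
          by (intro exI[of _ w1] exI[of _ "t @ u @ v @ t'"] exI[of _ w3]) auto
      next
        case (after t')
        then show ?thesis using 2 t uv True
          by (intro exI[of _ w1] exI[of _ w2] exI[of _ "t' @ u @ v @ x3"]) auto
      qed
    qed
  next
    case False
    with assms(2) have x2: "x2 = [0]" "u = [1]" "v = [2]" by auto
    have x13: "x1 @ 0 # x3 = w1 @ 0 # (w2 @ 0 # w3)" using 2(1) x2 by simp
    then show ?thesis
    proof (cases rule: append_Cons_cases)
      case 1
      then show ?thesis using 2 x2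
        by (intro exI[of _ "x1 @ [1]"] exI[of _ "2 # w2"] exI[of _ w3]) auto
    next
      \<comment> \<open>Wrapping the second 0 adds a 1 to \<open>w2\<close> and a 2 to
        \<open>w3\<close>; neither of these is counted.\<close>
      case t: (2 t)
      then have "t = w2" "x3 = w3"
        using 2(3,4) append_Cons_eq_iff[of 0 w2 w3 t x3] by auto
      then show ?thesis using 2(2-5) t(1) x2
        by (intro exI[of _ w1] exI[of _ "w2 @ [1]"] exI[of _ "2 # w3"]) simp
    next
      case 3 then show ?thesis using 2(2) by simp
    qed
  qed
  then show ?case by blast
qed

lemma twin_grammar_inv: "w \<in> L_in twin_grammar \<Longrightarrow> twin_inv w"
proof (induction rule: L_in_induct)
  case (axs x)
  then have "x = [0] \<or> x = [] @ 0 # [] @ 0 # []" by (auto simp: twin_grammar_def)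
  then show ?case unfolding twin_inv_def by fastforce
next
  case (step x1 x2 x3 S C u v)
  then show ?case by (intro twin_inv_step) (auto simp: twin_grammar_def)
qed

lemma twin_grammar_step:
  "x1 @ 0 # x3 \<in> L_in twin_grammar \<Longrightarrow> x1 @ 1 # 0 # 2 # x3 \<in> L_in twin_grammar"
  "x1 @ x3 \<in> L_in twin_grammar \<Longrightarrow> x1 @ 3 # 1 # x3 \<in> L_in twin_grammar"
  "x1 @ x3 \<in> L_in twin_grammar \<Longrightarrow> x1 @ 2 # 4 # x3 \<in> L_in twin_grammar"
proof -
  have sel: "({[0]}, {([1], [2])}) \<in> selection twin_grammar"
    "({[]}, {([3], [1]), ([2], [4])}) \<in> selection twin_grammar" by (simp_all add: twin_grammar_def)
  show "x1 @ 0 # x3 \<in> L_in twin_grammar \<Longrightarrow> x1 @ 1 # 0 # 2 # x3 \<in> L_in twin_grammar"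
    using L_in_step[OF _ sel(1), of x1 "[0]" x3 "[1]" "[2]"] by simp
  show "x1 @ x3 \<in> L_in twin_grammar \<Longrightarrow> x1 @ 3 # 1 # x3 \<in> L_in twin_grammar"
    "x1 @ x3 \<in> L_in twin_grammar \<Longrightarrow> x1 @ 2 # 4 # x3 \<in> L_in twin_grammar"
    using L_in_step[OF _ sel(2), of x1 "[]" x3 "[3]" "[1]"]
      L_in_step[OF _ sel(2), of x1 "[]" x3 "[2]" "[4]"] by simp_all
qed

lemma twin_grammar_pump:
  assumes "x1 @ 0 # x3 \<in> L_in twin_grammar"
  shows "x1 @ replicate n 1 @ 0 # replicate n 2 @ x3 \<in> L_in twin_grammar"
proof (induction n)
  case (Suc n)
  from twin_grammar_step(1)[of "x1 @ replicate n 1" "replicate n 2 @ x3"] Suc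
  show ?case by (simp add: replicate_app_Cons_same)
qed (use assms in simp)

lemma twin_grammar_free:
  assumes "x1 @ x3 \<in> L_in twin_grammar"
  shows "x1 @ replicate n 3 @ replicate n 1 @ x3 \<in> L_in twin_grammar"
    "x1 @ replicate n 2 @ replicate n 4 @ x3 \<in> L_in twin_grammar"
proof (induction n)
  case (Suc n)
  {
    case 1
    from twin_grammar_step(2)[of "x1 @ replicate n 3" "replicate n 1 @ x3"] Suc(1)
    show ?case by (simp add: replicate_app_Cons_same)
  next
    case 2
    from twin_grammar_step(3)[of "x1 @ replicate n 2" "replicate n 4 @ x3"] Suc(2)
    show ?case by (simp add: replicate_app_Cons_same)
  }
qed (use assms in simp_all)

text \<open>The word \<open>1^K 0 2^K\<close> forces a selected word \<open>x = 1^r 0 2^s\<close>.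
  By \<open>SYDEF_square\<close> the word \<open>x x\<close> is selected too, and wrapping it
  violates \<open>twin_inv\<close>.\<close>

lemma FIN_not_SYDEF: "\<not> IC (F_FIN :: nat family) \<subseteq> IC F_SYDEF"
proof
  let ?L = "L_in twin_grammar"
  assume "IC (F_FIN :: nat family) \<subseteq> IC F_SYDEF"
  then have "?L \<in> IC F_SYDEF" using IC_I[OF twin_grammar_FIN] by blast
  then obtain G where G: "contextual_grammar F_SYDEF G" and L: "L_in G = ?L" by (auto simp: IC_def)
  from grammar_bound[OF G] obtain K where K: "\<And>x. x \<in> axs G \<Longrightarrow> length x \<le> K" by metis
  have ax: "[0] \<in> ?L" "[0, 0] \<in> ?L" by (rule L_in_axs, simp add: twin_grammar_def)+
  define z :: "nat word" where "z = replicate K 1 @ [0] @ replicate K 2"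
  have "z \<in> L_in G" using twin_grammar_pump[of "[]" "[]" K] ax unfolding L z_def by simp
  then show False
  proof (cases rule: L_in_cases)
    case 1 then show False using K[of z] by (simp add: z_def)
  next
    case (2 S C u v x1 x2 x3)
    note inv = twin_grammar_inv[OF 2(5)[unfolded L]]
    have cz: "count_list z = (\<lambda>a. count_list (x1 @ x2 @ x3) a + count_list (u @ v) a)"
      unfolding 2(4) by auto
    have cz': "count_list z 0 = 1" "count_list z 3 = 0" "count_list z 4 = 0"
      "count_list z 1 = count_list z 2"
      by (simp_all add: z_def count_list_replicate)
    \<comment> \<open>Every word of the language contains a 0, so the last step did not insert the
      only one.\<close>
    from inv cz' have "count_list (x1 @ x2 @ x3) 0 \<ge> 1" unfolding twin_inv_def by (elim disjE exE conjE; simp)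
    with cz cz' have "count_list (u @ v) 0 = 0" "count_list (x1 @ x2 @ x3) 0 = 1" by simp_all
    moreover from this(2) inv have "count_list (x1 @ x2 @ x3) 1 + count_list (x1 @ x2 @ x3) 4 =
        count_list (x1 @ x2 @ x3) 2 + count_list (x1 @ x2 @ x3) 3"
      unfolding twin_inv_def by (elim disjE exE conjE) simp_all
    ultimately have uv: "0 \<notin> set (u @ v)" "count_list (u @ v) 1 = count_list (u @ v) 2"
      using cz cz' by (simp_all add: count_eq_0[symmetric])
    from 2(4) have "replicate K 1 @ (0 # []) @ replicate K 2 = x1 @ u @ x2 @ v @ x3" by (simp add: z_def)
    then obtain i r s where i: "i \<ge> 1" "u = replicate i 1" "v = replicate i 2"
      "x2 = replicate r 1 @ (0 # []) @ replicate s 2"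
      by (rule balanced_removal) (use uv grammarD(6)[OF G 2(1,2)] in auto)
    from grammarD(5)[OF G 2(1)] obtain U where "S \<in> F_SYDEF U" by blast
    from SYDEF_square[OF this 2(3)] have sq: "x2 @ x2 \<in> S" .
    let ?r = "\<lambda>n a. replicate n (a::nat)"
    \<comment> \<open>Derivation of \<open>3^r 1^s x2 x2 2^r 4^s\<close>: the first 0 is wrapped
      \<open>s\<close> times, the second \<open>r\<close> times, then \<open>3^r 1^r\<close> is put
      in front and \<open>2^s 4^s\<close> at the end.\<close>
    have "?r s 1 @ 0 # ?r s 2 @ [0] \<in> ?L" using twin_grammar_pump[of "[]" "[0]" s] ax by simp
    then have "?r s 1 @ 0 # ?r s 2 @ ?r r 1 @ 0 # ?r r 2 \<in> ?L"
      using twin_grammar_pump[of "?r s 1 @ 0 # ?r s 2" "[]" r] by simp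
    then have "?r r 3 @ ?r r 1 @ ?r s 1 @ 0 # ?r s 2 @ ?r r 1 @ 0 # ?r r 2 \<in> ?L"
      using twin_grammar_free(1)[of "[]" _ r] by simp
    then have "?r r 3 @ ?r r 1 @ ?r s 1 @ 0 # ?r s 2 @ ?r r 1 @ 0 # ?r r 2 @ ?r s 2 @ ?r s 4 \<in> ?L"
      using twin_grammar_free(2)[of "?r r 3 @ ?r r 1 @ ?r s 1 @ 0 # ?r s 2 @ ?r r 1 @ 0 # ?r r 2" "[]" s] by simp
    moreover have "?r r a @ ?r s a @ w = ?r s a @ ?r r a @ w" for a w
      by (metis append_assoc replicate_add add.commute)
    note comm = this
    have "?r r 3 @ ?r r 1 @ ?r s 1 @ 0 # ?r s 2 @ ?r r 1 @ 0 # ?r r 2 @ ?r s 2 @ ?r s 4 =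
       (?r r 3 @ ?r s 1) @ (x2 @ x2) @ (?r r 2 @ ?r s 4)"
      unfolding i(4) comm[of 1] comm[of 2] by simp
    ultimately have "(?r r 3 @ ?r s 1) @ u @ (x2 @ x2) @ v @ (?r r 2 @ ?r s 4) \<in> L_in G"
      using L_in_step[OF _ 2(1,2) sq] unfolding L by metis
    from twin_grammar_inv[OF this[unfolded L]]
    have "twin_inv ((?r r 3 @ ?r s 1 @ u @ ?r r 1) @ 0 # (?r s 2 @ ?r r 1) @ 0 #
        (?r s 2 @ v @ ?r r 2 @ ?r s 4))" (is "twin_inv (?a @ 0 # ?b @ 0 # ?c)")
      using i by simp
    moreover have "count_list (?a @ 0 # ?b @ 0 # ?c) 0 = 2" using i by (simp add: count_list_replicate)
    ultimately obtain w1 w2 w3 where w: "?a @ 0 # ?b @ 0 # ?c = w1 @ 0 # w2 @ 0 # w3"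
      "0 \<notin> set w1" "0 \<notin> set w2" "0 \<notin> set w3"
      "count_list w1 1 + count_list w2 4 = count_list w2 2 + count_list w1 3"
      unfolding twin_inv_def by auto
    have n0: "0 \<notin> set ?a" "0 \<notin> set ?b" "0 \<notin> set ?c" using i by auto
    from w(1) have "?a = w1 \<and> ?b @ 0 # ?c = w2 @ 0 # w3"
      by (cases rule: append_Cons_cases) (use n0 w(2) in auto)
    moreover from this have "?b = w2" using append_Cons_eq_iff[of 0 ?b ?c w2 w3] n0 by auto
    \<comment> \<open>The balance would read \<open>r + s + i = s + r\<close> with positive
      \<open>i\<close>.\<close>
    ultimately show False using w(5) i by (auto simp: count_list_replicate)
  qed
qed

lemma F_COMB_I:
  assumes "finite U" "X \<subseteq> U" shows "lists U @@ {[a] |a. a \<in> X} \<in> F_COMB U"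
proof -
  have "{[a] |a. a \<in> X} \<in> F_REG U" using assms finite_subset[OF assms(2,1)] by (intro REG_finite) auto
  then show ?thesis unfolding F_COMB_def using REG_conc[OF REG_lists_full[OF assms(1)]] assms(2) by auto
qed

lemma SUF_D: "T \<in> F_SUF U \<Longrightarrow> x @ y \<in> T \<Longrightarrow> y \<in> T"
  unfolding F_SUF_def using REG_lists[of T U] by fastforce

lemma PRE_D: "T \<in> F_PRE U \<Longrightarrow> x @ y \<in> T \<Longrightarrow> x \<in> T"
  unfolding F_PRE_def using REG_lists[of T U] by fastforce

lemma STAR_Nil: "T \<in> F_STAR U \<Longrightarrow> [] \<in> T"
  unfolding F_STAR_def using Nil_in_star by auto

lemma CIRC_swap: "T \<in> F_CIRC U \<Longrightarrow> x @ y \<in> T \<Longrightarrow> y @ x \<in> T"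
  unfolding F_CIRC_def using rotate_append[of x y] by (metis (mono_tags, lifting) mem_Collect_eq)

section \<open>Finite and combinational selection against four closure properties\<close>

text \<open>\<open>S\<close> is left open so that one argument serves finite selection, with
  \<open>{[0], [3, 0]}\<close>, and combinational selection, with all words over 0, 1, 3 that end in
  0.\<close>

definition dc_grammar :: "nat lang \<Rightarrow> nat cgrammar" where
  "dc_grammar S = \<lparr>letters = {0,1,2,3}, selection = {(S, {([1], [2])})}, axs = {[3, 0], [0, 3, 0]}\<rparr>"

text \<open>The factors 12 and 32 are excluded. Selected words end in 0 and do not begin with 2, so
  an inserted 2 follows a 0 and an inserted 1 does not precede a 2.\<close>

definition dc_inv :: "nat word \<Rightarrow> bool" where
  "dc_inv w \<longleftrightarrow> count_list w 1 = count_list w 2 \<and> 0 \<in> set w \<and> 3 \<in> set w \<and>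
     successively (\<lambda>x y. y = 2 \<longrightarrow> x \<noteq> 1 \<and> x \<noteq> 3) w"

lemma dc_grammar_IC:
  assumes "alphabet U" "U \<subseteq> {0,1,2,3}" "S \<in> F U"
  shows "L_in (dc_grammar S) \<in> IC F"
  by (rule IC_I, rule grammarI) (use assms in \<open>auto simp: dc_grammar_def alphabet_def\<close>)

context
  fixes S :: "nat lang"
  assumes S_ge: "{[0], [3, 0]} \<subseteq> S" and S_le: "S \<subseteq> lists {0,1,3} @@ {[0]}"
begin

lemma dc_grammar_inv: "w \<in> L_in (dc_grammar S) \<Longrightarrow> dc_inv w"
proof (induction rule: L_in_induct)
  case (axs x)
  then show ?case by (auto simp: dc_grammar_def dc_inv_def)
next
  case (step x1 x2 x3 S' C u v)
  then have uv: "u = [1]" "v = [2]" "x2 \<in> S" by (auto simp: dc_grammar_def)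
  then have "x2 \<in> lists {0,1,3} @@ {[0]}" using S_le by blast
  then obtain y where y: "x2 = y @ [0]" "set y \<subseteq> {0,1,3}" unfolding conc_def lists_eq_set by blast
  have hd: "hd (y @ 0 # w) \<noteq> 2" for w using y(2) by (cases y) auto
  from step.IH show ?case unfolding dc_inv_def uv y(1)
    using hd by (auto simp: successively_append_iff successively_Cons)
qed

lemma dc_grammar_step:
  "x1 @ 0 # x3 \<in> L_in (dc_grammar S) \<Longrightarrow> x1 @ 1 # 0 # 2 # x3 \<in> L_in (dc_grammar S)"
  "x1 @ 3 # 0 # x3 \<in> L_in (dc_grammar S) \<Longrightarrow> x1 @ 1 # 3 # 0 # 2 # x3 \<in> L_in (dc_grammar S)"
proof -
  have sel: "(S, {([1], [2])}) \<in> selection (dc_grammar S)" by (simp add: dc_grammar_def)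
  show "x1 @ 0 # x3 \<in> L_in (dc_grammar S) \<Longrightarrow> x1 @ 1 # 0 # 2 # x3 \<in> L_in (dc_grammar S)"
    "x1 @ 3 # 0 # x3 \<in> L_in (dc_grammar S) \<Longrightarrow> x1 @ 1 # 3 # 0 # 2 # x3 \<in> L_in (dc_grammar S)"
    using L_in_step[OF _ sel, of x1 "[0]" x3 "[1]" "[2]"]
      L_in_step[OF _ sel, of x1 "[3, 0]" x3 "[1]" "[2]"] S_ge by simp_all
qed

lemma dc_grammar_pump:
  "x1 @ 0 # x3 \<in> L_in (dc_grammar S) \<Longrightarrow> x1 @ replicate n 1 @ 0 # replicate n 2 @ x3 \<in> L_in (dc_grammar S)"
  "x1 @ 3 # 0 # x3 \<in> L_in (dc_grammar S) \<Longrightarrow>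
    x1 @ replicate n 1 @ 3 # 0 # replicate n 2 @ x3 \<in> L_in (dc_grammar S)"
proof (induction n)
  case (Suc n)
  {
    case 1
    with dc_grammar_step(1)[of "x1 @ replicate n 1" "replicate n 2 @ x3"] Suc(1)
    show ?case by (simp add: replicate_app_Cons_same)
  next
    case 2
    with dc_grammar_step(2)[of "x1 @ replicate n 1" "replicate n 2 @ x3"] Suc(2)
    show ?case by (simp add: replicate_app_Cons_same)
  }
qed simp_all

text \<open>A long derivation forces a selected word \<open>1\<^sup>r 3 0 2\<^sup>s\<close>; the empty word and the
  rotations of it are also found at places where the insertion is illegal.\<close>

lemma dc_grammar_lower_bound:
  assumes F: "\<And>T U x. T \<in> F U \<Longrightarrow> x \<in> T \<Longrightarrow> [] \<in> T \<or> (\<forall>p q. x = p @ q \<longrightarrow> q @ p \<in> T)"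
  shows "L_in (dc_grammar S) \<notin> IC F"
proof
  let ?L = "L_in (dc_grammar S)" and ?r = "\<lambda>n a. replicate n (a::nat)"
  assume "?L \<in> IC F"
  then obtain G where G: "contextual_grammar F G" and L: "L_in G = ?L" by (auto simp: IC_def)
  from grammar_bound[OF G] obtain K where K: "\<And>x. x \<in> axs G \<Longrightarrow> length x \<le> K" by metis
  have ax: "[3, 0] \<in> ?L" "[0, 3, 0] \<in> ?L" by (rule L_in_axs, simp add: dc_grammar_def)+
  define z :: "nat word" where "z = ?r K 1 @ [3, 0] @ ?r K 2"
  have "z \<in> L_in G" using dc_grammar_pump(2)[of "[]" "[]" K] ax unfolding L z_def by simp
  then show False
  proof (cases rule: L_in_cases)
    case 1 then show False using K[of z] by (simp add: z_def)
  next
    case (2 T C u v x1 x2 x3)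
    note inv = dc_grammar_inv[OF 2(5)[unfolded L], unfolded dc_inv_def]
    have cz: "count_list z a = count_list (x1 @ x2 @ x3) a + count_list (u @ v) a" for a
      unfolding 2(4) by auto
    have cz': "count_list z 0 = 1" "count_list z 3 = 1" "count_list z 1 = count_list z 2"
      by (simp_all add: z_def count_list_replicate)
    have "count_list (x1 @ x2 @ x3) 0 \<noteq> 0" "count_list (x1 @ x2 @ x3) 3 \<noteq> 0"
      using inv unfolding count_eq_0 by auto
    with cz[of 0] cz[of 3] cz' have "count_list (u @ v) 0 = 0" "count_list (u @ v) 3 = 0" by linarith+
    then have uv: "0 \<notin> set (u @ v)" "3 \<notin> set (u @ v)" unfolding count_eq_0 .
    have cuv: "count_list (u @ v) 1 = count_list (u @ v) 2"
      using cz[of 1] cz[of 2] cz'(3) inv by linarith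
    from 2(4) have "?r K 1 @ (3 # [0]) @ ?r K 2 = x1 @ u @ x2 @ v @ x3" by (simp add: z_def)
    then obtain i r s where i: "i \<ge> 1" "u = ?r i 1" "v = ?r i 2"
      "x2 = ?r r 1 @ (3 # [0]) @ ?r s 2"
      by (rule balanced_removal) (use uv cuv grammarD(6)[OF G 2(1,2)] in auto)
    from i(1) obtain j where "i = Suc j" by (cases i) auto
    then have j: "u = ?r j 1 @ [1]" "v = 2 # ?r j 2" using i(2,3) by (simp_all add: replicate_append_same)
    from grammarD(5)[OF G 2(1)] obtain U where TF: "T \<in> F U" by blast
    from F[OF this 2(3)] show False
    proof
      assume "[] \<in> T"
      \<comment> \<open>Around the empty word, \<open>u v\<close> is inserted into 30, which creates
        the factor 12.\<close>
      from L_in_step[OF _ 2(1,2) this, of "[3]" "[0]"] ax(1) L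
      have "[3] @ u @ v @ [0] \<in> ?L" by simp
      from dc_grammar_inv[OF this] show False
        unfolding dc_inv_def j by (auto simp: successively_append_iff successively_Cons)
    next
      assume "\<forall>p q. x2 = p @ q \<longrightarrow> q @ p \<in> T"
      then have rot: "(0 # ?r s 2) @ (?r r 1 @ [3]) \<in> T"
        by (elim allE[of _ "?r r 1 @ [3]"] allE[of _ "0 # ?r s 2"]) (simp add: i(4))
      \<comment> \<open>The rotation \<open>0 2^s 1^r 3\<close> is a factor of the derivable word
        \<open>1^s 0 2^s 1^r 3 0 2^r\<close>; the context puts a 2 directly after the 3.\<close>
      have "?r s 1 @ 0 # ?r s 2 @ [3, 0] \<in> ?L" using dc_grammar_pump(1)[of "[]" "[3, 0]" s] ax by simp
      then have "?r s 1 @ 0 # ?r s 2 @ ?r r 1 @ 3 # 0 # ?r r 2 \<in> ?L"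
        using dc_grammar_pump(2)[of "?r s 1 @ 0 # ?r s 2" "[]" r] by simp
      with L_in_step[OF _ 2(1,2) rot, of "?r s 1" "0 # ?r r 2"] L
      have "(?r s 1 @ u @ 0 # ?r s 2 @ ?r r 1) @ [3] @ (v @ 0 # ?r r 2) \<in> ?L" by simp
      from dc_grammar_inv[OF this] show False
        unfolding dc_inv_def j by (auto simp: successively_append_iff successively_Cons)
    qed
  qed
qed

end

text \<open>The first alternative covers \<open>F_SUF\<close>, \<open>F_PRE\<close> and
  \<open>F_STAR\<close>, the second \<open>F_CIRC\<close>.\<close>

lemma rotation_or_Nil:
  fixes T :: "nat lang"
  assumes "F \<in> {F_SUF, F_PRE, F_STAR, F_CIRC}" "T \<in> F U" "x \<in> T"
  shows "[] \<in> T \<or> (\<forall>p q. x = p @ q \<longrightarrow> q @ p \<in> T)"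
  using assms SUF_D[of T U x "[]"] PRE_D[of T U "[]" x] STAR_Nil[of T U] CIRC_swap[of T U] by auto

lemma FIN_not:
  fixes F :: "nat family"
  assumes "F \<in> {F_SUF, F_PRE, F_STAR, F_CIRC}" shows "\<not> IC F_FIN \<subseteq> IC F"
proof -
  have "L_in (dc_grammar {[0], [3, 0]}) \<in> IC F_FIN"
    by (rule dc_grammar_IC[of "{0,3}"]) (auto simp: alphabet_def F_FIN_def)
  moreover have "[3] @ [0] \<in> lists {0,1,3} @@ {[0::nat]}" "[] @ [0] \<in> lists {0,1,3} @@ {[0::nat]}"
    by (rule concI; simp)+
  then have "L_in (dc_grammar {[0], [3, 0]}) \<notin> IC F"
    by (intro dc_grammar_lower_bound rotation_or_Nil[OF assms]) auto
  ultimately show ?thesis by blast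
qed

lemma COMB_not:
  fixes F :: "nat family"
  assumes "F \<in> {F_SUF, F_PRE, F_STAR, F_CIRC}" shows "\<not> IC F_COMB \<subseteq> IC F"
proof -
  let ?S = "lists {0,1,3} @@ {[0::nat]}"
  have "lists {0,1,3} @@ {[a] |a. a \<in> {0::nat}} \<in> F_COMB {0,1,3}" by (rule F_COMB_I) auto
  then have "L_in (dc_grammar ?S) \<in> IC F_COMB"
    by (intro dc_grammar_IC[of "{0,1,3}"]) (auto simp: alphabet_def)
  moreover have "[3] @ [0] \<in> ?S" "[] @ [0] \<in> ?S" by (rule concI; simp)+
  then have "L_in (dc_grammar ?S) \<notin> IC F"
    by (intro dc_grammar_lower_bound rotation_or_Nil[OF assms]) auto
  ultimately show ?thesis by blast
qed

text \<open>The contexts \<open>(0, 1)\<close> and \<open>(2, 3)\<close> cross in \<open>0\<^sup>n 2\<^sup>n 1\<^sup>n 3\<^sup>n\<close>, so that the last derivation step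
  selects a long word.\<close>

definition cross_grammar :: "nat cgrammar" where
  "cross_grammar = \<lparr>letters = {0,1,2,3,4,5},
     selection = {(lists {0,1,2} @@ {[1]}, {([0], [1])}), (lists {1,2,3} @@ {[3]}, {([2], [3])})},
     axs = {[0,2,1,3], [2,3,4], [0,1,5]}\<rparr>"

lemma cross_grammar_COMB: "L_in cross_grammar \<in> IC F_COMB"
proof (rule IC_I, rule grammarI)
  fix S C assume "(S, C) \<in> selection cross_grammar"
  then consider "S = lists {0,1,2} @@ {[1]}" | "S = lists {1,2,3} @@ {[3]}" by (auto simp: cross_grammar_def)
  then show "\<exists>U. alphabet U \<and> U \<subseteq> letters cross_grammar \<and> S \<in> F_COMB U"
  proof cases
    case 1
    have "lists {0,1,2} @@ {[a] |a. a \<in> {1::nat}} \<in> F_COMB {0,1,2}" by (rule F_COMB_I) auto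
    with 1 show ?thesis by (intro exI[of _ "{0,1,2}"]) (auto simp: alphabet_def cross_grammar_def)
  next
    case 2
    have "lists {1,2,3} @@ {[a] |a. a \<in> {3::nat}} \<in> F_COMB {1,2,3}" by (rule F_COMB_I) auto
    with 2 show ?thesis by (intro exI[of _ "{1,2,3}"]) (auto simp: alphabet_def cross_grammar_def)
  qed
qed (auto simp: cross_grammar_def alphabet_def)

text \<open>The axioms with 4 and 5 provide test words \<open>2^n 3^n 4\<close> and
  \<open>0^n 1^n 5\<close>, to which no 1 and no 3, respectively, can ever be added.\<close>

definition cross_inv :: "nat word \<Rightarrow> bool" where
  "cross_inv w \<longleftrightarrow> count_list w 0 = count_list w 1 \<and> count_list w 2 = count_list w 3 \<and>
     (4 \<in> set w \<longrightarrow> 1 \<notin> set w) \<and> (5 \<in> set w \<longrightarrow> 3 \<notin> set w)"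

lemma cross_grammar_inv: "w \<in> L_in cross_grammar \<Longrightarrow> cross_inv w"
proof (induction rule: L_in_induct)
  case (step x1 x2 x3 S C u v)
  then have "1 \<in> set x2 \<and> u = [0] \<and> v = [1] \<or> 3 \<in> set x2 \<and> u = [2] \<and> v = [3]"
    by (auto simp: cross_grammar_def conc_def)
  with step.IH show ?case unfolding cross_inv_def by (elim disjE conjE) simp_all
qed (auto simp: cross_grammar_def cross_inv_def)

lemma cross_grammar_step:
  "x1 @ x2 @ 1 # x3 \<in> L_in cross_grammar \<Longrightarrow> set x2 \<subseteq> {0,1,2} \<Longrightarrow> x1 @ 0 # x2 @ 1 # 1 # x3 \<in> L_in cross_grammar"
  "x1 @ x2 @ 3 # x3 \<in> L_in cross_grammar \<Longrightarrow> set x2 \<subseteq> {1,2,3} \<Longrightarrow> x1 @ 2 # x2 @ 3 # 3 # x3 \<in> L_in cross_grammar"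
proof -
  have sel: "(lists {0,1,2} @@ {[1]}, {([0], [1])}) \<in> selection cross_grammar"
    "(lists {1,2,3} @@ {[3]}, {([2], [3])}) \<in> selection cross_grammar" by (simp_all add: cross_grammar_def)
  show "x1 @ 0 # x2 @ 1 # 1 # x3 \<in> L_in cross_grammar"
    if "x1 @ x2 @ 1 # x3 \<in> L_in cross_grammar" "set x2 \<subseteq> {0,1,2}"
  proof -
    have "x2 @ [1] \<in> lists {0,1,2} @@ {[1]}" by (rule concI) (use that(2) in auto)
    from L_in_step[OF _ sel(1) _ this, of x1 x3 "[0]" "[1]"] that show ?thesis by simp
  qed
  show "x1 @ 2 # x2 @ 3 # 3 # x3 \<in> L_in cross_grammar"
    if "x1 @ x2 @ 3 # x3 \<in> L_in cross_grammar" "set x2 \<subseteq> {1,2,3}"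
  proof -
    have "x2 @ [3] \<in> lists {1,2,3} @@ {[3]}" by (rule concI) (use that(2) in auto)
    from L_in_step[OF _ sel(2) _ this, of x1 x3 "[2]" "[3]"] that show ?thesis by simp
  qed
qed

lemma cross_grammar_words:
  "replicate (Suc n) 0 @ replicate (Suc n) 2 @ replicate (Suc n) 1 @ replicate (Suc n) 3 \<in> L_in cross_grammar"
  "replicate (Suc n) 2 @ replicate (Suc n) 3 @ [4] \<in> L_in cross_grammar"
  "replicate (Suc n) 0 @ replicate (Suc n) 1 @ [5] \<in> L_in cross_grammar"
proof -
  have ax: "[0,2,1,3] \<in> L_in cross_grammar" "[2,3,4] \<in> L_in cross_grammar" "[0,1,5] \<in> L_in cross_grammar"
    by (rule L_in_axs, simp add: cross_grammar_def)+
  have 1: "replicate (Suc k) 0 @ 2 # replicate (Suc k) 1 @ [3] \<in> L_in cross_grammar" for k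
  proof (induction k)
    case (Suc k)
    from cross_grammar_step(1)[of "replicate (Suc k) 0" "2 # replicate k 1" "[3]"] Suc
    show ?case by (simp add: replicate_app_Cons_same set_replicate_conv_if)
  qed (use ax in simp)
  show "replicate (Suc n) 0 @ replicate (Suc n) 2 @ replicate (Suc n) 1 @ replicate (Suc n) 3 \<in> L_in cross_grammar"
  proof -
    have "replicate (Suc n) 0 @ replicate (Suc k) 2 @ replicate (Suc n) 1 @ replicate (Suc k) 3 \<in> L_in cross_grammar" for k
    proof (induction k)
      case (Suc k)
      from cross_grammar_step(2)[of "replicate (Suc n) 0 @ replicate (Suc k) 2" "replicate (Suc n) 1 @ replicate k 3" "[]"] Suc
      show ?case by (simp add: replicate_app_Cons_same set_replicate_conv_if)
    qed (use 1[of n] in simp)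
    then show ?thesis .
  qed
  show "replicate (Suc n) 2 @ replicate (Suc n) 3 @ [4] \<in> L_in cross_grammar"
  proof (induction n)
    case (Suc k)
    from cross_grammar_step(2)[of "replicate (Suc k) 2" "replicate k 3" "[4]"] Suc
    show ?case by (simp add: replicate_app_Cons_same set_replicate_conv_if)
  qed (use ax in simp)
  show "replicate (Suc n) 0 @ replicate (Suc n) 1 @ [5] \<in> L_in cross_grammar"
  proof (induction n)
    case (Suc k)
    from cross_grammar_step(1)[of "replicate (Suc k) 0" "replicate k 1" "[5]"] Suc
    show ?case by (simp add: replicate_app_Cons_same set_replicate_conv_if)
  qed (use ax in simp)
qed

text \<open>\<open>a\<close> stems from the left of the run of \<open>c\<close> and \<open>b\<close>
  from the right of it. The run is too long to be bridged by \<open>u\<close> and \<open>v\<close>,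
  so \<open>x2\<close> fills the gap between them.\<close>

lemma far_factors:
  assumes z: "p @ replicate n c @ q = x1 @ u @ x2 @ v @ x3"
    and len: "length u \<le> K" "length v \<le> K" "2 * K + B < n"
    and a: "a \<in> set u \<union> set v" "a \<notin> set q" and b: "b \<in> set u \<union> set v" "b \<notin> set p"
    and c: "a \<noteq> c" "b \<noteq> c"
  shows "c \<in> set x2" "B < length x2" "b \<in> set v"
proof -
  let ?z = "x1 @ u @ x2 @ v @ x3"
  let ?P = "length p"
  have zn: "?z ! k = (if k < ?P then p ! k else if k < ?P + n then c else q ! (k - ?P - n))"
    if "k < length ?z" for k
    using that unfolding z[symmetric] by (auto simp: nth_append)
  have lenz: "length ?z = ?P + n + length q" unfolding z[symmetric] by simp
  have pos_a: "k < ?P" if "k < length ?z" "?z ! k = a" for k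
    using zn[OF that(1)] that c a(2) lenz by (auto split: if_splits)
  have pos_b: "k \<ge> ?P + n" if "k < length ?z" "?z ! k = b" for k
    using zn[OF that(1)] that c b(2) by (auto split: if_splits)
  have u_pos: "\<exists>k. length x1 \<le> k \<and> k < length x1 + length u \<and> k < length ?z \<and> ?z ! k = e" if e: "e \<in> set u" for e
  proof -
    from e obtain k where "k < length u" "u ! k = e" by (auto simp: in_set_conv_nth)
    then show ?thesis by (intro exI[of _ "length x1 + k"]) (auto simp: nth_append)
  qed
  have v_pos: "\<exists>k. length x1 + length u + length x2 \<le> k \<and> k < length x1 + length u + length x2 + length v \<and>
      k < length ?z \<and> ?z ! k = e" if e: "e \<in> set v" for e
  proof -
    from e obtain k where "k < length v" "v ! k = e" by (auto simp: in_set_conv_nth)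
    then show ?thesis by (intro exI[of _ "length x1 + length u + length x2 + k"]) (auto simp: nth_append)
  qed
  have "b \<notin> set u"
  proof
    assume "b \<in> set u"
    from u_pos[OF this] pos_b obtain k where k: "length x1 \<le> k" "k < length x1 + length u" "k \<ge> ?P + n" by blast
    show False
    proof (cases "a \<in> set u")
      case True
      from u_pos[OF this] pos_a obtain k' where "length x1 \<le> k'" "k' < ?P" by blast
      then show False using k len by linarith
    next
      case False
      with a v_pos[of a] pos_a obtain k' where "length x1 + length u + length x2 \<le> k'" "k' < ?P" by blast
      then show False using k len by linarith
    qed
  qed
  with b show bv: "b \<in> set v" by blast
  from v_pos[OF this] pos_b obtain k where k: "length x1 + length u + length x2 \<le> k"
      "k < length x1 + length u + length x2 + length v" "k \<ge> ?P + n" by blast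
  have "a \<in> set u"
  proof (rule ccontr)
    assume "a \<notin> set u"
    with a v_pos[of a] pos_a obtain k' where "length x1 + length u + length x2 \<le> k'" "k' < ?P" by blast
    then show False using k len by linarith
  qed
  from u_pos[OF this] pos_a obtain k' where k': "length x1 \<le> k'" "k' < length x1 + length u" "k' < ?P" by blast
  show "B < length x2" using k k' len by linarith
  \<comment> \<open>\<open>u\<close> begins before the run and has at most \<open>K\<close> letters,
    so it ends by this position; \<open>v\<close> begins later because it reaches beyond the run and
    \<open>2 * K < n\<close>.\<close>
  let ?j = "?P + K"
  have j: "length x1 + length u \<le> ?j" "?j < length x1 + length u + length x2" using k k' len by linarith+
  then have "?z ! ?j = c" using zn[of ?j] lenz len by auto
  moreover have "?z ! ?j = x2 ! (?j - (length x1 + length u))"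
    using j by (auto simp: nth_append)
  ultimately show "c \<in> set x2" using j by (metis nth_mem add_diff_inverse_nat nat_add_left_cancel_less not_le)
qed

text \<open>A long selected word forces a cofinite selection language, which contains a power of a
  single letter. That power also occurs in a test word, where the context is illegal.\<close>

lemma COMB_not_NIL: "\<not> IC (F_COMB :: nat family) \<subseteq> IC F_NIL"
proof
  let ?L = "L_in cross_grammar" and ?r = "\<lambda>n a. replicate n (a::nat)"
  assume "IC (F_COMB :: nat family) \<subseteq> IC F_NIL"
  with cross_grammar_COMB have "?L \<in> IC F_NIL" by blast
  then obtain G where G: "contextual_grammar F_NIL G" and L: "L_in G = ?L" by (auto simp: IC_def)
  from grammar_bound[OF G] obtain K where K: "\<And>x. x \<in> axs G \<Longrightarrow> length x \<le> K"
    "\<And>S C u v. (S, C) \<in> selection G \<Longrightarrow> (u, v) \<in> C \<Longrightarrow> length u \<le> K \<and> length v \<le> K" by metis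
  have fin: "finite (\<Union>{S \<in> fst ` selection G. finite S})" using grammarD(2)[OF G] by auto
  from finite_nat_bound[OF fin, of length] obtain B where
    B: "\<forall>x\<in>\<Union>{S \<in> fst ` selection G. finite S}. length x \<le> B" ..
  define n where "n = Suc (2 * K + B)"
  define z where "z = ?r n 0 @ ?r n 2 @ ?r n 1 @ ?r n 3"
  have "z \<in> L_in G" using cross_grammar_words(1)[of "2 * K + B"] unfolding L z_def n_def .
  then show False
  proof (cases rule: L_in_cases)
    case 1 then show False using K(1)[of z] by (simp add: z_def n_def)
  next
    case (2 S C u v x1 x2 x3)
    note inv = cross_grammar_inv[OF 2(5)[unfolded L], unfolded cross_inv_def]
    note len = K(2)[OF 2(1,2)]
    have cz: "count_list z a = count_list (x1 @ x2 @ x3) a + count_list (u @ v) a" for a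
      unfolding 2(4) by auto
    have cz': "count_list z 0 = count_list z 1" "count_list z 2 = count_list z 3"
      by (simp_all add: z_def count_list_replicate)
    have c01: "count_list (u @ v) 0 = count_list (u @ v) 1" using cz[of 0] cz[of 1] cz' inv by linarith
    have c23: "count_list (u @ v) 2 = count_list (u @ v) 3" using cz[of 2] cz[of 3] cz' inv by linarith
    have set_uv: "set (u @ v) \<subseteq> {0,1,2,3}"
    proof -
      have "set (u @ v) \<subseteq> set z" unfolding 2(4) by auto
      also have "\<dots> \<subseteq> {0,1,2,3}" by (auto simp: z_def)
      finally show ?thesis .
    qed
    \<comment> \<open>Either 0 and 1 were inserted, across the run of 2, or 2 and 3, across the run
      of 1.\<close>
    have ex: "\<exists>c d. c \<in> set x2 \<and> B < length x2 \<and> d \<in> set v \<and> (c = 2 \<and> d = 1 \<or> c = 1 \<and> d = 3)"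
    proof (cases "0 \<in> set (u @ v)")
      case True
      then have "1 \<in> set (u @ v)" using c01 count_eq_0 by metis
      with True have "2 \<in> set x2 \<and> B < length x2 \<and> 1 \<in> set v"
        using far_factors[of "?r n 0" n 2 "?r n 1 @ ?r n 3" x1 u x2 v x3 K B 0 1] len 2(4)
        by (auto simp: z_def n_def)
      then show ?thesis by blast
    next
      case False
      have "2 \<in> set (u @ v) \<and> 3 \<in> set (u @ v)"
      proof (rule ccontr)
        assume "\<not> (2 \<in> set (u @ v) \<and> 3 \<in> set (u @ v))"
        then have "2 \<notin> set (u @ v)" "3 \<notin> set (u @ v)" using c23 count_eq_0[of "u @ v"] by metis+
        moreover have "1 \<notin> set (u @ v)" using False c01 count_eq_0[of "u @ v"] by metis
        ultimately have "x \<notin> set (u @ v)" for x using False set_uv by (cases "x \<in> {0,1,2,3}") auto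
        then have "set (u @ v) = {}" by (intro equals0I) metis
        then show False using grammarD(6)[OF G 2(1,2)] by simp
      qed
      then have "1 \<in> set x2 \<and> B < length x2 \<and> 3 \<in> set v"
        using far_factors[of "?r n 0 @ ?r n 2" n 1 "?r n 3" x1 u x2 v x3 K B 2 3] len 2(4)
        by (auto simp: z_def n_def)
      then show ?thesis by blast
    qed
    then obtain c d where cd: "c \<in> set x2" "B < length x2" "d \<in> set v" "c = 2 \<and> d = 1 \<or> c = 1 \<and> d = 3"
      by (elim exE conjE) metis
    from grammarD(5)[OF G 2(1)] obtain U where U: "S \<in> F_NIL U" by blast
    have "\<not> finite S" using B cd(2) 2(1,3) by force
    with U have co: "finite (lists U - S)" and SU: "S \<subseteq> lists U" by (auto simp: F_NIL_def dest: REG_lists)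
    from SU 2(3) cd(1) have cU: "c \<in> U" by auto
    have "\<exists>m. ?r (Suc m) c \<in> S"
    proof (rule ccontr)
      assume "\<nexists>m. ?r (Suc m) c \<in> S"
      then have "range (\<lambda>m. ?r (Suc m) c) \<subseteq> lists U - S" using cU by auto
      moreover have "inj (\<lambda>m. ?r (Suc m) c)" by (rule injI) (metis length_replicate nat.inject)
      ultimately show False using co by (metis finite_imageD finite_subset infinite_UNIV_nat)
    qed
    then obtain m where m: "?r (Suc m) c \<in> S" ..
    from cd(4) show False
    proof
      assume c: "c = 2 \<and> d = 1"
      from cross_grammar_words(2)[of m] have "[] @ ?r (Suc m) c @ (?r (Suc m) 3 @ [4]) \<in> L_in G"
        unfolding L using c by simp
      from L_in_step[OF this 2(1,2) m] show False
        using cross_grammar_inv cd(3) c unfolding L cross_inv_def by fastforce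
    next
      assume c: "c = 1 \<and> d = 3"
      from cross_grammar_words(3)[of m] have "?r (Suc m) 0 @ ?r (Suc m) c @ [5] \<in> L_in G"
        unfolding L using c by simp
      from L_in_step[OF this 2(1,2) m] show False
        using cross_grammar_inv cd(3) c unfolding L cross_inv_def by fastforce
    qed
  qed
qed

subsection \<open>A language that forces its main selection language\<close>

text \<open>The growth contexts keep the \<open>weight\<close> defined below equal to 0: letters of \<open>A\<close> count 1 and are
  compensated by 2 on their right or by 3 on their left, and 4 compensates 2. A step with the selection
  language \<open>S\<close> can thus be told from one that inserts 0 and 1 around a word outside of \<open>S\<close>.\<close>

definition growth :: "nat set \<Rightarrow> (nat word \<times> nat word) set" where
  "growth A = (\<lambda>s. ([s], [2])) ` A \<union> (\<lambda>s. ([3], [s])) ` A \<union> {([2], [4])}"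

text \<open>The axiom \<open>[]\<close> leads to the words \<open>0 x 1 2^n\<close>; the axiom
  \<open>[1]\<close> leads to words in which a step across the letter 1 can be tested. The letters 0
  to 4 are reserved, so \<open>A\<close> will consist of letters from 5 on.\<close>

definition probe_grammar :: "nat set \<Rightarrow> nat lang \<Rightarrow> nat cgrammar" where
  "probe_grammar A S = \<lparr>letters = A \<union> {0,1,2,3,4},
     selection = {(S, {([0], [1])}), (lists (A \<union> {2,3,4}), growth A)}, axs = {[], [1]}\<rparr>"

text \<open>The growth pair selects all words over its alphabet; this is where \<open>F\<close> has
  to include \<open>F_MON\<close>.\<close>

lemma probe_grammar_IC:
  assumes "finite A" "alphabet U" "U \<subseteq> A" "S \<in> F U" "\<And>V. alphabet V \<Longrightarrow> F_MON V \<subseteq> F V"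
  shows "L_in (probe_grammar A S) \<in> IC F"
proof (rule IC_I, rule grammarI)
  have W: "alphabet (A \<union> {2,3,4})" using assms(1) by (simp add: alphabet_def)
  then have "lists (A \<union> {2,3,4}) \<in> F (A \<union> {2,3,4})"
    using assms(5)[OF W] REG_lists_full[of "A \<union> {2,3,4}"] by (auto simp: F_MON_def alphabet_def)
  then show "\<exists>V. alphabet V \<and> V \<subseteq> letters (probe_grammar A S) \<and> T \<in> F V"
    if "(T, C) \<in> selection (probe_grammar A S)" for T C
    using that assms(2-4) W by (auto simp: probe_grammar_def)
qed (use assms(1) in \<open>auto simp: probe_grammar_def alphabet_def growth_def\<close>)

definition weight :: "nat word \<Rightarrow> int" where
  "weight w = (\<Sum>a\<leftarrow>w. if a \<le> 1 then 0 else if a = 2 \<or> a = 3 then - 1 else 1)"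

lemma weight_append [simp]: "weight (u @ v) = weight u + weight v"
  by (simp add: weight_def)

lemma weight_Cons: "weight (a # w) = (if a \<le> 1 then 0 else if a = 2 \<or> a = 3 then - 1 else 1) + weight w"
  by (simp add: weight_def)

lemma weight_replicate2 [simp]: "weight (replicate n 2) = - int n"
  and weight_replicate3 [simp]: "weight (replicate n 3) = - int n"
  by (simp_all add: weight_def sum_list_replicate)

lemma weight_ge5: "\<forall>a\<in>set w. 5 \<le> a \<Longrightarrow> weight w = int (length w)"
  by (induction w) (auto simp: weight_def)

text \<open>The two alternatives correspond to the two axioms. The finer claims concern words with
  at most one 0, so nested insertions of 0 and 1 are merely counted.\<close>

definition probe_inv :: "nat set \<Rightarrow> nat lang \<Rightarrow> nat word \<Rightarrow> bool" where
  "probe_inv A S w \<longleftrightarrow>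
     count_list w 1 = count_list w 0 \<and> weight w = 0 \<and>
       (count_list w 0 = 1 \<longrightarrow> (\<forall>\<alpha> \<mu> \<gamma>. w = \<alpha> @ 0 # \<mu> @ 1 # \<gamma> \<longrightarrow> set \<mu> \<subseteq> A \<longrightarrow> \<mu> \<in> S)) \<or>
     count_list w 1 = Suc (count_list w 0) \<and>
       (count_list w 0 = 0 \<longrightarrow> (\<forall>\<alpha> \<beta>. w = \<alpha> @ 1 # \<beta> \<longrightarrow> weight \<alpha> = 0))"

lemma probe_inv_D:
  assumes "probe_inv A S w" "w = \<alpha> @ 0 # \<mu> @ 1 # \<gamma>" "count_list w 0 = 1" "count_list w 1 = 1" "set \<mu> \<subseteq> A"
  shows "\<mu> \<in> S"
proof -
  from assms(1,3,4) have "\<forall>\<alpha> \<mu> \<gamma>. w = \<alpha> @ 0 # \<mu> @ 1 # \<gamma> \<longrightarrow> set \<mu> \<subseteq> A \<longrightarrow> \<mu> \<in> S"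
    unfolding probe_inv_def by simp
  with assms(2,5) show ?thesis by blast
qed

text \<open>\<open>N\<close> absorbs the finitely many exceptions. \<open>T\<close> may have letters
  outside \<open>A\<close>, and only its words over \<open>A\<close> can be tested in the encoding
  grammar.\<close>

definition covered :: "nat family \<Rightarrow> nat set \<Rightarrow> nat lang \<Rightarrow> bool" where
  "covered F A S \<longleftrightarrow> (\<exists>Q N. finite Q \<and>
     (\<forall>(T, p, q)\<in>Q. (\<exists>U. alphabet U \<and> T \<in> F U) \<and> (\<forall>y\<in>T \<inter> lists A. p @ y @ q \<in> S)) \<and>
     (\<forall>x\<in>S. N \<le> length x \<longrightarrow> (\<exists>(T, p, q)\<in>Q. \<exists>y\<in>T. x = p @ y @ q)))"

context
  fixes A :: "nat set" and S :: "nat lang"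
  assumes A5: "\<forall>s\<in>A. 5 \<le> s" and SA: "S \<subseteq> lists A"
begin

lemma A_small: "0 \<notin> A" "1 \<notin> A" "2 \<notin> A" "3 \<notin> A" "4 \<notin> A"
  using A5 by fastforce+

lemma weight_A: "set w \<subseteq> A \<Longrightarrow> weight w = int (length w)"
  using A5 by (intro weight_ge5) blast

lemma growthD:
  assumes "(u, v) \<in> growth A"
  shows "0 \<notin> set (u @ v)" "1 \<notin> set (u @ v)" "weight u + weight v = 0" "\<not> set (u @ v) \<subseteq> A"
  using assms A_small weight_A[of "[_]"] by (auto simp: growth_def) (auto simp: weight_def)

lemma probe_grammar_inv: "w \<in> L_in (probe_grammar A S) \<Longrightarrow> probe_inv A S w"
proof (induction rule: L_in_induct)
  case (axs x)
  then show ?case by (auto simp: probe_grammar_def probe_inv_def weight_def Cons_eq_append_conv)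
next
  case (step x1 x2 x3 T C u v)
  let ?w = "x1 @ x2 @ x3" and ?w' = "x1 @ u @ x2 @ v @ x3"
  from step.hyps consider "x2 \<in> S" "u = [0]" "v = [1]" | "x2 \<in> lists (A \<union> {2,3,4})" "(u, v) \<in> growth A"
    by (auto simp: probe_grammar_def)
  then show ?case
  proof cases
    case 1
    have x2: "set x2 \<subseteq> A" using 1(1) SA by auto
    then have x2': "count_list x2 0 = 0" "count_list x2 1 = 0" using A_small by (auto simp: count_eq_0)
    have cnt: "count_list ?w' 0 = Suc (count_list ?w 0)" "count_list ?w' 1 = Suc (count_list ?w 1)"
      "weight ?w' = weight ?w" using 1(2,3) by (auto simp: weight_def)
    show ?thesis
    proof (cases "count_list ?w 1 = count_list ?w 0")
      case True
      have "\<mu> \<in> S" if "?w' = \<alpha> @ 0 # \<mu> @ 1 # \<gamma>" "count_list ?w' 0 = 1" for \<alpha> \<mu> \<gamma>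
      proof -
        have c: "count_list ?w 0 = 0" "count_list ?w 1 = 0" using that(2) cnt True by simp_all
        then have n: "0 \<notin> set x1" "0 \<notin> set (x2 @ 1 # x3)" "1 \<notin> set x2" "1 \<notin> set x3"
          by (auto simp: count_eq_0)
        have eq: "x1 @ 0 # (x2 @ 1 # x3) = \<alpha> @ 0 # (\<mu> @ 1 # \<gamma>)" using that(1) 1 by simp
        then have "x2 @ 1 # x3 = \<mu> @ 1 # \<gamma>" using append_Cons_eq_iff[OF n(1,2)] by blast
        then have "x2 = \<mu>" using append_Cons_eq_iff[OF n(3,4)] by blast
        then show ?thesis using 1 by simp
      qed
      moreover have "weight ?w = 0" using step.IH True unfolding probe_inv_def by linarith
      ultimately show ?thesis using cnt True unfolding probe_inv_def by metis
    next
      case False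
      \<comment> \<open>The new word contains a 0, so its claim on weights is void.\<close>
      then have "count_list ?w 1 = Suc (count_list ?w 0)" using step.IH unfolding probe_inv_def by blast
      then show ?thesis using cnt unfolding probe_inv_def by simp
    qed
  next
    case 2
    let ?m = "u @ x2 @ v"
    note g = growthD[OF 2(2)]
    have n: "0 \<notin> set ?m" "1 \<notin> set ?m" "0 \<notin> set x2" "1 \<notin> set x2" using 2(1) g(1,2) A_small by auto
    then have cnt: "count_list ?w' 0 = count_list ?w 0" "count_list ?w' 1 = count_list ?w 1"
      using count_eq_0[of ?m] count_eq_0[of x2] by auto
    have wt: "weight ?m = weight x2" using g(3) by simp
    have w': "?w' = x1 @ ?m @ x3" by simp
    from step.IH show ?thesis
      unfolding probe_inv_def cnt
    proof (elim disjE, goal_cases)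
      case c: 1
      have "\<mu> \<in> S" if *: "?w' = \<alpha> @ 0 # \<mu> @ 1 # \<gamma>" "set \<mu> \<subseteq> A" "count_list ?w 0 = 1" for \<alpha> \<mu> \<gamma>
      proof -
        have c': "\<mu>' \<in> S" if "?w = \<alpha>' @ 0 # \<mu>' @ 1 # \<gamma>'" "set \<mu>' \<subseteq> A" for \<alpha>' \<mu>' \<gamma>'
          using c that *(3) by blast
        from *(1) have "x1 @ ?m @ x3 = \<alpha> @ 0 # (\<mu> @ 1 # \<gamma>)" by simp
        from this n(1) show ?thesis
        proof (cases rule: split_letter)
          case (before t)
          then show ?thesis using c'[of "x1 @ x2 @ t" \<mu> \<gamma>] *(2) by simp
        next
          case (after t)
          from after(2)[symmetric] have "t @ ?m @ x3 = \<mu> @ 1 # \<gamma>" .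
          from this n(2) show ?thesis
          proof (cases rule: split_letter)
            \<comment> \<open>Here the context lies between 0 and 1, but it would bring a letter
              outside \<open>A\<close> into \<open>\<mu>\<close>.\<close>
            case (before t')
            then show ?thesis using *(2) g(4) by auto
          next
            case (after t')
            then show ?thesis using c'[of \<alpha> \<mu> "t' @ x2 @ x3"] \<open>x1 = \<alpha> @ 0 # t\<close> *(2) by simp
          qed
        qed
      qed
      then show ?case using c wt by auto
    next
      case c: 2
      have "weight \<alpha> = 0" if *: "?w' = \<alpha> @ 1 # \<beta>" "count_list ?w 0 = 0" for \<alpha> \<beta>
      proof -
        have c': "weight \<alpha>' = 0" if "?w = \<alpha>' @ 1 # \<beta>'" for \<alpha>' \<beta>' using c that *(2) by blast
        from *(1) have "x1 @ ?m @ x3 = \<alpha> @ 1 # \<beta>" by simp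
        from this n(2) show ?thesis
        proof (cases rule: split_letter)
          case (before t)
          then show ?thesis using c'[of "x1 @ x2 @ t" \<beta>] wt by simp
        next
          case (after t)
          then show ?thesis using c'[of \<alpha> "t @ x2 @ x3"] by simp
        qed
      qed
      then show ?case using c by blast
    qed
  qed
qed

lemma probe_grammar_grow:
  assumes "x1 @ x2 @ x3 \<in> L_in (probe_grammar A S)" "(u, v) \<in> growth A" "set x2 \<subseteq> A \<union> {2,3,4}"
  shows "x1 @ u @ x2 @ v @ x3 \<in> L_in (probe_grammar A S)"
proof (rule L_in_step[OF assms(1) _ assms(2)])
  show "(lists (A \<union> {2,3,4}), growth A) \<in> selection (probe_grammar A S)" by (simp add: probe_grammar_def)
qed (use assms(3) in auto)

lemma probe_grammar_word:
  "set x \<subseteq> A \<Longrightarrow> x @ replicate (length x) 2 \<in> L_in (probe_grammar A S)"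
proof (induction x)
  case Nil then show ?case by (auto simp: probe_grammar_def intro: L_in_axs)
next
  case (Cons a x)
  have "set (x @ replicate (length x) 2) \<subseteq> A \<union> {2,3,4}" using Cons.prems by auto
  from probe_grammar_grow[OF _ _ this, of "[]" "[]" "[a]" "[2]"] Cons
  show ?case by (auto simp: growth_def replicate_append_same set_replicate_conv_if)
qed

lemma probe_grammar_main:
  assumes "x \<in> S" shows "0 # x @ 1 # replicate (length x) 2 \<in> L_in (probe_grammar A S)"
proof -
  have "(S, {([0], [1])}) \<in> selection (probe_grammar A S)" by (simp add: probe_grammar_def)
  from L_in_step[OF _ this, of "[]" x "replicate (length x) 2" "[0]" "[1]"] assms SA probe_grammar_word[of x]
  show ?thesis by auto
qed

text \<open>\<open>x\<close> is built from right to left by wrapping \<open>([3], [a])\<close>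
  around the block of 3s. Each letter of \<open>x\<close> is paid for by a 3, and behind the 1 the
  letters 2 and 4 pay for each other.\<close>

lemma probe_grammar_host:
  assumes "set x \<subseteq> A"
  shows "replicate (length x) 3 @ x @ 1 # replicate s 2 @ replicate s 4 \<in> L_in (probe_grammar A S)"
  using assms
proof (induction x)
  case Nil
  show ?case
  proof (induction s)
    case 0 then show ?case by (auto simp: probe_grammar_def intro: L_in_axs)
  next
    case (Suc s)
    from probe_grammar_grow[of "[1]" "replicate s 2 @ replicate s 4" "[]" "[2]" "[4]"] Suc
    show ?case by (auto simp: growth_def replicate_append_same set_replicate_conv_if)
  qed
next
  case (Cons a x)
  have "set (replicate (length x) 3) \<subseteq> A \<union> {2,3,4}" by auto
  from probe_grammar_grow[OF _ _ this, of "[]" "x @ 1 # replicate s 2 @ replicate s 4" "[3]" "[a]"] Cons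
  show ?case by (auto simp: growth_def)
qed

text \<open>The word \<open>0 x 1 2\<^sup>n\<close> with \<open>n = |x|\<close> can only be obtained by inserting 0 and 1: a step that adds
  letters of \<open>x\<close> together with as many letters 2 could also be applied across the letter 1 in a word
  \<open>3\<^sup>r y 1 2\<^sup>s 4\<^sup>s\<close>, where it would destroy the balance.\<close>

lemma probe_grammar_forced:
  assumes G: "contextual_grammar F G" and L: "L_in G = L_in (probe_grammar A S)"
    and K: "\<And>x. x \<in> axs G \<Longrightarrow> length x \<le> K"
    "\<And>S C u v. (S, C) \<in> selection G \<Longrightarrow> (u, v) \<in> C \<Longrightarrow> length u \<le> K \<and> length v \<le> K"
    and x: "x \<in> S" "2 * K < length x"
  obtains T C p q y j where "(T, C) \<in> selection G" "(0 # p, q @ 1 # j) \<in> C" "x = p @ y @ q" "y \<in> T"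
    "1 \<notin> set q" "\<And>y'. y' \<in> T \<Longrightarrow> y' \<in> lists A \<Longrightarrow> p @ y' @ q \<in> S"
proof -
  let ?r = "\<lambda>n a. replicate n (a::nat)"
  define z where "z = 0 # x @ 1 # ?r (length x) 2"
  have xA: "set x \<subseteq> A" using x(1) SA by auto
  then have nx: "0 \<notin> set x" "1 \<notin> set x" using A_small by auto
  have "z \<in> L_in G" using probe_grammar_main[OF x(1)] by (simp add: L z_def)
  then show thesis
  proof (cases rule: L_in_cases)
    case 1 then show thesis using K(1)[of z] x(2) by (simp add: z_def)
  next
    case (2 T C u v x1 x2 x3)
    note len = K(2)[OF 2(1,2)]
    let ?y = "x1 @ x2 @ x3"
    note inv = probe_grammar_inv[OF 2(5)[unfolded L], unfolded probe_inv_def]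
    have cz: "count_list z a = count_list ?y a + count_list (u @ v) a" "weight z = weight ?y + weight (u @ v)" for a
      unfolding 2(4) by auto
    have cz': "count_list z 0 = 1" "count_list z 1 = 1" "weight z = 0"
      using nx weight_A[OF xA] by (auto simp: z_def count_list_replicate count_eq_0 weight_Cons)
    have eq: "x1 @ u @ x2 @ v @ x3 = (0 # x) @ 1 # ?r (length x) 2" using 2(4) by (simp add: z_def)
    show thesis
    proof (cases "0 \<in> set (u @ v) \<or> 1 \<in> set (u @ v)")
      case False
      then have n: "0 \<notin> set u" "0 \<notin> set v" "1 \<notin> set u" "1 \<notin> set v" by auto
      then have "count_list ?y 0 = 1" "count_list ?y 1 = 1"
        using cz(1)[of 0] cz(1)[of 1] cz' count_eq_0[of "u @ v"] by auto
      with inv have "weight ?y = 0" by simp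
      with cz(2) cz' have wuv: "weight u + weight v = 0" by simp
      have uv_ne: "u @ v \<noteq> []" by (rule grammarD(6)[OF G 2(1,2)])
      from eq n(3,4) have False
      proof (cases rule: split_letter2)
        case (left t)
        have "set (u @ v) \<subseteq> set (?r (length x) 2)" unfolding left by auto
        then have "set (u @ v) \<subseteq> {2}" by (auto split: if_splits)
        then have "u @ v = ?r (length (u @ v)) 2" by (intro replicate_eqI) auto
        then have "weight (u @ v) = - int (length (u @ v))" by (metis weight_replicate2)
        then have "length (u @ v) = 0" using wuv unfolding weight_append by linarith
        then show False using uv_ne by simp
      next
        case (right t)
        have "set (u @ v) \<subseteq> set (0 # x)" unfolding right by auto
        then have "weight (u @ v) = int (length (u @ v))" using n xA by (intro weight_A) auto
        then have "length (u @ v) = 0" using wuv unfolding weight_append by linarith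
        then show False using uv_ne by simp
      next
        case (inner t t')
        have "set v \<subseteq> set (?r (length x) 2)" unfolding inner by auto
        then have "v = ?r (length v) 2" by (intro replicate_eqI) (auto split: if_splits)
        then have wv: "weight v = - int (length v)" by (metis weight_replicate2)
        have "set u \<subseteq> set (0 # x)" unfolding inner by auto
        then have wu: "weight u = int (length u)" using n xA by (intro weight_A) auto
        have u_ne: "u \<noteq> []" using wu wv wuv uv_ne by auto
        have "x1 \<noteq> []" using inner(2) u_ne n(1) by (cases u) auto
        then obtain x1' where "x1 = 0 # x1'" "x = x1' @ u @ t" using inner(2) by (cases x1) auto
        then have tA: "set t \<subseteq> A" using xA by auto
        have t': "t' = ?r (length t') 2" using append_eq_replicate(1)[OF inner(3)[symmetric]] .
        \<comment> \<open>\<open>x2\<close> is \<open>t 1 2^s\<close> with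
          \<open>s = length t'\<close> and thus a factor of the host word for \<open>t\<close>.
          There the step adds the positive weight of \<open>u\<close> to the left of the 1.\<close>
        from probe_grammar_host[OF tA, of "length t'"]
        have "?r (length t) 3 @ x2 @ ?r (length t') 4 \<in> L_in G" using inner(1) t' by (simp add: L)
        from L_in_step[OF this 2(1,2,3)]
        have h: "(?r (length t) 3 @ u @ t) @ 1 # (t' @ v @ ?r (length t') 4) \<in> L_in (probe_grammar A S)"
          using inner(1) by (simp add: L)
        have "0 \<notin> set ((?r (length t) 3 @ u @ t) @ 1 # (t' @ v @ ?r (length t') 4))"
          using n tA A_small t' by (auto simp: in_set_replicate) (metis in_set_replicate zero_neq_numeral)
        moreover have "count_list ((?r (length t) 3 @ u @ t) @ 1 # (t' @ v @ ?r (length t') 4)) 1 \<noteq> 0"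
          by simp
        ultimately have "weight (?r (length t) 3 @ u @ t) = 0"
          using probe_grammar_inv[OF h] unfolding probe_inv_def count_eq_0[symmetric] by metis
        then show False using wu u_ne weight_A[OF tA] by simp
      qed
      then show ?thesis ..
    next
      case True
      \<comment> \<open>Otherwise the word before the step has a 1 but no 0, and the weight left of
        its 1 is 0. But what stands there is a word over \<open>A\<close>, nonempty because of
        \<open>2 * K < length x\<close>.\<close>
      have 1: "1 \<in> set (u @ v)"
      proof (rule ccontr)
        assume n1: "1 \<notin> set (u @ v)"
        then have "count_list ?y 1 = 1" using cz(1)[of 1] cz' count_eq_0[of "u @ v"] by auto
        moreover have "count_list (u @ v) 0 \<noteq> 0" using True n1 count_eq_0[of "u @ v"] by blast
        then have "count_list ?y 0 = 0" using cz(1)[of 0] cz'(1) by linarith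
        ultimately have y: "weight \<alpha> = 0" if "?y = \<alpha> @ 1 # \<beta>" for \<alpha> \<beta> using inv that by simp
        have "1 \<notin> set u" "1 \<notin> set v" using n1 by auto
        from eq \<open>1 \<notin> set u\<close> \<open>1 \<notin> set v\<close> obtain \<alpha>' \<beta>' where
          *: "?y = \<alpha>' @ 1 # \<beta>'" "set \<alpha>' \<subseteq> set (0 # x)" "length (0 # x) \<le> length \<alpha>' + length u + length v"
        proof (cases rule: split_letter2)
          case (left t)
          then show ?thesis using that[of "0 # x" "t @ x2 @ x3"] by simp
        next
          case (inner t t')
          then have "set (x1 @ t) \<subseteq> set (0 # x)" "length (0 # x) = length (x1 @ t) + length u" by auto
          then show ?thesis using that[of "x1 @ t" "t' @ x3"] inner by simp
        next
          case (right t)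
          then have "set (x1 @ x2 @ t) \<subseteq> set (0 # x)" "length (0 # x) = length (x1 @ x2 @ t) + length u + length v" by auto
          then show ?thesis using that[of "x1 @ x2 @ t" "?r (length x) 2"] right by simp
        qed
        have "0 \<notin> set \<alpha>'" using \<open>count_list ?y 0 = 0\<close> *(1) unfolding count_eq_0 by (metis Un_iff set_append)
        then have "weight \<alpha>' = int (length \<alpha>')" using *(2) xA by (intro weight_A) auto
        with y[OF *(1)] *(3) len x(2) show False by simp
      qed
      have c1: "count_list (u @ v) 1 = 1" "count_list ?y 1 = 0"
        using 1 cz(1)[of 1] cz' count_eq_0[of "u @ v" 1] by auto
      have "count_list ?y 0 = 0" using inv c1 by linarith
      then have 0: "0 \<in> set (u @ v)" using cz(1)[of 0] cz' count_eq_0[of "u @ v" 0] by auto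
      \<comment> \<open>The 0 stands left of the 1, so \<open>u\<close> would contain all of
        \<open>0 x 1\<close> and exceed its length bound.\<close>
      have "1 \<notin> set u"
      proof
        assume "1 \<in> set u"
        then obtain u1 u2 where u: "u = u1 @ 1 # u2" by (meson split_list)
        have "(x1 @ u1) @ 1 # (u2 @ x2 @ v @ x3) = (0 # x) @ 1 # ?r (length x) 2" using eq u by simp
        then have xu: "x1 @ u1 = 0 # x" "u2 @ x2 @ v @ x3 = ?r (length x) 2"
          using append_Cons_eq_iff[of 1 "0 # x" "?r (length x) 2" "x1 @ u1" "u2 @ x2 @ v @ x3"] nx by auto
        have "0 \<notin> set v"
        proof
          assume "0 \<in> set v"
          then have "0 \<in> set (?r (length x) 2)" unfolding xu(2)[symmetric] by simp
          then show False by simp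
        qed
        then have "0 \<in> set u" using 0 by simp
        then have "0 \<in> set u1 \<or> 0 \<in> set u2" using u by simp
        then have "0 \<in> set u1"
        proof
          assume "0 \<in> set u2"
          then have "0 \<in> set (?r (length x) 2)" unfolding xu(2)[symmetric] by simp
          then show ?thesis by simp
        qed
        then have "x1 = []" using xu(1) nx by (cases x1) auto
        then have "length u > length x" using xu u arg_cong[OF xu(1), of length] by simp
        then show False using len x(2) by simp
      qed
      then have "1 \<in> set v" using 1 by simp
      then obtain q j where v: "v = q @ 1 # j" "1 \<notin> set q" by (meson split_list_first)
      have "(x1 @ u @ x2 @ q) @ 1 # (j @ x3) = (0 # x) @ 1 # ?r (length x) 2" using eq v by simp
      then have e: "x1 @ u @ x2 @ q = 0 # x" "j @ x3 = ?r (length x) 2"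
        using append_Cons_eq_iff[of 1 "0 # x" "?r (length x) 2" "x1 @ u @ x2 @ q" "j @ x3"] nx by auto
      have "0 \<notin> set j" using e(2) append_eq_replicate(1)[OF e(2)] by (metis in_set_replicate zero_neq_numeral)
      have "x1 = []"
      proof (rule ccontr)
        assume "x1 \<noteq> []"
        then have "set (u @ x2 @ q) \<subseteq> set x" using e(1) by (cases x1) auto
        then show False using 0 v nx \<open>0 \<notin> set j\<close> by auto
      qed
      \<comment> \<open>An empty \<open>u\<close> would leave the 0 to \<open>v\<close>, whose part
        before the 1 would then be all of \<open>0 x\<close>.\<close>
      have "u \<noteq> []"
      proof
        assume u: "u = []"
        then have "0 \<in> set q" using 0 v \<open>0 \<notin> set j\<close> by auto
        then have "x2 = []" using e(1) u \<open>x1 = []\<close> nx by (cases x2) auto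
        then have "length q = Suc (length x)" using e(1) u \<open>x1 = []\<close> by simp
        then show False using len x(2) v by simp
      qed
      then obtain p where p: "u = 0 # p" "x = p @ x2 @ q" using e(1) \<open>x1 = []\<close> by (cases u) auto
      \<comment> \<open>The same pair is applied to \<open>y'\<close> followed by its letters 2. The
        result has a single 0 and a single 1 with \<open>p y' q\<close> between them, which
        \<open>probe_inv\<close> places in \<open>S\<close>.\<close>
      have "p @ y' @ q \<in> S" if y': "y' \<in> T" "y' \<in> lists A" for y'
      proof -
        have "[] @ y' @ ?r (length y') 2 \<in> L_in G" using probe_grammar_word[of y'] y'(2) by (auto simp: L)
        from L_in_step[OF this 2(1,2) y'(1)]
        have h: "[] @ 0 # (p @ y' @ q) @ 1 # (j @ ?r (length y') 2) \<in> L_in (probe_grammar A S)"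
          using p v by (simp add: L)
        have sub: "set (p @ y' @ q) \<subseteq> A" using xA p(2) y'(2) by auto
        then have "0 \<notin> set (p @ y' @ q)" using A_small by blast
        then have c: "count_list ([] @ 0 # (p @ y' @ q) @ 1 # (j @ ?r (length y') 2)) 0 = 1"
          using \<open>0 \<notin> set j\<close> by (auto simp: count_eq_0 count_list_replicate)
        have "1 \<notin> set (p @ y' @ q)" "1 \<notin> set j"
          using sub A_small append_eq_replicate(1)[OF e(2)] by (blast, metis in_set_replicate one_eq_numeral_iff semiring_norm(85))
        then have "count_list ([] @ 0 # (p @ y' @ q) @ 1 # (j @ ?r (length y') 2)) 1 = 1"
          by (auto simp: count_eq_0 count_list_replicate)
        from probe_inv_D[OF probe_grammar_inv[OF h] refl c this sub] show ?thesis .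
      qed
      then show thesis using that[of T C p q j x2] 2 p v by auto
    qed
  qed
qed

lemma probe_grammar_covered:
  assumes "L_in (probe_grammar A S) \<in> IC F"
  shows "covered F A S"
proof -
  from assms obtain G where G: "contextual_grammar F G" and L: "L_in G = L_in (probe_grammar A S)"
    by (auto simp: IC_def)
  from grammar_bound[OF G] obtain K where K: "\<And>x. x \<in> axs G \<Longrightarrow> length x \<le> K"
    "\<And>S C u v. (S, C) \<in> selection G \<Longrightarrow> (u, v) \<in> C \<Longrightarrow> length u \<le> K \<and> length v \<le> K" by metis
  define P where "P = (\<Union>(T, C)\<in>selection G. {T} \<times> C)"
  \<comment> \<open>Candidates are read off from all contexts: \<open>tl\<close> removes the 0 of
    \<open>0 # p\<close>, and \<open>takeWhile\<close> keeps what precedes the 1. The intersection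
    discards contexts without this meaning.\<close>
  define Q where "Q = (\<lambda>(T, u, v). (T, tl u, takeWhile (\<lambda>a. a \<noteq> 1) v)) ` P \<inter>
     {(T, p, q). \<forall>y\<in>T \<inter> lists A. p @ y @ q \<in> S}"
  have "finite P" unfolding P_def using grammarD(2,4)[OF G] by auto
  then have "finite Q" unfolding Q_def by simp
  moreover have "(\<exists>U. alphabet U \<and> T \<in> F U) \<and> (\<forall>y\<in>T \<inter> lists A. p @ y @ q \<in> S)" if "(T, p, q) \<in> Q" for T p q
  proof -
    from that obtain C where "(T, C) \<in> selection G" by (auto simp: Q_def P_def)
    from grammarD(5)[OF G this] have "\<exists>U. alphabet U \<and> T \<in> F U" by blast
    then show ?thesis using that by (auto simp: Q_def)
  qed
  moreover have "\<exists>(T, p, q)\<in>Q. \<exists>y\<in>T. x = p @ y @ q" if x: "x \<in> S" "Suc (2 * K) \<le> length x" for x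
  proof -
    have x2: "2 * K < length x" using x(2) by simp
    show ?thesis
    proof (rule probe_grammar_forced[OF G L K x(1) x2])
      fix T C p q y j
      assume *: "(T, C) \<in> selection G" "(0 # p, q @ 1 # j) \<in> C" "x = p @ y @ q" "y \<in> T" "1 \<notin> set q"
        "\<And>y'. y' \<in> T \<Longrightarrow> y' \<in> lists A \<Longrightarrow> p @ y' @ q \<in> S"
      have "(T, 0 # p, q @ 1 # j) \<in> P" unfolding P_def using *(1,2) by blast
      moreover have "takeWhile (\<lambda>a. a \<noteq> 1) (q @ 1 # j) = q" using *(5) by (induction q) auto
      ultimately have "(T, p, q) \<in> (\<lambda>(T, u, v). (T, tl u, takeWhile (\<lambda>a. a \<noteq> 1) v)) ` P" by force
      then have "(T, p, q) \<in> Q" unfolding Q_def using *(6) by blast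
      then show ?thesis using *(3,4) by blast
    qed auto
  qed
  ultimately show ?thesis
    unfolding covered_def by (intro exI[of _ Q] exI[of _ "Suc (2 * K)"] conjI) (assumption, fast, blast)
qed

end

section \<open>From uncovered languages to separations\<close>

lemma not_IC_subset:
  assumes "finite A" "\<forall>s\<in>A. 5 \<le> s" "alphabet U" "U \<subseteq> A" "S \<in> F U" "S \<subseteq> lists A"
    "\<And>V. alphabet V \<Longrightarrow> F_MON V \<subseteq> F V" "\<not> covered F' A S"
  shows "\<not> IC F \<subseteq> IC F'"
  using probe_grammar_IC[OF assms(1,3,4,5,7)] probe_grammar_covered[OF assms(2,6)] assms(8) by blast

text \<open>As \<open>Q\<close> is finite, one \<open>K\<close> bounds the exceptions, all
  \<open>p\<close> and \<open>q\<close>, and the parameter of a property \<open>P\<close> that each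
  \<open>T\<close> has, such as its constant for non-counting.\<close>

lemma covered_bounded:
  assumes "covered F A S" "\<And>T U. alphabet U \<Longrightarrow> T \<in> F U \<Longrightarrow> \<exists>k::nat. P T k"
    and mono: "\<And>T k k'. P T k \<Longrightarrow> k \<le> k' \<Longrightarrow> P T k'"
  shows "\<exists>K. \<forall>x\<in>S. K \<le> length x \<longrightarrow> (\<exists>T U p y q. alphabet U \<and> T \<in> F U \<and> P T K \<and>
    x = p @ y @ q \<and> length p \<le> K \<and> length q \<le> K \<and> y \<in> T \<and> (\<forall>y\<in>T \<inter> lists A. p @ y @ q \<in> S))"
proof -
  from assms(1) obtain Q N where Q: "finite Q"
    "\<forall>(T, p, q)\<in>Q. (\<exists>U. alphabet U \<and> T \<in> F U) \<and> (\<forall>y\<in>T \<inter> lists A. p @ y @ q \<in> S)"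
    "\<forall>x\<in>S. N \<le> length x \<longrightarrow> (\<exists>(T, p, q)\<in>Q. \<exists>y\<in>T. x = p @ y @ q)"
    unfolding covered_def by blast
  define b where "b = (\<lambda>(T, p, q). (SOME k. P T k) + length (p::nat word) + length (q::nat word))"
  from finite_nat_bound[OF Q(1), of b] obtain B where B: "\<forall>x\<in>Q. b x \<le> B" ..
  show ?thesis
  proof (intro exI[of _ "N + B"] ballI impI)
    fix x assume x: "x \<in> S" "N + B \<le> length x"
    then obtain T p q y where T: "(T, p, q) \<in> Q" "y \<in> T" "x = p @ y @ q" using Q(3) by fastforce
    with Q(2) obtain U where U: "alphabet U" "T \<in> F U" "\<forall>y\<in>T \<inter> lists A. p @ y @ q \<in> S" by blast
    have bB: "(SOME k. P T k) + length p + length q \<le> B" using B T(1) by (auto simp: b_def)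
    have "P T (SOME k. P T k)" using assms(2)[OF U(1,2)] by (rule someI_ex)
    then have "P T (N + B)" by (rule mono) (use bB in simp)
    moreover have "length p \<le> N + B" "length q \<le> N + B" using bB by simp_all
    ultimately show "\<exists>T U p y q. alphabet U \<and> T \<in> F U \<and> P T (N + B) \<and>
      x = p @ y @ q \<and> length p \<le> N + B \<and> length q \<le> N + B \<and> y \<in> T \<and> (\<forall>y\<in>T \<inter> lists A. p @ y @ q \<in> S)"
      using T U by blast
  qed
qed

subsection \<open>Witnesses\<close>

lemma MON_ORD: fixes V :: "nat set" assumes "alphabet V" shows "F_MON V \<subseteq> F_ORD V"
  using MON_NIL[of V] NIL_DEF[of V] DEF_ORD[of V] assms unfolding alphabet_def by blast

lemma MON_NC: fixes V :: "nat set" assumes "alphabet V" shows "F_MON V \<subseteq> F_NC V"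
  using MON_ORD[OF assms] ORD_NC by blast

lemma MON_SYDEF: "F_MON V \<subseteq> F_SYDEF V"
proof
  fix L assume L: "L \<in> F_MON V"
  then have "L = {[]} @@ lists V @@ {[]}" by (simp add: F_MON_def conc_Nil_left conc_Nil_right)
  with L show "L \<in> F_SYDEF V" unfolding F_SYDEF_def F_MON_def using REG_Nil[of V] by blast
qed

lemma conc_assoc: "(A @@ B) @@ C = A @@ B @@ C"
proof (intro equalityI subsetI)
  fix w assume "w \<in> (A @@ B) @@ C"
  then obtain a b c where "w = a @ b @ c" "a \<in> A" "b \<in> B" "c \<in> C" by (auto simp: conc_def)
  then show "w \<in> A @@ B @@ C" by (auto intro: concI)
next
  fix w assume "w \<in> A @@ B @@ C"
  then obtain a b c where "w = (a @ b) @ c" "a \<in> A" "b \<in> B" "c \<in> C" by (auto simp: conc_def)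
  then show "w \<in> (A @@ B) @@ C" by (metis concI)
qed

lemma core_factor:
  assumes "replicate m a @ c @ replicate m b = p @ y @ q" "length p \<le> K" "length q \<le> K" "K \<le> m"
  obtains i j where "i \<le> K" "j \<le> K" "p = replicate i a" "q = replicate j b"
    "y = replicate (m - i) a @ c @ replicate (m - j) b"
proof -
  have m: "length p \<le> m" "length q \<le> m" using assms(2-4) by simp_all
  have "replicate m a = replicate (length p) a @ replicate (m - length p) a"
    "replicate m b = replicate (m - length q) b @ replicate (length q) b"
    using m by (simp_all add: replicate_add[symmetric])
  with assms(1) have eq: "replicate (length p) a @ (replicate (m - length p) a @ c @ replicate (m - length q) b) @ replicate (length q) b
      = p @ y @ q" by simp
  then have p: "replicate (length p) a = p" and
    r: "(replicate (m - length p) a @ c @ replicate (m - length q) b) @ replicate (length q) b = y @ q"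
    by (subst (asm) append_eq_append_conv; simp)+
  from r have "replicate (m - length p) a @ c @ replicate (m - length q) b = y" "replicate (length q) b = q"
    by (subst (asm) append_eq_append_conv; simp)+
  with p show thesis using that[of "length p" "length q"] assms(2,3) by simp
qed

lemma long_run:
  assumes "u @ replicate n c @ v = p @ y @ q" "length p + length q + k \<le> n"
  obtains y1 y2 where "y = y1 @ replicate k c @ y2"
proof -
  have "replicate n c = replicate (length p) c @ replicate k c @ replicate (n - length p - k) c"
    using assms(2) by (simp add: replicate_add[symmetric])
  with assms(1) have eq: "(u @ replicate (length p) c) @ replicate k c @ (replicate (n - length p - k) c @ v) = p @ y @ q"
    by simp
  define y1 where "y1 = drop (length p) (u @ replicate (length p) c)"
  define r where "r = replicate (n - length p - k) c @ v"
  define y2 where "y2 = take (length r - length q) r"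
  have "take (length p) (p @ y @ q) = take (length p) (u @ replicate (length p) c)" unfolding eq[symmetric] by simp
  then have 1: "u @ replicate (length p) c = p @ y1" unfolding y1_def by (metis append_eq_conv_conj append_take_drop_id)
  have lr: "length q \<le> length r" using assms(2) by (simp add: r_def)
  have "rev q = take (length q) (rev (p @ y @ q))" by simp
  also have "\<dots> = take (length q) (rev r)" unfolding eq[symmetric] r_def[symmetric] using lr by simp
  also have "\<dots> = rev (drop (length r - length q) r)" using lr by (simp add: rev_drop)
  finally have 2: "r = y2 @ q" unfolding y2_def by (metis append_take_drop_id rev_rev_ident)
  have "p @ (y1 @ replicate k c @ y2) @ q = p @ y @ q" using eq unfolding 1 r_def[symmetric] 2 by simp
  then have "y = y1 @ replicate k c @ y2" by simp
  then show thesis by (rule that)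
qed

text \<open>The word \<open>x\<close> may depend on \<open>K\<close> only. Whichever
  \<open>p T q\<close> is offered for it, the properties of \<open>T\<close> have to produce a word
  outside of \<open>S\<close>.\<close>

lemma not_coveredI:
  assumes "\<And>T U. alphabet U \<Longrightarrow> T \<in> F U \<Longrightarrow> \<exists>k::nat. P T k" "\<And>T k k'. P T k \<Longrightarrow> k \<le> k' \<Longrightarrow> P T k'"
    and "\<And>K. \<exists>x\<in>S. K \<le> length x \<and> (\<forall>T U p y q. alphabet U \<longrightarrow> T \<in> F U \<longrightarrow> P T K \<longrightarrow> x = p @ y @ q \<longrightarrow>
       length p \<le> K \<longrightarrow> length q \<le> K \<longrightarrow> y \<in> T \<longrightarrow> (\<exists>y'\<in>T \<inter> lists A. p @ y' @ q \<notin> S))"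
  shows "\<not> covered F A S"
proof
  assume cov: "covered F A S"
  have "\<exists>K. \<forall>x\<in>S. K \<le> length x \<longrightarrow> (\<exists>T U p y q. alphabet U \<and> T \<in> F U \<and> P T K \<and>
    x = p @ y @ q \<and> length p \<le> K \<and> length q \<le> K \<and> y \<in> T \<and> (\<forall>y\<in>T \<inter> lists A. p @ y @ q \<in> S))"
    by (rule covered_bounded[where P = P, OF cov]; (rule assms(1) | rule assms(2)); assumption)
  then obtain K where K: "\<And>x. x \<in> S \<Longrightarrow> K \<le> length x \<Longrightarrow>
    \<exists>T U p y q. alphabet U \<and> T \<in> F U \<and> P T K \<and>
    x = p @ y @ q \<and> length p \<le> K \<and> length q \<le> K \<and> y \<in> T \<and> (\<forall>y\<in>T \<inter> lists A. p @ y @ q \<in> S)"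
    by blast
  from assms(3)[of K] obtain x where x: "x \<in> S" "K \<le> length x" and *: "\<And>T U p y q. alphabet U \<Longrightarrow>
    T \<in> F U \<Longrightarrow> P T K \<Longrightarrow> x = p @ y @ q \<Longrightarrow> length p \<le> K \<Longrightarrow> length q \<le> K \<Longrightarrow> y \<in> T \<Longrightarrow>
    \<exists>y'\<in>T \<inter> lists A. p @ y' @ q \<notin> S" by blast
  from K[OF x] obtain T U p y q where "alphabet U" "T \<in> F U" "P T K" "x = p @ y @ q" "length p \<le> K"
    "length q \<le> K" "y \<in> T" and S: "\<forall>y\<in>T \<inter> lists A. p @ y @ q \<in> S" by blast
  from *[OF this(1-7)] S show False by blast
qed

lemma REG_star_letter: "a \<in> V \<Longrightarrow> star {[a]} \<in> F_REG V"
  by (intro REG_star REG_letter)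

lemma sorted_decomposition:
  "set w \<subseteq> {5,6,7} \<Longrightarrow> sorted w \<Longrightarrow> \<exists>i j k. w = replicate i (5::nat) @ replicate j 6 @ replicate k 7"
proof (induction w)
  case (Cons a w)
  then obtain i j k where w: "w = replicate i 5 @ replicate j 6 @ replicate k 7" by auto
  consider "a = 5" | "a = 6" | "a = 7" using Cons.prems(1) by auto
  then show ?case
  proof cases
    case 1 then show ?thesis using w by (intro exI[of _ "Suc i"] exI[of _ j] exI[of _ k]) simp
  next
    case 2
    then have "i = 0" using Cons.prems(2) w by (cases i) auto
    then show ?thesis using w 2 by (intro exI[of _ 0] exI[of _ "Suc j"] exI[of _ k]) simp
  next
    case 3
    then have "i = 0" "j = 0" using Cons.prems(2) w by (cases i; cases j; auto)+
    then show ?thesis using w 3 by (intro exI[of _ 0] exI[of _ "Suc k"]) simp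
  qed
qed (auto intro: exI[of _ 0])

section \<open>Separation from finite, definite and non-counting selection\<close>

lemma MON_not_FIN: "\<not> IC F_MON \<subseteq> IC (F_FIN :: nat family)"
proof (rule not_IC_subset[of "{5}" "{5}" "lists {5}"])
  show "lists {5} \<in> F_MON {5}" by (simp add: F_MON_def REG_lists_full)
  show "\<not> covered F_FIN {5} (lists {5})"
  proof (rule not_coveredI[where P = "\<lambda>T k. \<forall>w\<in>T. length w \<le> k"])
    show "\<exists>k. \<forall>w\<in>T. length w \<le> k" if "T \<in> F_FIN U" for T :: "nat lang" and U
      using that finite_nat_bound[of T length] by (auto simp: F_FIN_def)
    show "\<exists>x\<in>lists {5::nat}. K \<le> length x \<and> (\<forall>T U p y q. alphabet U \<longrightarrow> T \<in> F_FIN U \<longrightarrow> (\<forall>w\<in>T. length w \<le> K) \<longrightarrow>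
      x = p @ y @ q \<longrightarrow> length p \<le> K \<longrightarrow> length q \<le> K \<longrightarrow> y \<in> T \<longrightarrow> (\<exists>y'\<in>T \<inter> lists {5}. p @ y' @ q \<notin> lists {5}))" for K
    proof (rule bexI[of _ "replicate (Suc (3 * K)) (5::nat)"], intro conjI allI impI)
      fix T :: "nat lang" and U :: "nat set" and p y q :: "nat word"
      assume "replicate (Suc (3 * K)) 5 = p @ y @ q" "length p \<le> K" "length q \<le> K" "y \<in> T" "\<forall>w\<in>T. length w \<le> K"
      then have "length (p @ y @ q) = Suc (3 * K)" "length y \<le> K" by (metis length_replicate, blast)
      then show "\<exists>y'\<in>T \<inter> lists {5}. p @ y' @ q \<notin> lists {5}"
        using \<open>length p \<le> K\<close> \<open>length q \<le> K\<close> by simp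
    qed auto
  qed fastforce
qed (auto simp: alphabet_def)

text \<open>The occurrence of a 6 is remembered by a monotone automaton. Behind a long run of 5 it
  is hidden from the short suffixes that a definite language also contains.\<close>

lemma ORD_not_DEF: "\<not> IC F_ORD \<subseteq> IC (F_DEF :: nat family)"
proof -
  define S where "S = {w \<in> lists {5,6}. (6::nat) \<in> set w}"
  have "S = lists {5,6} @@ {[6]} @@ lists {5,6}"
  proof (intro equalityI subsetI)
    fix w assume "w \<in> S"
    then have w: "w \<in> lists {5,6}" "6 \<in> set w" by (simp_all add: S_def)
    from split_list[OF w(2)] obtain x y where xy: "w = x @ 6 # y" by blast
    have "x @ [6] @ y \<in> lists {5,6} @@ {[6]} @@ lists {5,6}" by (intro concI) (use w(1) xy in auto)
    then show "w \<in> lists {5,6} @@ {[6]} @@ lists {5,6}" using xy by simp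
  qed (auto simp: conc_def S_def)
  then have S_REG: "S \<in> F_REG {5,6}" by (simp add: REG_conc REG_lists_full REG_letter)
  define \<delta> where "\<delta> = (\<lambda>s a::nat. if a = 6 then 1 else s :: nat)"
  have fold: "foldl \<delta> s w = (if 6 \<in> set w then 1 else s)" for s w
    by (induction w arbitrary: s) (auto simp: \<delta>_def)
  have [simp]: "\<delta> s 5 = s" "\<delta> s 6 = 1" for s by (simp_all add: \<delta>_def)
  have "is_dfa {5,6} {0,1} 0 {1} \<delta>" "S = dfa_lang {5,6} 0 {1} \<delta>"
    "linear_order_on {0,1} {(0,0),(0,1),(1,1::nat)}"
    "\<forall>z z'. (z, z') \<in> {(0,0),(0,1),(1,1)} \<longrightarrow> (\<forall>a\<in>{5,6}. (\<delta> z a, \<delta> z' a) \<in> {(0,0),(0,1),(1,1)})"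
    by (auto simp: is_dfa_def dfa_lang_def fold S_def order_on_defs refl_on_def trans_def antisym_def total_on_def)
  with S_REG have S: "S \<in> F_ORD {5,6}" unfolding F_ORD_def by blast
  \<comment> \<open>A long word of a definite language ends in a word of \<open>B\<close>, which
    itself belongs to the language.\<close>
  let ?P = "\<lambda>T (k::nat). \<forall>w\<in>T. k < length w \<longrightarrow> (\<exists>v b. w = v @ b \<and> length b \<le> k \<and> b \<in> T)"
  have "\<not> covered F_DEF {5,6} S"
  proof (rule not_coveredI[where P = ?P])
    fix T :: "nat lang" and U assume "T \<in> F_DEF U"
    then obtain A B where T: "finite A" "finite B" "T = A \<union> lists U @@ B" by (auto simp: F_DEF_def)
    from T(1,2) finite_nat_bound[of "A \<union> B" length] obtain k where k: "\<forall>w\<in>A \<union> B. length w \<le> k" by auto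
    have "\<exists>v b. w = v @ b \<and> length b \<le> k \<and> b \<in> T" if w: "w \<in> T" "k < length w" for w
    proof -
      have "w \<notin> A" using k w(2) by force
      then have "w \<in> lists U @@ B" using w(1) unfolding T(3) by blast
      then obtain v b where "w = v @ b" "b \<in> B" by (auto simp: conc_def)
      then show ?thesis using k T(3) concI[of "[]" "lists U" b B] by fastforce
    qed
    then show "\<exists>k. ?P T k" by blast
  next
    fix T :: "nat lang" and k k' :: nat assume *: "?P T k" "k \<le> k'"
    show "?P T k'"
    proof (intro ballI impI)
      fix w assume "w \<in> T" "k' < length w"
      with * obtain v b where "w = v @ b" "length b \<le> k" "b \<in> T" by fastforce
      then show "\<exists>v b. w = v @ b \<and> length b \<le> k' \<and> b \<in> T" using *(2) by fastforce
    qed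
  next
    fix K :: nat
    let ?r = "replicate (3 * K) (5::nat)" let ?x = "?r @ [6] @ ?r"
    show "\<exists>x\<in>S. K \<le> length x \<and> (\<forall>T U p y q. alphabet U \<longrightarrow> T \<in> F_DEF U \<longrightarrow> ?P T K \<longrightarrow> x = p @ y @ q \<longrightarrow>
       length p \<le> K \<longrightarrow> length q \<le> K \<longrightarrow> y \<in> T \<longrightarrow> (\<exists>y'\<in>T \<inter> lists {5,6}. p @ y' @ q \<notin> S))"
    proof (rule bexI[of _ ?x], intro conjI allI impI)
      fix T U and p y q :: "nat word"
      assume *: "?P T K" "?x = p @ y @ q" "length p \<le> K" "length q \<le> K" "y \<in> T"
      obtain i j where ij: "i \<le> K" "j \<le> K" "p = replicate i 5" "q = replicate j 5"
        "y = replicate (3 * K - i) 5 @ [6] @ replicate (3 * K - j) 5"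
        using *(2-4) by (rule core_factor) auto
      have "K < length y" using ij by simp
      with *(1,5) obtain v b where b: "y = v @ b" "length b \<le> K" "b \<in> T" by blast
      have "6 \<notin> set b"
      proof
        assume "6 \<in> set b"
        then obtain b1 b2 where b': "b = b1 @ 6 # b2" by (meson split_list)
        have "(v @ b1) @ 6 # b2 = replicate (3 * K - i) 5 @ 6 # replicate (3 * K - j) 5" using b(1) b' ij(5) by simp
        then have "b2 = replicate (3 * K - j) 5"
          using append_Cons_eq_iff[of 6 "replicate (3 * K - i) 5" "replicate (3 * K - j) 5" "v @ b1" b2]
          by (auto simp: in_set_replicate)
        then show False using b(2) b' ij(2) by simp
      qed
      moreover have "set b \<subseteq> set y" unfolding b(1) by auto
      then have "b \<in> lists {5,6}" unfolding ij(5) by (auto split: if_splits)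
      moreover have "p @ b @ q \<notin> S" using \<open>6 \<notin> set b\<close> ij by (auto simp: S_def)
      ultimately show "\<exists>y'\<in>T \<inter> lists {5,6}. p @ y' @ q \<notin> S" using b(3) by blast
    qed (auto simp: S_def)
  qed
  then show ?thesis using S MON_ORD
    by (intro not_IC_subset[of "{5,6}" "{5,6}" S]) (auto simp: alphabet_def S_def)
qed

text \<open>As \<open>k\<close> is positive, membership of \<open>x a^k z\<close> forces
  \<open>x\<close>, \<open>a\<close> and \<open>z\<close> to be over \<open>U\<close>, so that the
  non-counting property applies.\<close>

lemma NC_pump_letter:
  assumes "T \<in> F_NC U"
  shows "\<exists>k\<ge>1. \<forall>x a z. x @ replicate k a @ z \<in> T \<longrightarrow> x @ replicate (Suc k) a @ z \<in> T"
proof -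
  from assms obtain k where k: "T \<in> F_REG U" "k \<ge> 1" "\<And>x y z. x \<in> lists U \<Longrightarrow> y \<in> lists U \<Longrightarrow> z \<in> lists U \<Longrightarrow>
    x @ wpow y k @ z \<in> T \<longleftrightarrow> x @ wpow y (k + 1) @ z \<in> T" unfolding F_NC_def by blast
  have "x @ replicate (Suc k) a @ z \<in> T" if *: "x @ replicate k a @ z \<in> T" for x a z
  proof -
    have "x @ replicate k a @ z \<in> lists U" using REG_lists[OF k(1)] * by blast
    then have "x \<in> lists U" "[a] \<in> lists U" "z \<in> lists U" using k(2) by (auto simp: in_set_replicate)
    from k(3)[OF this] * show ?thesis by (simp add: wpow_letter)
  qed
  with k(2) show ?thesis by blast
qed

text \<open>A non-counting \<open>T\<close> cannot notice one more letter in a run of length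
  \<open>K\<close>; \<open>S\<close> has to notice it, however the short ends are cut off.\<close>

lemma not_covered_NC:
  assumes "\<And>K. \<exists>x\<in>S. K \<le> length x \<and> (\<forall>p y q. x = p @ y @ q \<longrightarrow> length p \<le> K \<longrightarrow> length q \<le> K \<longrightarrow>
    (\<exists>y1 y2 a. y = y1 @ replicate K a @ y2 \<and> y1 @ replicate (Suc K) a @ y2 \<in> lists A \<and>
       p @ (y1 @ replicate (Suc K) a @ y2) @ q \<notin> S))"
  shows "\<not> covered F_NC A S"
proof (rule not_coveredI[where P = "\<lambda>T k. \<forall>x a z. x @ replicate k a @ z \<in> T \<longrightarrow> x @ replicate (Suc k) a @ z \<in> T"])
  fix T :: "nat lang" and U assume "T \<in> F_NC U"
  from NC_pump_letter[OF this]
  show "\<exists>k. \<forall>x a z. x @ replicate k a @ z \<in> T \<longrightarrow> x @ replicate (Suc k) a @ z \<in> T" by blast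
next
  fix T :: "nat lang" and k k' :: nat
  assume *: "\<forall>x a z. x @ replicate k a @ z \<in> T \<longrightarrow> x @ replicate (Suc k) a @ z \<in> T" "k \<le> k'"
  have split: "replicate k' a = replicate (k' - k) a @ replicate k a" for a :: nat
    using *(2) by (simp add: replicate_add[symmetric])
  have "replicate (Suc k') a = replicate (k' - k) a @ replicate (Suc k) a" for a :: nat
    using *(2) by (simp add: replicate_add[symmetric] del: replicate_Suc)
  then show "\<forall>x a z. x @ replicate k' a @ z \<in> T \<longrightarrow> x @ replicate (Suc k') a @ z \<in> T"
    using *(1) split by (metis append_assoc)
next
  fix K
  from assms[of K] obtain x where x: "x \<in> S" "K \<le> length x" and *: "\<And>p y q. x = p @ y @ q \<Longrightarrow>
    length p \<le> K \<Longrightarrow> length q \<le> K \<Longrightarrow> \<exists>y1 y2 a. y = y1 @ replicate K a @ y2 \<and>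
    y1 @ replicate (Suc K) a @ y2 \<in> lists A \<and> p @ (y1 @ replicate (Suc K) a @ y2) @ q \<notin> S" by blast
  show "\<exists>x\<in>S. K \<le> length x \<and> (\<forall>T U p y q. alphabet U \<longrightarrow> T \<in> F_NC U \<longrightarrow>
     (\<forall>x a z. x @ replicate K a @ z \<in> T \<longrightarrow> x @ replicate (Suc K) a @ z \<in> T) \<longrightarrow> x = p @ y @ q \<longrightarrow>
     length p \<le> K \<longrightarrow> length q \<le> K \<longrightarrow> y \<in> T \<longrightarrow> (\<exists>y'\<in>T \<inter> lists A. p @ y' @ q \<notin> S))"
  proof (rule bexI[OF _ x(1)], intro conjI x(2) allI impI)
    fix T U p y q
    assume T: "\<forall>x a z. x @ replicate K a @ z \<in> T \<longrightarrow> x @ replicate (Suc K) a @ z \<in> T"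
      "x = p @ y @ q" "length p \<le> K" "length q \<le> K" "y \<in> T"
    from *[OF T(2-4)] obtain y1 y2 a where y: "y = y1 @ replicate K a @ y2"
      "y1 @ replicate (Suc K) a @ y2 \<in> lists A" "p @ (y1 @ replicate (Suc K) a @ y2) @ q \<notin> S" by blast
    then have "y1 @ replicate (Suc K) a @ y2 \<in> T" using T(1,5) by blast
    with y show "\<exists>y'\<in>T \<inter> lists A. p @ y' @ q \<notin> S" by blast
  qed
qed

lemma star_55: "star {[5,5::nat]} = {replicate (2 * n) 5 |n. True}"
proof -
  have "wpow [5,5] n = replicate (2 * n) (5::nat)" for n by (induction n) (auto simp: wpow_0 wpow_Suc)
  then show ?thesis by (simp add: star_singleton)
qed

text \<open>Membership depends on the parity of the run of 5 before the first 6, and everything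
  behind that 6 is free.\<close>

lemma SYDEF_not_NC: "\<not> IC F_SYDEF \<subseteq> IC (F_NC :: nat family)"
proof -
  define S where "S = star {[5,5]} @@ {[6]} @@ lists {5,6::nat}"
  have E: "star {[5,5]} @@ {[6]} \<in> F_REG {5,6::nat}" by (intro REG_conc REG_star REG_letter REG_word) auto
  have S_eq: "S = (star {[5,5]} @@ {[6]}) @@ lists {5,6} @@ {[]}"
    unfolding S_def conc_Nil_right conc_assoc ..
  have "S \<in> F_REG {5,6}" unfolding S_eq by (intro REG_conc REG_star REG_letter REG_word REG_lists_full REG_Nil) auto
  then have S: "S \<in> F_SYDEF {5,6}" unfolding F_SYDEF_def using E REG_Nil[of "{5,6}"] S_eq by blast
  have tw: "length (takeWhile (\<lambda>a. a \<noteq> 6) (replicate n (5::nat) @ 6 # v)) = n" for n v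
    by (induction n) auto
  have S_even: "even (length (takeWhile (\<lambda>a. a \<noteq> 6) w))" if "w \<in> S" for w
  proof -
    from that obtain n v where "w = replicate (2 * n) 5 @ 6 # v" by (auto simp: S_def star_55 conc_def)
    then show ?thesis using tw by simp
  qed
  have "\<not> covered F_NC {5,6} S"
  proof (rule not_covered_NC)
    fix K :: nat
    let ?r = "replicate (2 * K) (5::nat)" let ?x = "?r @ [6] @ ?r"
    show "\<exists>x\<in>S. K \<le> length x \<and> (\<forall>p y q. x = p @ y @ q \<longrightarrow> length p \<le> K \<longrightarrow> length q \<le> K \<longrightarrow>
      (\<exists>y1 y2 a. y = y1 @ replicate K a @ y2 \<and> y1 @ replicate (Suc K) a @ y2 \<in> lists {5,6} \<and>
       p @ (y1 @ replicate (Suc K) a @ y2) @ q \<notin> S))"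
    proof (rule bexI[of _ ?x], intro conjI allI impI)
      show "?x \<in> S" unfolding S_def star_55 by (intro concI) auto
      fix p y q :: "nat word" assume *: "?x = p @ y @ q" "length p \<le> K" "length q \<le> K"
      obtain i j where ij: "i \<le> K" "j \<le> K" "p = replicate i 5" "q = replicate j 5"
        "y = replicate (2 * K - i) 5 @ [6] @ replicate (2 * K - j) 5"
        using * by (rule core_factor) auto
      let ?y1 = "replicate (K - i) (5::nat)" and ?y2 = "[6] @ replicate (2 * K - j) (5::nat)"
      have "p @ (?y1 @ replicate (Suc K) 5 @ ?y2) @ q = replicate (Suc (2 * K)) 5 @ 6 # (replicate (2 * K - j) 5 @ q)"
        using ij(1) unfolding ij(3) by (simp add: replicate_add[symmetric] flip: append_assoc replicate_Suc)
      then have "p @ (?y1 @ replicate (Suc K) 5 @ ?y2) @ q \<notin> S"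
        using S_even[of "replicate (Suc (2 * K)) 5 @ 6 # (replicate (2 * K - j) 5 @ q)"] unfolding tw
        by (metis even_Suc even_mult_iff dvd_refl)
      moreover have "y = ?y1 @ replicate K 5 @ ?y2"
        using ij(1) unfolding ij(5) by (simp add: replicate_add[symmetric] flip: append_assoc)
      moreover have "?y1 @ replicate (Suc K) 5 @ ?y2 \<in> lists {5,6}" by auto
      ultimately show "\<exists>y1 y2 a. y = y1 @ replicate K a @ y2 \<and> y1 @ replicate (Suc K) a @ y2 \<in> lists {5,6} \<and>
        p @ (y1 @ replicate (Suc K) a @ y2) @ q \<notin> S" by blast
    qed simp
  qed
  moreover have "S \<subseteq> lists {5,6}" by (rule REG_lists) (use S in \<open>simp add: F_SYDEF_def\<close>)
  ultimately show ?thesis using S MON_SYDEF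
    by (intro not_IC_subset[of "{5,6}" "{5,6}" S]) (auto simp: alphabet_def)
qed

text \<open>Counting is demanded only in the presence of both end markers 5 and 7. An infix that
  keeps both keeps every 6 between them, and any other infix is exempt.\<close>

lemma INF_not_NC: "\<not> IC F_INF \<subseteq> IC (F_NC :: nat family)"
proof -
  define S where "S = {w \<in> lists {5,6,7}. sorted w \<and> count_list w 5 \<le> 1 \<and> count_list w 7 \<le> 1 \<and>
     ((5::nat) \<in> set w \<and> 7 \<in> set w \<longrightarrow> even (count_list w 6))}"
  let ?E = "star {[6,6::nat]}" and ?C = "star {[6::nat]}"
  have E: "?E = {replicate (2 * n) 6 |n. True}"
  proof -
    have "wpow [6,6] n = replicate (2 * n) (6::nat)" for n by (induction n) (auto simp: wpow_0 wpow_Suc)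
    then show ?thesis by (simp add: star_singleton)
  qed
  have S_eq: "S = {[5]} @@ ?E @@ {[7]} \<union> ({[], [5]} @@ ?C \<union> ?C @@ {[], [7]})"
  proof (intro equalityI subsetI)
    fix w assume w: "w \<in> S"
    then obtain i j k where ijk: "w = replicate i 5 @ replicate j 6 @ replicate k 7"
      using sorted_decomposition[of w] by (auto simp: S_def lists_eq_set)
    with w have "i \<le> 1" "k \<le> 1" "i = 1 \<and> k = 1 \<longrightarrow> even j" by (auto simp: S_def count_list_replicate)
    then consider "i = 1" "k = 1" "even j" | "i = 0" "k \<le> 1" | "i \<le> 1" "k = 0" by linarith
    then show "w \<in> {[5]} @@ ?E @@ {[7]} \<union> ({[], [5]} @@ ?C \<union> ?C @@ {[], [7]})"
    proof cases
      case 1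
      then have "w \<in> {[5]} @@ ?E @@ {[7]}" unfolding ijk E by (intro concI) (auto elim: evenE)
      then show ?thesis by blast
    next
      case 2
      then have "replicate k 7 \<in> {[], [7::nat]}" by (cases k) auto
      then have "w \<in> ?C @@ {[], [7]}" unfolding ijk using 2(1) concI[of "replicate j 6" ?C "replicate k 7" "{[],[7]}"]
        by (auto simp: star_letter)
      then show ?thesis by blast
    next
      case 3
      then have "replicate i 5 \<in> {[], [5::nat]}" by (cases i) auto
      then have "w \<in> {[], [5]} @@ ?C" unfolding ijk using 3(2) concI[of "replicate i 5" "{[],[5]}" "replicate j 6" ?C]
        by (auto simp: star_letter)
      then show ?thesis by blast
    qed
  qed (auto simp: S_def conc_def E star_letter sorted_append count_list_replicate in_set_replicate)
  have "S \<in> F_REG {5,6,7}" unfolding S_eq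
    by (intro REG_union REG_conc REG_star REG_letter REG_word REG_finite) auto
  then have S: "S \<in> F_INF {5,6,7}" unfolding F_INF_def
  proof (intro CollectI conjI ballI impI)
    fix x y z assume xyz: "x @ y @ z \<in> S" and y: "y \<in> lists {5,6,7}"
    have "even (count_list y 6)" if "5 \<in> set y" "7 \<in> set y"
    proof -
      have "\<forall>a\<in>set x. a \<le> 5" "\<forall>a\<in>set z. 7 \<le> a" using xyz that by (auto simp: S_def sorted_append)
      then have "6 \<notin> set x" "6 \<notin> set z" by auto
      moreover have "even (count_list (x @ y @ z) 6)" using xyz that by (simp add: S_def)
      ultimately show ?thesis by (simp add: count_eq_0[symmetric])
    qed
    then show "y \<in> S" using xyz y by (simp add: S_def sorted_append)
  qed
  have "\<not> covered F_NC {5,6,7} S"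
  proof (rule not_covered_NC)
    fix K :: nat
    \<comment> \<open>An even number of letters 6, large enough for a run of \<open>K\<close> to
      remain after two cuts of length at most \<open>K\<close>.\<close>
    let ?x = "[5] @ replicate (4 * K) (6::nat) @ [7]"
    show "\<exists>x\<in>S. K \<le> length x \<and> (\<forall>p y q. x = p @ y @ q \<longrightarrow> length p \<le> K \<longrightarrow> length q \<le> K \<longrightarrow>
      (\<exists>y1 y2 a. y = y1 @ replicate K a @ y2 \<and> y1 @ replicate (Suc K) a @ y2 \<in> lists {5,6,7} \<and>
       p @ (y1 @ replicate (Suc K) a @ y2) @ q \<notin> S))"
    proof (rule bexI[of _ ?x], intro conjI allI impI)
      show "?x \<in> S" by (auto simp: S_def sorted_append count_list_replicate)
      fix p y q :: "nat word" assume *: "?x = p @ y @ q" "length p \<le> K" "length q \<le> K"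
      then obtain y1 y2 where y: "y = y1 @ replicate K 6 @ y2"
        by (elim long_run[where k = K]) simp
      have x: "?x = p @ (y1 @ replicate K 6 @ y2) @ q" using *(1) y by simp
      have c: "count_list ?x a = count_list (p @ (y1 @ replicate K 6 @ y2) @ q) a" for a unfolding x ..
      have s: "set ?x = set (p @ (y1 @ replicate K 6 @ y2) @ q)" unfolding x ..
      have "5 \<in> set (p @ (y1 @ replicate (Suc K) 6 @ y2) @ q)" "7 \<in> set (p @ (y1 @ replicate (Suc K) 6 @ y2) @ q)"
        using s by auto
      moreover have "count_list (p @ (y1 @ replicate (Suc K) 6 @ y2) @ q) 6 = Suc (4 * K)"
        using c[of 6] by (simp add: count_list_replicate)
      ultimately have "p @ (y1 @ replicate (Suc K) 6 @ y2) @ q \<notin> S" unfolding S_def by simp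
      moreover have "y1 @ replicate (Suc K) 6 @ y2 \<in> lists {5,6,7}"
        using s unfolding lists_eq_set by (auto split: if_splits)
      ultimately show "\<exists>y1 y2 a. y = y1 @ replicate K a @ y2 \<and> y1 @ replicate (Suc K) a @ y2 \<in> lists {5,6,7} \<and>
        p @ (y1 @ replicate (Suc K) a @ y2) @ q \<notin> S" using y by blast
    qed simp
  qed
  then show ?thesis using S MON_INF
    by (intro not_IC_subset[of "{5,6,7}" "{5,6,7}" S]) (auto simp: alphabet_def S_def)
qed

section \<open>Separation by closure properties\<close>

lemma MON_SUF: "F_MON V \<subseteq> F_SUF V"
  using MON_INF INF_SUF by blast

lemma MON_PRE: "F_MON V \<subseteq> F_PRE V"
  using MON_INF INF_PRE by blast

lemma MON_CIRC: "F_MON V \<subseteq> F_CIRC V"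
  using MON_COMM COMM_CIRC by blast

text \<open>With outer runs of length \<open>K + 1\<close>, at least one \<open>a\<close> and one
  \<open>b\<close> remain in \<open>y\<close>; hence \<open>Suc i\<close> and
  \<open>Suc j\<close>.\<close>

lemma not_covered_core:
  assumes "\<And>m. replicate m a @ c @ replicate m b \<in> S"
    and "\<And>T U i j k l. T \<in> F U \<Longrightarrow> replicate (Suc i) a @ c @ replicate (Suc j) b \<in> T \<Longrightarrow>
      \<exists>y\<in>T \<inter> lists A. replicate k a @ y @ replicate l b \<notin> S"
  shows "\<not> covered F A S"
proof (rule not_coveredI[where P = "\<lambda>_ _. True"])
  fix K :: nat
  let ?x = "replicate (Suc K) a @ c @ replicate (Suc K) b"
  show "\<exists>x\<in>S. K \<le> length x \<and> (\<forall>T U p y q. alphabet U \<longrightarrow> T \<in> F U \<longrightarrow> True \<longrightarrow> x = p @ y @ q \<longrightarrow>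
     length p \<le> K \<longrightarrow> length q \<le> K \<longrightarrow> y \<in> T \<longrightarrow> (\<exists>y'\<in>T \<inter> lists A. p @ y' @ q \<notin> S))"
  proof (rule bexI[of _ ?x], intro conjI allI impI)
    fix T U p y q
    assume T: "T \<in> F U" "y \<in> T" and *: "?x = p @ y @ q" "length p \<le> K" "length q \<le> K"
    obtain i j where ij: "i \<le> K" "j \<le> K" "p = replicate i a" "q = replicate j b"
      "y = replicate (Suc K - i) a @ c @ replicate (Suc K - j) b"
      using * by (rule core_factor) auto
    then show "\<exists>y'\<in>T \<inter> lists A. p @ y' @ q \<notin> S"
      using T assms(2)[OF T(1), of "K - i" "K - j" i j] by (simp add: Suc_diff_le)
  qed (use assms(1)[of "Suc K"] in auto)
qed auto

text \<open>For \<open>x = 5^i 6^j\<close> with positive exponents, both \<open>x x\<close> and the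
  rotation \<open>6^j 5^i\<close> are unsorted. One language thus serves against
  \<open>F_SYDEF\<close>, \<open>F_STAR\<close> and \<open>F_CIRC\<close>.\<close>

lemma INF_not:
  fixes F :: "nat family"
  assumes F: "\<And>T U x. T \<in> F U \<Longrightarrow> x \<in> T \<Longrightarrow> x @ x \<in> T \<or> (\<forall>p q. x = p @ q \<longrightarrow> q @ p \<in> T)"
  shows "\<not> IC F_INF \<subseteq> IC F"
proof -
  define S where "S = {w \<in> lists {5,6}. sorted (w :: nat word)}"
  have S_eq: "S = star {[5]} @@ star {[6]}"
  proof (intro equalityI subsetI)
    fix w assume w: "w \<in> S"
    then obtain i j k where ijk: "w = replicate i 5 @ replicate j 6 @ replicate k 7"
      using sorted_decomposition[of w] by (auto simp: S_def lists_eq_set)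
    with w have "k = 0" by (cases k) (auto simp: S_def)
    then show "w \<in> star {[5]} @@ star {[6]}" unfolding star_letter ijk by (auto intro!: concI)
  qed (auto simp: S_def conc_def star_letter sorted_append)
  have "S \<in> F_REG {5,6}" unfolding S_eq by (intro REG_conc REG_star_letter) auto
  then have S: "S \<in> F_INF {5,6}" unfolding F_INF_def by (auto simp: S_def sorted_append)
  have "\<not> covered F {5,6} S"
  proof (rule not_covered_core[where a = 5 and b = 6 and c = "[]"])
    show "replicate m 5 @ [] @ replicate m 6 \<in> S" for m by (auto simp: S_def sorted_append)
    fix T :: "nat lang" and U and i j k l :: nat
    let ?p = "replicate (Suc i) (5::nat)" and ?q = "replicate (Suc j) (6::nat)"
    assume T: "T \<in> F U" "?p @ [] @ ?q \<in> T"
    from F[OF T] have "\<exists>y\<in>T \<inter> lists {5,6}. \<not> sorted y"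
    proof
      assume *: "(?p @ [] @ ?q) @ (?p @ [] @ ?q) \<in> T"
      show ?thesis by (rule bexI[OF _ IntI[OF *]]) (auto simp: sorted_append)
    next
      assume *: "\<forall>p q. ?p @ [] @ ?q = p @ q \<longrightarrow> q @ p \<in> T"
      have "?q @ ?p \<in> T" by (rule *[rule_format]) simp
      then show ?thesis by (intro bexI[of _ "?q @ ?p"]) (auto simp: sorted_append)
    qed
    then show "\<exists>y\<in>T \<inter> lists {5,6}. replicate k 5 @ y @ replicate l 6 \<notin> S"
      by (auto simp: S_def sorted_append)
  qed
  then show ?thesis using S MON_INF
    by (intro not_IC_subset[of "{5,6}" "{5,6}" S]) (auto simp: alphabet_def S_def)
qed

lemma STAR_square: "T \<in> F_STAR U \<Longrightarrow> x \<in> T \<Longrightarrow> x @ x \<in> T"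
  unfolding F_STAR_def using star_append by blast

lemma INF_not_SYDEF: "\<not> IC F_INF \<subseteq> IC (F_SYDEF :: nat family)"
  by (rule INF_not) (blast intro: SYDEF_square)

lemma INF_not_STAR: "\<not> IC F_INF \<subseteq> IC (F_STAR :: nat family)"
  by (rule INF_not) (blast intro: STAR_square)

lemma INF_not_CIRC: "\<not> IC F_INF \<subseteq> IC (F_CIRC :: nat family)"
  by (rule INF_not) (blast intro: CIRC_swap)

text \<open>A 5 has to be accompanied by a 6, which stands behind it: suffixes with a 5 keep the 6,
  whereas the prefix \<open>5^i\<close> loses it.\<close>

lemma SUF_not_PRE: "\<not> IC F_SUF \<subseteq> IC (F_PRE :: nat family)"
proof -
  define S where "S = {w \<in> lists {5,6,7}. sorted w \<and> count_list w 6 \<le> 1 \<and> ((5::nat) \<in> set w \<longrightarrow> 6 \<in> set w)}"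
  have S_eq: "S = star {[5]} @@ {[6]} @@ star {[7]} \<union> star {[7]}"
  proof (intro equalityI subsetI)
    fix w assume w: "w \<in> S"
    then obtain i j k where ijk: "w = replicate i 5 @ replicate j 6 @ replicate k 7"
      using sorted_decomposition[of w] by (auto simp: S_def lists_eq_set)
    with w have "j = 1 \<or> j = 0 \<and> i = 0" by (auto simp: S_def count_list_replicate in_set_replicate)
    then show "w \<in> star {[5]} @@ {[6]} @@ star {[7]} \<union> star {[7]}"
    proof
      assume "j = 1"
      then have "w \<in> star {[5]} @@ {[6]} @@ star {[7]}" unfolding star_letter ijk by (intro concI) auto
      then show ?thesis by blast
    qed (auto simp: star_letter ijk)
  qed (auto simp: S_def conc_def star_letter sorted_append count_list_replicate in_set_replicate)
  have "S \<in> F_REG {5,6,7}" unfolding S_eq by (intro REG_union REG_conc REG_star_letter REG_letter) auto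
  then have S: "S \<in> F_SUF {5,6,7}" unfolding F_SUF_def
  proof (intro CollectI conjI ballI impI)
    fix x y assume xy: "x @ y \<in> S" and y: "y \<in> lists {5,6,7}"
    have "6 \<in> set y" if "5 \<in> set y"
    proof -
      have "\<forall>a\<in>set x. a \<le> 5" using xy that by (auto simp: S_def sorted_append)
      then have "6 \<notin> set x" by auto
      then show ?thesis using xy that by (auto simp: S_def)
    qed
    then show "y \<in> S" using xy y by (auto simp: S_def sorted_append)
  qed
  have "\<not> covered F_PRE {5,6,7} S"
  proof (rule not_covered_core[where a = 5 and b = 7 and c = "[6]"])
    show "replicate m 5 @ [6] @ replicate m 7 \<in> S" for m
      by (auto simp: S_def sorted_append count_list_replicate)
    fix T :: "nat lang" and U and i j k l :: nat
    assume T: "T \<in> F_PRE U" "replicate (Suc i) 5 @ [6] @ replicate (Suc j) 7 \<in> T"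
    from PRE_D[OF this] show "\<exists>y\<in>T \<inter> lists {5,6,7}. replicate k 5 @ y @ replicate l 7 \<notin> S"
      by (intro bexI[of _ "replicate (Suc i) 5"]) (auto simp: S_def in_set_replicate)
  qed
  then show ?thesis using S MON_SUF
    by (intro not_IC_subset[of "{5,6,7}" "{5,6,7}" S]) (auto simp: alphabet_def S_def)
qed

text \<open>The mirror image of \<open>SUF_not_PRE\<close>: here a 7 needs the 6 before it.\<close>

lemma PRE_not_SUF: "\<not> IC F_PRE \<subseteq> IC (F_SUF :: nat family)"
proof -
  define S where "S = {w \<in> lists {5,6,7}. sorted w \<and> count_list w 6 \<le> 1 \<and> ((7::nat) \<in> set w \<longrightarrow> 6 \<in> set w)}"
  have S_eq: "S = star {[5]} @@ {[6]} @@ star {[7]} \<union> star {[5]}"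
  proof (intro equalityI subsetI)
    fix w assume w: "w \<in> S"
    then obtain i j k where ijk: "w = replicate i 5 @ replicate j 6 @ replicate k 7"
      using sorted_decomposition[of w] by (auto simp: S_def lists_eq_set)
    with w have "j = 1 \<or> j = 0 \<and> k = 0" by (auto simp: S_def count_list_replicate in_set_replicate)
    then show "w \<in> star {[5]} @@ {[6]} @@ star {[7]} \<union> star {[5]}"
    proof
      assume "j = 1"
      then have "w \<in> star {[5]} @@ {[6]} @@ star {[7]}" unfolding star_letter ijk by (intro concI) auto
      then show ?thesis by blast
    qed (auto simp: star_letter ijk)
  qed (auto simp: S_def conc_def star_letter sorted_append count_list_replicate in_set_replicate)
  have "S \<in> F_REG {5,6,7}" unfolding S_eq by (intro REG_union REG_conc REG_star_letter REG_letter) auto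
  then have S: "S \<in> F_PRE {5,6,7}" unfolding F_PRE_def
  proof (intro CollectI conjI ballI impI)
    fix x y assume xy: "x @ y \<in> S" and x: "x \<in> lists {5,6,7}"
    have "6 \<in> set x" if "7 \<in> set x"
    proof -
      have "\<forall>a\<in>set y. 7 \<le> a" using xy that by (auto simp: S_def sorted_append)
      then have "6 \<notin> set y" by auto
      then show ?thesis using xy that by (auto simp: S_def)
    qed
    then show "x \<in> S" using xy x by (auto simp: S_def sorted_append)
  qed
  have "\<not> covered F_SUF {5,6,7} S"
  proof (rule not_covered_core[where a = 5 and b = 7 and c = "[6]"])
    show "replicate m 5 @ [6] @ replicate m 7 \<in> S" for m
      by (auto simp: S_def sorted_append count_list_replicate)
    fix T :: "nat lang" and U and i j k l :: nat
    assume T: "T \<in> F_SUF U" "replicate (Suc i) 5 @ [6] @ replicate (Suc j) 7 \<in> T"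
    then have "(replicate (Suc i) 5 @ [6]) @ replicate (Suc j) 7 \<in> T" by simp
    from SUF_D[OF T(1) this] show "\<exists>y\<in>T \<inter> lists {5,6,7}. replicate k 5 @ y @ replicate l 7 \<notin> S"
      by (intro bexI[of _ "replicate (Suc j) 7"]) (auto simp: S_def in_set_replicate)
  qed
  then show ?thesis using S MON_PRE
    by (intro not_IC_subset[of "{5,6,7}" "{5,6,7}" S]) (auto simp: alphabet_def S_def)
qed

section \<open>Star, commutative and circular selection\<close>

lemma PS_pump_letter:
  assumes "T \<in> F_PS U"
  shows "\<exists>k\<ge>1. \<forall>a n. k \<le> n \<longrightarrow> replicate n a \<in> T \<longrightarrow> replicate (Suc n) a \<in> T"
proof -
  from assms obtain k where k: "T \<in> F_REG U" "k \<ge> 1" "\<And>x. x \<in> lists U \<Longrightarrow>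
    {wpow x n |n. n \<ge> k} \<inter> T = {} \<or> {wpow x n |n. n \<ge> k} \<subseteq> T" unfolding F_PS_def by blast
  have "replicate (Suc n) a \<in> T" if *: "k \<le> n" "replicate n a \<in> T" for a n
  proof -
    have "replicate n a \<in> lists U" using REG_lists[OF k(1)] * by blast
    then have "[a] \<in> lists U" using k(2) *(1) by (auto simp: in_set_replicate)
    from k(3)[OF this] have "{replicate n a |n. n \<ge> k} \<inter> T = {} \<or> {replicate n a |n. n \<ge> k} \<subseteq> T"
      by (simp add: wpow_letter)
    moreover have "replicate n a \<in> {replicate n a |n. n \<ge> k}" using *(1) by blast
    moreover have "replicate (Suc n) a \<in> {replicate n a |n. n \<ge> k}" using *(1) le_SucI by blast
    ultimately show ?thesis using *(2) by blast
  qed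
  with k(2) show ?thesis by blast
qed

text \<open>A power-separating \<open>T\<close> contains all high powers of 5 or none, which
  destroys parity. Over one letter the language is both a star and commutative, so it serves two
  separations.\<close>

lemma not_covered_PS: "\<not> covered F_PS {5} (star {[5,5]})"
proof (rule not_coveredI[where P = "\<lambda>T k. \<forall>a n. k \<le> n \<longrightarrow> replicate n a \<in> T \<longrightarrow> replicate (Suc n) a \<in> T"])
  fix T :: "nat lang" and U assume "T \<in> F_PS U"
  from PS_pump_letter[OF this]
  show "\<exists>k. \<forall>a n. k \<le> n \<longrightarrow> replicate n a \<in> T \<longrightarrow> replicate (Suc n) a \<in> T" by blast
next
  fix K :: nat
  let ?x = "replicate (2 * (3 * K)) (5::nat)"
  show "\<exists>x\<in>star {[5,5::nat]}. K \<le> length x \<and> (\<forall>T U p y q. alphabet U \<longrightarrow> T \<in> F_PS U \<longrightarrow>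
     (\<forall>a n. K \<le> n \<longrightarrow> replicate n a \<in> T \<longrightarrow> replicate (Suc n) a \<in> T) \<longrightarrow> x = p @ y @ q \<longrightarrow>
     length p \<le> K \<longrightarrow> length q \<le> K \<longrightarrow> y \<in> T \<longrightarrow> (\<exists>y'\<in>T \<inter> lists {5}. p @ y' @ q \<notin> star {[5,5]}))"
  proof (rule bexI[of _ ?x], intro conjI allI impI)
    fix T :: "nat lang" and U and p y q :: "nat word"
    assume T: "\<forall>a n. K \<le> n \<longrightarrow> replicate n a \<in> T \<longrightarrow> replicate (Suc n) a \<in> T" "y \<in> T"
      and *: "?x = p @ y @ q" "length p \<le> K" "length q \<le> K"
    have len: "length p + length y + length q = 6 * K" using arg_cong[OF *(1), of length] by simp
    have "set y \<subseteq> set ?x" unfolding *(1) by auto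
    then have "set y \<subseteq> {5}" by (auto split: if_splits)
    then have y: "y = replicate (length y) 5" by (intro replicate_eqI) auto
    have "K \<le> length y" using len *(2,3) by linarith
    then have "replicate (Suc (length y)) 5 \<in> T" using T y by metis
    moreover have "p @ replicate (Suc (length y)) 5 @ q \<notin> star {[5,5]}"
    proof
      assume "p @ replicate (Suc (length y)) 5 @ q \<in> star {[5,5]}"
      then obtain n where "p @ replicate (Suc (length y)) 5 @ q = replicate (2 * n) 5" by (auto simp: star_55)
      from arg_cong[OF this, of length] have "Suc (6 * K) = 2 * n" using len by simp
      then show False by presburger
    qed
    ultimately show "\<exists>y'\<in>T \<inter> lists {5}. p @ y' @ q \<notin> star {[5,5]}"
      by (intro bexI[of _ "replicate (Suc (length y)) 5"]) auto
  qed (auto simp: star_55)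
qed auto

lemma STAR_not_PS: "\<not> IC F_STAR \<subseteq> IC (F_PS :: nat family)"
proof (rule not_IC_subset[of "{5}" "{5}" "star {[5,5]}"])
  have "{[5,5]} \<in> F_REG {5::nat}" by (rule REG_word) simp
  then show "star {[5,5]} \<in> F_STAR {5::nat}" unfolding F_STAR_def using REG_star by blast
  show "F_MON V \<subseteq> F_STAR V" if "alphabet V" for V :: "nat set"
    using MON_STAR[of V] that by (simp add: alphabet_def)
  show "star {[5,5]} \<subseteq> lists {5::nat}" by (rule star_mono_lists) simp
qed (simp_all add: alphabet_def not_covered_PS)

lemma COMM_not_PS: "\<not> IC F_COMM \<subseteq> IC (F_PS :: nat family)"
proof (rule not_IC_subset[of "{5}" "{5}" "star {[5,5]}"])
  have "{[5,5]} \<in> F_REG {5::nat}" by (rule REG_word) simp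
  then have "star {[5,5]} \<in> F_REG {5::nat}" by (rule REG_star)
  moreover have "w' \<in> star {[5,5]}" if "w \<in> star {[5,5::nat]}" "mset w' = mset w" for w w'
  proof -
    from that(1) obtain n where n: "w = replicate (2 * n) 5" by (auto simp: star_55)
    with that(2) have "set w' \<subseteq> {5}" "length w' = 2 * n"
      using mset_eq_setD[OF that(2)] mset_eq_length[OF that(2)] by (auto split: if_splits)
    then have "w' = replicate (2 * n) 5" by (intro replicate_eqI) auto
    then show ?thesis by (auto simp: star_55)
  qed
  ultimately show "star {[5,5]} \<in> F_COMM {5::nat}" unfolding F_COMM_def by blast
  show "star {[5,5]} \<subseteq> lists {5::nat}" by (rule star_mono_lists) simp
qed (simp_all add: alphabet_def not_covered_PS MON_COMM)

text \<open>Rotation by one letter moves the second letter of \<open>y\<close> to a position of the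
  other parity, where an alternating word has a different letter.\<close>

lemma STAR_not_CIRC: "\<not> IC F_STAR \<subseteq> IC (F_CIRC :: nat family)"
proof -
  let ?S = "star {[5,6::nat]}"
  have H: "{[5,6]} \<in> F_REG {5,6::nat}" by (rule REG_word) simp
  then have S: "?S \<in> F_STAR {5,6}" unfolding F_STAR_def using REG_star by blast
  have alt: "w ! i = (if even i then 5 else 6)" if "w \<in> ?S" "i < length w" for w i
    using that
  proof (induction arbitrary: i rule: star_induct)
    case (step x y)
    show ?case
    proof (cases i)
      case (Suc j)
      then show ?thesis using step by (cases j) auto
    qed (use step in simp)
  qed simp
  have "\<not> covered F_CIRC {5,6} ?S"
  proof (rule not_coveredI[where P = "\<lambda>_ _. True"])
    fix K :: nat
    let ?x = "wpow [5,6::nat] (Suc (Suc K))"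
    have len: "length (wpow [5,6::nat] n) = 2 * n" for n by (induction n) (auto simp: wpow_0 wpow_Suc)
    show "\<exists>x\<in>?S. K \<le> length x \<and> (\<forall>T U p y q. alphabet U \<longrightarrow> T \<in> F_CIRC U \<longrightarrow> True \<longrightarrow> x = p @ y @ q \<longrightarrow>
       length p \<le> K \<longrightarrow> length q \<le> K \<longrightarrow> y \<in> T \<longrightarrow> (\<exists>y'\<in>T \<inter> lists {5,6}. p @ y' @ q \<notin> ?S))"
    proof (rule bexI[of _ ?x], intro conjI allI impI)
      show xS: "?x \<in> ?S" unfolding star_singleton by blast
      fix T :: "nat lang" and U and p y q :: "nat word"
      assume *: "?x = p @ y @ q" "length p \<le> K" "length q \<le> K" and T: "T \<in> F_CIRC U" "y \<in> T"
      have "length p + length y + length q = 2 * Suc (Suc K)" using arg_cong[OF *(1), of length] len by simp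
      then obtain a b v where y: "y = a # b # v" using *(2,3) by (cases y; cases "tl y") auto
      have "(b # v) @ [a] \<in> T" using CIRC_swap[OF T(1), of "[a]" "b # v"] T(2) y by simp
      moreover have "set y \<subseteq> set ?x" unfolding *(1) by auto
      then have "set y \<subseteq> {5,6}" using wpow_lists[of "[5,6]" "{5,6::nat}"] by (auto simp: lists_eq_set)
      then have "(b # v) @ [a] \<in> lists {5,6}" using y by auto
      moreover have "p @ ((b # v) @ [a]) @ q \<notin> ?S"
      proof
        assume "p @ ((b # v) @ [a]) @ q \<in> ?S"
        from alt[OF this, of "length p"] have "b = (if even (length p) then 5 else 6)" by (simp add: nth_append)
        moreover have "(p @ y @ q) ! Suc (length p) = (if even (Suc (length p)) then 5 else 6)"
          by (rule alt) (use xS *(1) y in auto)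
        then have "b = (if even (Suc (length p)) then 5 else 6)" using y by (simp add: nth_append)
        ultimately show False by (simp split: if_splits)
      qed
      ultimately show "\<exists>y'\<in>T \<inter> lists {5,6}. p @ y' @ q \<notin> ?S" by blast
    qed (simp add: len)
  qed auto
  moreover have "F_MON V \<subseteq> F_STAR V" if "alphabet V" for V :: "nat set"
    using MON_STAR[of V] that by (simp add: alphabet_def)
  moreover have "?S \<subseteq> lists {5,6}" by (rule star_mono_lists) simp
  ultimately show ?thesis using S by (intro not_IC_subset[of "{5,6}" "{5,6}" ?S]) (auto simp: alphabet_def)
qed

lemma filter_letter: "filter (\<lambda>a. a \<noteq> c) w = [] \<longleftrightarrow> w \<in> star {[c]}"
proof
  assume "filter (\<lambda>a. a \<noteq> c) w = []"
  then have "w = replicate (length w) c" by (intro replicate_eqI) (auto simp: filter_empty_conv)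
  then show "w \<in> star {[c]}" unfolding star_letter by blast
qed (auto simp: star_letter)

lemma filter_letter_Cons:
  assumes "x \<noteq> c"
  shows "filter (\<lambda>a. a \<noteq> c) w = x # xs \<longleftrightarrow> w \<in> star {[c]} @@ {[x]} @@ {v. filter (\<lambda>a. a \<noteq> c) v = xs}"
proof
  assume "filter (\<lambda>a. a \<noteq> c) w = x # xs"
  then obtain u v where "w = u @ x # v" "\<forall>a\<in>set u. \<not> a \<noteq> c" "xs = filter (\<lambda>a. a \<noteq> c) v"
    unfolding filter_eq_Cons_iff by blast
  moreover from this(2) have "u \<in> star {[c]}" unfolding filter_letter[symmetric] by (simp add: filter_empty_conv)
  ultimately show "w \<in> star {[c]} @@ {[x]} @@ {v. filter (\<lambda>a. a \<noteq> c) v = xs}"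
    using concI[of u "star {[c]}" "[x] @ v"] concI[of "[x]" "{[x]}" v] by simp
qed (use assms in \<open>auto simp: conc_def star_letter\<close>)

text \<open>Since \<open>c\<close> may occur anywhere, the language is an alternating product of
  \<open>star {[c]}\<close> and the letters of \<open>xs\<close>.\<close>

lemma REG_filter_letter:
  assumes "c \<in> V" "set xs \<subseteq> V" "c \<notin> set xs"
  shows "{w. filter (\<lambda>a. a \<noteq> c) w = xs} \<in> F_REG V"
  using assms(2,3)
proof (induction xs)
  case Nil
  have "{w. filter (\<lambda>a. a \<noteq> c) w = []} = star {[c]}" unfolding filter_letter by simp
  then show ?case using REG_star_letter[OF assms(1)] by simp
next
  case (Cons x xs)
  then have "{w. filter (\<lambda>a. a \<noteq> c) w = x # xs} = star {[c]} @@ {[x]} @@ {v. filter (\<lambda>a. a \<noteq> c) v = xs}"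
    using filter_letter_Cons[of x c] by auto
  then show ?case using Cons REG_star_letter[OF assms(1)] by (simp add: REG_conc REG_letter)
qed

text \<open>Permutations preserve a single 6 among letters 5; squares double it.\<close>

lemma COMM_not_STAR: "\<not> IC F_COMM \<subseteq> IC (F_STAR :: nat family)"
proof -
  define S where "S = {w. filter (\<lambda>a. a \<noteq> 5) w = [6::nat]}"
  have "S \<in> F_REG {5,6}" unfolding S_def by (rule REG_filter_letter) auto
  moreover have "w' \<in> S" if "w \<in> S" "mset w' = mset w" for w w'
  proof -
    have "mset (filter (\<lambda>a. a \<noteq> 5) w') = mset (filter (\<lambda>a. a \<noteq> 5) w)" using that(2) by simp
    also have "\<dots> = {#6#}" using that(1) by (simp add: S_def del: mset_filter)
    finally show ?thesis unfolding S_def mset_single_iff by simp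
  qed
  ultimately have S: "S \<in> F_COMM {5,6}" unfolding F_COMM_def by blast
  have "\<not> covered F_STAR {5,6} S"
  proof (rule not_covered_core[where a = 5 and b = 5 and c = "[6]"])
    show "replicate m 5 @ [6] @ replicate m 5 \<in> S" for m by (simp add: S_def)
    fix T :: "nat lang" and U and i j k l :: nat
    assume T: "T \<in> F_STAR U" "replicate (Suc i) 5 @ [6] @ replicate (Suc j) 5 \<in> T"
    from STAR_square[OF this] show "\<exists>y\<in>T \<inter> lists {5,6}. replicate k 5 @ y @ replicate l 5 \<notin> S"
      by (intro bexI[rotated, OF IntI]) (assumption, auto simp: S_def)
  qed
  moreover have "S \<subseteq> lists {5,6}" by (rule REG_lists) (use S in \<open>simp add: F_COMM_def\<close>)
  ultimately show ?thesis using S MON_COMM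
    by (intro not_IC_subset[of "{5,6}" "{5,6}" S]) (auto simp: alphabet_def)
qed

text \<open>The letters other than 5 spell a rotation of 678. Rotations preserve this, and an
  exchange of 7 and 8 destroys it.\<close>

lemma CIRC_not_COMM: "\<not> IC F_CIRC \<subseteq> IC (F_COMM :: nat family)"
proof -
  let ?f = "filter (\<lambda>a. a \<noteq> (5::nat))"
  define S where "S = {w. ?f w = [6,7,8]} \<union> {w. ?f w = [7,8,6]} \<union> {w. ?f w = [8,6,7]}"
  have REG: "S \<in> F_REG {5,6,7,8}" unfolding S_def by (intro REG_union REG_filter_letter) auto
  have rot1: "rotate1 w \<in> S" if "w \<in> S" for w
    using that by (cases w) (auto simp: S_def split: if_splits)
  have "rotate n w \<in> S" if "w \<in> S" for n w
    using that by (induction n) (auto intro: rot1)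
  with REG have S: "S \<in> F_CIRC {5,6,7,8}" unfolding F_CIRC_def by blast
  have "\<not> covered F_COMM {5,6,7,8} S"
  proof (rule not_covered_core[where a = 5 and b = 5 and c = "[6,7,8]"])
    show "replicate m 5 @ [6,7,8] @ replicate m 5 \<in> S" for m by (simp add: S_def)
    fix T :: "nat lang" and U and i j k l :: nat
    let ?y = "replicate (Suc i) 5 @ [6,8,7] @ replicate (Suc j) (5::nat)"
    assume T: "T \<in> F_COMM U" "replicate (Suc i) 5 @ [6,7,8] @ replicate (Suc j) 5 \<in> T"
    then have "?y \<in> T" unfolding F_COMM_def by (auto simp del: replicate_Suc)
    then show "\<exists>y\<in>T \<inter> lists {5,6,7,8}. replicate k 5 @ y @ replicate l 5 \<notin> S"
      by (intro bexI[of _ ?y]) (auto simp: S_def)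
  qed
  then show ?thesis using S MON_CIRC REG_lists[OF REG]
    by (intro not_IC_subset[of "{5,6,7,8}" "{5,6,7,8}" S]) (auto simp: alphabet_def)
qed

subsection \<open>Non-counting but not ordered\<close>

text \<open>In the states \<open>P = 0\<close> and \<open>Q = 1\<close> the letters 5 and 6, respectively, must be read; the following
  letter 7 leaves the state unchanged and 8 exchanges \<open>P\<close> and \<open>Q\<close>. State 4 is a sink.\<close>

definition toggle :: "nat \<Rightarrow> nat \<Rightarrow> nat" where
  "toggle s a = (if s = 0 \<and> a = 5 then 2 else if s = 1 \<and> a = 6 then 3
     else if s = 2 \<and> a = 7 \<or> s = 3 \<and> a = 8 then 0 else if s = 3 \<and> a = 7 \<or> s = 2 \<and> a = 8 then 1 else 4)"

abbreviation run :: "nat \<Rightarrow> nat word \<Rightarrow> nat" where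
  "run \<equiv> foldl toggle"

definition toggle_lang :: "nat lang" where
  "toggle_lang = {w. run 0 w = 0}"

lemma toggle_simps [simp]:
  "toggle 0 a = (if a = 5 then 2 else 4)" "toggle (Suc 0) a = (if a = 6 then 3 else 4)"
  "toggle 2 a = (if a = 7 then 0 else if a = 8 then 1 else 4)"
  "toggle 3 a = (if a = 7 then 1 else if a = 8 then 0 else 4)" "toggle 4 a = 4"
  by (auto simp: toggle_def)

lemma run_dead [simp]: "run 4 w = 4"
  by (induction w) (auto simp: toggle_def)

lemma run_letters: "run s w \<noteq> 4 \<Longrightarrow> set w \<subseteq> {5,6,7,8}"
proof (induction w arbitrary: s)
  case (Cons a w)
  have "a \<in> {5,6,7,8}"
  proof (rule ccontr)
    assume "a \<notin> {5,6,7,8}"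
    then have "toggle s a = 4" by (simp add: toggle_def)
    then show False using Cons.prems run_dead by simp
  qed
  then show ?case using Cons by simp
qed simp

lemma toggle_lang_letters: "w \<in> toggle_lang \<Longrightarrow> set w \<subseteq> {5,6,7,8}"
  by (intro run_letters[of 0]) (simp add: toggle_lang_def)

lemma toggle_lang_lists: "toggle_lang \<subseteq> lists {5,6,7,8}"
  using toggle_lang_letters by (auto simp: lists_eq_set)

lemma toggle_lang_append: "u \<in> toggle_lang \<Longrightarrow> v \<in> toggle_lang \<Longrightarrow> u @ v \<in> toggle_lang"
  by (simp add: toggle_lang_def)

text \<open>State elimination: \<open>Y\<close> holds the words that lead from state 1 to state 0
  for the first time, \<open>X\<close> those that return to state 0 for the first time.\<close>

lemma toggle_lang_regular: "toggle_lang \<in> F_REG {5,6,7,8}"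
proof -
  define Y where "Y = star {[6,7]} @@ {[6,8::nat]}"
  define X where "X = {[5,7]} \<union> {[5,8]} @@ Y"
  have 1: "(run 0 w = 0 \<longrightarrow> w \<in> star X) \<and> (run 1 w = 0 \<longrightarrow> w \<in> Y @@ star X)" for w
  proof (induction w rule: length_induct)
    case (1 w)
    show ?case
    proof (cases w)
      case Nil then show ?thesis by (simp add: Nil_in_star)
    next
      case (Cons a w1)
      show ?thesis
      proof (cases w1)
        case Nil then show ?thesis using Cons by simp
      next
        case c2: (Cons b v)
        then have IH: "run 0 v = 0 \<Longrightarrow> v \<in> star X" "run 1 v = 0 \<Longrightarrow> v \<in> Y @@ star X" using 1 Cons by simp_all
        have d: "toggle 4 b = 4" by simp
        show ?thesis
        proof (intro conjI impI)
          assume w: "run 0 w = 0"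
          have "a = 5" using w Cons c2 d by (auto split: if_splits)
          with w Cons c2 have "b = 7 \<and> run 0 v = 0 \<or> b = 8 \<and> run 1 v = 0"
            by (auto split: if_splits)
          then show "w \<in> star X"
          proof
            assume "b = 7 \<and> run 0 v = 0"
            then show ?thesis using IH star_step[of "[5,7]" X v] \<open>a = 5\<close> Cons c2 by (simp add: X_def)
          next
            assume b: "b = 8 \<and> run 1 v = 0"
            with IH obtain y z where yz: "v = y @ z" "y \<in> Y" "z \<in> star X" by (auto simp: conc_def)
            then have "[5,8] @ y \<in> X" unfolding X_def by (intro UnI2 concI) auto
            from star_step[OF this yz(3)] show ?thesis using b yz(1) \<open>a = 5\<close> Cons c2 by simp
          qed
        next
          assume w: "run 1 w = 0"
          have "a = 6" using w Cons c2 d by (auto split: if_splits)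
          with w Cons c2 have "b = 7 \<and> run 1 v = 0 \<or> b = 8 \<and> run 0 v = 0"
            by (auto split: if_splits)
          then show "w \<in> Y @@ star X"
          proof
            assume b: "b = 7 \<and> run 1 v = 0"
            with IH obtain y m z where yz: "v = (m @ y) @ z" "m \<in> star {[6,7]}" "y \<in> {[6,8]}" "z \<in> star X"
              by (auto simp: conc_def Y_def)
            have "([6,7] @ m) @ y \<in> Y" unfolding Y_def by (intro concI star_step yz) simp
            from concI[OF this yz(4)] show ?thesis using b yz(1) \<open>a = 6\<close> Cons c2 by simp
          next
            assume b: "b = 8 \<and> run 0 v = 0"
            have "[] @ [6,8] \<in> Y" unfolding Y_def by (intro concI Nil_in_star) simp
            from concI[OF this IH(1)] show ?thesis using b \<open>a = 6\<close> Cons c2 by simp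
          qed
        qed
      qed
    qed
  qed
  have Y: "run 1 w = 0" if "w \<in> Y" for w
  proof -
    have "run 1 m = 1" if "m \<in> star {[6,7]}" for m
      using that by (induction rule: star_induct) auto
    then show ?thesis using that by (auto simp: Y_def conc_def)
  qed
  have X: "run 0 w = 0" if "w \<in> X" for w
    using that Y by (auto simp: X_def conc_def)
  have "run 0 w = 0" if "w \<in> star X" for w
    using that by (induction rule: star_induct) (auto simp: X)
  with 1 have "toggle_lang = star X" by (auto simp: toggle_lang_def)
  also have "\<dots> \<in> F_REG {5,6,7,8}" unfolding X_def Y_def
    by (intro REG_star REG_union REG_conc REG_word) auto
  finally show ?thesis .
qed

text \<open>Two letters that are survived reveal the state in which they were read. Hence a
  \<open>y\<close> of length at least 2 that is survived twice in a row returns to its starting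
  state, which gives non-counting with \<open>k = 2\<close>.\<close>

lemma run_source_unique:
  assumes "2 \<le> length y" "run s y \<noteq> 4" "run t y \<noteq> 4" shows "s = t"
proof -
  from assms(1) obtain a b v where y: "y = a # b # v" by (cases y; cases "tl y") auto
  have "toggle (toggle s a) b \<noteq> 4" "toggle (toggle t a) b \<noteq> 4" using assms(2,3) y run_dead by force+
  moreover have "r = (if a = 5 then 0 else if a = 6 then 1
      else if a = 7 then (if b = 5 then 2 else 3) else (if b = 6 then 2 else 3))"
    if "toggle (toggle r a) b \<noteq> 4" for r
  proof -
    have "toggle r a = 4" if "r \<notin> {0,1,2,3}" using that by (simp add: toggle_def)
    then have "r \<in> {0,1,2,3}" using that by force
    then consider "r = 0" | "r = 1" | "r = 2" | "r = 3" by blast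
    then show ?thesis using that by cases (simp_all split: if_splits)
  qed
  ultimately show ?thesis by metis
qed

lemma toggle_lang_NC: "toggle_lang \<in> F_NC {5,6,7,8}"
proof -
  have run3: "run s (y @ y) = run s (y @ y @ y)" for s y
  proof (cases "2 \<le> length y")
    case True
    show ?thesis
    proof (cases "run (run s y) y = 4")
      case False
      then have "run s y \<noteq> 4" using run_dead by metis
      then have "run s y = s" using run_source_unique[OF True False] by blast
      then show ?thesis by simp
    qed (simp add: run_dead)
  next
    case False
    then consider "y = []" | a where "y = [a]" by (cases y; cases "tl y") auto
    then show ?thesis
    proof cases
      case 2
      \<comment> \<open>Letters from {5,6} alternate with letters from {7,8}, so no letter is
        survived twice in a row.\<close>
      have "toggle (toggle s a) a = 4" for s by (auto simp: toggle_def)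
      then show ?thesis using 2 by simp
    qed simp
  qed
  have "x @ wpow y 2 @ z \<in> toggle_lang \<longleftrightarrow> x @ wpow y (2 + 1) @ z \<in> toggle_lang" for x y z
  proof -
    have w: "wpow y 2 = y @ y" "wpow y (2 + 1) = y @ y @ y" by (simp_all add: wpow_def numeral_eq_Suc)
    have "run 0 (x @ wpow y 2 @ z) = run (run (run 0 x) (y @ y)) z" unfolding w by simp
    also have "\<dots> = run 0 (x @ wpow y (2 + 1) @ z)" unfolding run3 w by simp
    finally show ?thesis by (simp add: toggle_lang_def)
  qed
  then show ?thesis unfolding F_NC_def using toggle_lang_regular by (intro CollectI conjI exI[of _ 2]) auto
qed

lemma finite_image_extremes:
  fixes g :: "'b \<Rightarrow> 'c :: linorder"
  assumes "finite (g ` X)" "X \<noteq> {}"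
  shows "\<exists>a\<in>X. \<exists>b\<in>X. \<forall>v\<in>X. g a \<le> g v \<and> g v \<le> g b"
proof -
  have "Min (g ` X) \<in> g ` X" "Max (g ` X) \<in> g ` X" using assms by (auto intro: Min_in Max_in)
  then obtain a b where ab: "a \<in> X" "Min (g ` X) = g a" "b \<in> X" "Max (g ` X) = g b"
    unfolding image_iff by blast
  have "g a \<le> g v \<and> g v \<le> g b" if "v \<in> X" for v
    using Min_le[OF assms(1), of "g v"] Max_ge[OF assms(1), of "g v"] that by (simp add: ab)
  then show ?thesis using ab by blast
qed

text \<open>The values reached in the states \<open>P\<close> and \<open>Q\<close> inside a minimal strongly connected part overlap
  in the order: otherwise the letter 7 would order the two groups in one way and 8 in the other. A
  word that resets the group of \<open>P\<close> then also resets a member of the group of \<open>Q\<close>, or vice versa.\<close>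

lemma ordered_dfa_toggle:
  assumes dfa: "ordered_dfa U Z z0 F \<delta> f" and AU: "{5,6,7,8} \<subseteq> U" and u: "set u \<subseteq> U"
    and live: "\<And>v. run 0 v = 0 \<Longrightarrow> G (foldl \<delta> z0 (u @ v))"
    and G: "\<And>z w. set w \<subseteq> {5,6,7,8} \<Longrightarrow> G (foldl \<delta> z w) \<Longrightarrow> G z"
    and dead: "\<And>v. set v \<subseteq> {5,6,7,8} \<Longrightarrow> run 0 v = 4 \<Longrightarrow> \<not> G (foldl \<delta> z0 (u @ v))"
  shows False
proof -
  have d: "is_dfa U Z z0 F \<delta>" and inj: "inj_on f Z" using dfa by (auto simp: ordered_dfa_def)
  then have "z0 \<in> Z" "finite Z" by (auto simp: is_dfa_def)
  define D where "D v = foldl \<delta> z0 (u @ v)" for v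
  have DZ: "D v \<in> Z" if "set v \<subseteq> {5,6,7,8}" for v
    unfolding D_def using that u AU by (intro dfa_foldl[OF d \<open>z0 \<in> Z\<close>]) auto
  have D_app: "D (v @ w) = foldl \<delta> (D v) w" for v w by (simp add: D_def)
  have live_Q: "G (D v)" if "run 0 v = 1" for v
  proof -
    have "run 0 (v @ [6,8]) = 0" using that by simp
    from live[OF this] show ?thesis using G[of "[6,8]" "D v"] by (simp add: D_def)
  qed
  define C where "C v0 = {D (v0 @ v) |v. run 0 v = 0}" for v0
  have C_sub: "C (v0 @ v1) \<subseteq> C v0" if "run 0 v1 = 0" for v0 v1
  proof
    fix z assume "z \<in> C (v0 @ v1)"
    then obtain v where "z = D (v0 @ (v1 @ v))" "run 0 v = 0" by (auto simp: C_def)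
    moreover from this(2) that have "run 0 (v1 @ v) = 0" by simp
    ultimately show "z \<in> C v0" unfolding C_def by blast
  qed
  have lets: "set v \<subseteq> {5,6,7,8}" if "run 0 v \<in> {0,1}" for v using that by (intro run_letters[of 0]) auto
  have C_fin: "finite (C v0)" if "run 0 v0 = 0" for v0
  proof (rule finite_subset[OF _ \<open>finite Z\<close>])
    show "C v0 \<subseteq> Z" unfolding C_def using DZ lets that by fastforce
  qed
  \<comment> \<open>By minimality further reading does not shrink the set of states reached by
    returns to state 0, so \<open>D v0\<close> stays reachable: this is the strongly connected
    part.\<close>
  obtain v0 where v0: "run 0 v0 = 0" "\<And>v. run 0 v = 0 \<Longrightarrow> card (C v0) \<le> card (C v)"
    using ex_has_least_nat[of "\<lambda>v. run 0 v = 0" "[]" "\<lambda>v. card (C v)"] by auto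
  have return: "\<exists>v. run 0 v = 0 \<and> D (v0 @ v1 @ v) = D v0" if "run 0 v1 = 0" for v1
  proof -
    have "C (v0 @ v1) = C v0"
      using C_sub[OF that] C_fin[OF v0(1)] v0(2)[of "v0 @ v1"] v0(1) that by (intro card_seteq) auto
    moreover have "D v0 \<in> C v0" unfolding C_def by (auto intro!: exI[of _ "[]"])
    ultimately have "D v0 \<in> C (v0 @ v1)" by simp
    then obtain v where "D v0 = D ((v0 @ v1) @ v)" "run 0 v = 0" unfolding C_def by blast
    then show ?thesis by (intro exI[of _ v]) simp
  qed
  define P where "P = {v. run 0 v = 0}"
  define Q where "Q = {v. run 0 v = 1}"
  let ?g = "\<lambda>v. f (D (v0 @ v))"
  have fin: "finite (?g ` X)" if "X \<subseteq> P \<union> Q" for X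
  proof -
    have "?g ` X \<subseteq> f ` Z"
    proof (intro image_subsetI imageI DZ)
      fix v assume "v \<in> X"
      then have "run 0 v \<in> {0,1}" using that by (auto simp: P_def Q_def)
      then show "set (v0 @ v) \<subseteq> {5,6,7,8}" using lets[of v] lets[of v0] v0(1) by auto
    qed
    then show ?thesis using \<open>finite Z\<close> finite_surj by blast
  qed
  have extremes: "\<exists>a\<in>X. \<exists>b\<in>X. \<forall>v\<in>X. ?g a \<le> ?g v \<and> ?g v \<le> ?g b" if "X \<subseteq> P \<union> Q" "X \<noteq> {}" for X
    using fin[OF that(1)] that(2) by (rule finite_image_extremes)
  have "[] \<in> P" "[5,8] \<in> Q" by (simp_all add: P_def Q_def)
  \<comment> \<open>\<open>a\<close> and \<open>b\<close> reach the lowest and the highest state of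
    the group of \<open>P\<close>, \<open>c\<close> and \<open>e\<close> those of the group of
    \<open>Q\<close>.\<close>
  with extremes[of P] extremes[of Q] obtain a b c e where
    ab: "a \<in> P" "b \<in> P" "\<And>v. v \<in> P \<Longrightarrow> ?g a \<le> ?g v \<and> ?g v \<le> ?g b" and
    ce: "c \<in> Q" "e \<in> Q" "\<And>v. v \<in> Q \<Longrightarrow> ?g c \<le> ?g v \<and> ?g v \<le> ?g e"
    by (metis Un_upper1 Un_upper2 empty_iff)
  have mono: "f (foldl \<delta> x w) \<le> f (foldl \<delta> y w)" if "f x \<le> f y" "x \<in> Z" "y \<in> Z" "set w \<subseteq> {5,6,7,8}" for x y w
    using that AU by (intro ordered_dfa_mono[OF dfa]) auto
  have letsP: "set (v0 @ v) \<subseteq> {5,6,7,8}" if "v \<in> P \<union> Q" for v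
    using lets[of v] lets[of v0] v0(1) that by (auto simp: P_def Q_def)
  have overlap: "?g a \<le> ?g e" "?g c \<le> ?g b"
  proof -
    \<comment> \<open>These belong to the toggle states 2 and 3. The letter 7 sends them to the
      groups of \<open>P\<close> and \<open>Q\<close>, the letter 8 to those of \<open>Q\<close> and
      \<open>P\<close>; so either order of the two yields both inequalities.\<close>
    let ?r = "D (v0 @ [5])" and ?s = "D (v0 @ [5,8,6])"
    have Z: "?r \<in> Z" "?s \<in> Z" using letsP[of "[]"] \<open>[] \<in> P\<close> by (auto intro!: DZ)
    have m: "[5,7] \<in> P" "[5,8,6,7] \<in> Q" "[5,8] \<in> Q" "[5,8,6,8] \<in> P" by (simp_all add: P_def Q_def)
    have st: "D (v0 @ [5,7]) = foldl \<delta> ?r [7]" "D (v0 @ [5,8]) = foldl \<delta> ?r [8]"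
      "D (v0 @ [5,8,6,7]) = foldl \<delta> ?s [7]" "D (v0 @ [5,8,6,8]) = foldl \<delta> ?s [8]" by (simp_all add: D_def)
    have "?g a \<le> ?g e \<and> ?g c \<le> ?g b"
    proof (cases "f ?r \<le> f ?s")
      case True
      from mono[OF True Z, of "[7]"] mono[OF True Z, of "[8]"]
      have "?g [5,7] \<le> ?g [5,8,6,7]" "?g [5,8] \<le> ?g [5,8,6,8]" unfolding st by simp_all
      then show ?thesis using ab(3) ce(3) m by (meson order_trans)
    next
      case False
      then have le: "f ?s \<le> f ?r" by simp
      from mono[OF le Z(2,1), of "[7]"] mono[OF le Z(2,1), of "[8]"]
      have "?g [5,8,6,7] \<le> ?g [5,7]" "?g [5,8,6,8] \<le> ?g [5,8]" unfolding st by simp_all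
      then show ?thesis using ab(3) ce(3) m by (meson order_trans)
    qed
    then show "?g a \<le> ?g e" "?g c \<le> ?g b" by simp_all
  qed
  show False
  proof (cases "?g a \<le> ?g c")
    case True
    have "run 0 (a @ [5,7]) = 0" using ab(1) by (simp add: P_def)
    from return[OF this] obtain v where v: "run 0 v = 0" "D (v0 @ (a @ [5,7]) @ v) = D v0" by blast
    \<comment> \<open>\<open>h\<close> maps the lowest state of \<open>P\<close> to the highest. The
      state of \<open>c\<close> lies between these two, so monotonicity gives it the same live
      image, although the initial 5 of \<open>h\<close> is fatal after \<open>c\<close>.\<close>
    define h where "h = [5,7] @ v @ b"
    have hb: "b @ h \<in> P" using ab(2) v(1) by (simp add: h_def P_def)
    have h: "set h \<subseteq> {5,6,7,8}" using lets[of v] lets[of b] v(1) ab(2) by (auto simp: h_def P_def)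
    have "D (v0 @ a @ h) = foldl \<delta> (D (v0 @ (a @ [5,7]) @ v)) b" by (simp add: h_def D_def)
    also have "\<dots> = D (v0 @ b)" unfolding v(2) by (simp add: D_def)
    finally have ah: "foldl \<delta> (D (v0 @ a)) h = D (v0 @ b)" by (simp add: D_def)
    have "f (foldl \<delta> (D (v0 @ a)) h) \<le> f (foldl \<delta> (D (v0 @ c)) h)"
      using True ab(1) ce(1) letsP h by (intro mono DZ) auto
    moreover have "f (foldl \<delta> (D (v0 @ c)) h) \<le> f (foldl \<delta> (D (v0 @ b)) h)"
      using overlap(2) ab(2) ce(1) letsP h by (intro mono DZ) auto
    moreover have "f (foldl \<delta> (D (v0 @ b)) h) \<le> ?g b" using ab(3)[OF hb] by (simp add: D_def)
    ultimately have "f (D (v0 @ c @ h)) = f (D (v0 @ b))" unfolding ah by (simp add: D_def)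
    moreover have "D (v0 @ c @ h) \<in> Z" "D (v0 @ b) \<in> Z" using letsP[of c] letsP[of b] ce(1) ab(2) h by (auto intro!: DZ)
    ultimately have eq: "D (v0 @ c @ h) = D (v0 @ b)" using inj by (auto dest: inj_onD)
    have "run 0 (v0 @ b) = 0" using v0(1) ab(2) by (simp add: P_def)
    from live[OF this] have "G (D (v0 @ c @ h))" unfolding eq by (simp add: D_def)
    moreover have "run 0 (v0 @ c @ h) = 4" using v0(1) ce(1) by (simp add: Q_def h_def)
    ultimately show False using dead[of "v0 @ c @ h"] letsP[of c] ce(1) h by (auto simp: D_def)
  next
    case False
    then have ca: "?g c \<le> ?g a" by simp
    have "run 0 (c @ [6,8]) = 0" using ce(1) by (simp add: Q_def)
    from return[OF this] obtain v where v: "run 0 v = 0" "D (v0 @ (c @ [6,8]) @ v) = D v0" by blast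
    \<comment> \<open>The same with the groups exchanged: the initial 6 of \<open>h\<close> is fatal
      after \<open>a\<close>.\<close>
    define h where "h = [6,8] @ v @ e"
    have he: "e @ h \<in> Q" using ce(2) v(1) by (simp add: h_def Q_def)
    have h: "set h \<subseteq> {5,6,7,8}" using lets[of v] lets[of e] v(1) ce(2) by (auto simp: h_def Q_def)
    have "D (v0 @ c @ h) = foldl \<delta> (D (v0 @ (c @ [6,8]) @ v)) e" by (simp add: h_def D_def)
    also have "\<dots> = D (v0 @ e)" unfolding v(2) by (simp add: D_def)
    finally have ch: "foldl \<delta> (D (v0 @ c)) h = D (v0 @ e)" by (simp add: D_def)
    have "f (foldl \<delta> (D (v0 @ c)) h) \<le> f (foldl \<delta> (D (v0 @ a)) h)"
      using ca ab(1) ce(1) letsP h by (intro mono DZ) auto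
    moreover have "f (foldl \<delta> (D (v0 @ a)) h) \<le> f (foldl \<delta> (D (v0 @ e)) h)"
      using overlap(1) ab(1) ce(2) letsP h by (intro mono DZ) auto
    moreover have "f (foldl \<delta> (D (v0 @ e)) h) \<le> ?g e" using ce(3)[OF he] by (simp add: D_def)
    ultimately have "f (D (v0 @ a @ h)) = f (D (v0 @ e))" unfolding ch by (simp add: D_def)
    moreover have "D (v0 @ a @ h) \<in> Z" "D (v0 @ e) \<in> Z" using letsP[of a] letsP[of e] ce(2) ab(1) h by (auto intro!: DZ)
    ultimately have eq: "D (v0 @ a @ h) = D (v0 @ e)" using inj by (auto dest: inj_onD)
    have "run 0 (v0 @ e) = 1" using v0(1) ce(2) by (simp add: Q_def)
    from live_Q[OF this] have "G (D (v0 @ a @ h))" unfolding eq .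
    moreover have "run 0 (v0 @ a @ h) = 4" using v0(1) ab(1) by (simp add: P_def h_def)
    ultimately show False using dead[of "v0 @ a @ h"] letsP[of a] ab(1) h by (auto simp: D_def)
  qed
qed

text \<open>Otherwise some continuation within \<open>S\<close> excludes the first \<open>M\<close>
  for good, a further one the second, and so on; in the end no member of the finite
  \<open>\<M>\<close> could cover.\<close>

lemma persistent_cover:
  assumes "finite \<M>" and S: "\<And>u v. u \<in> S \<Longrightarrow> v \<in> S \<Longrightarrow> u @ v \<in> S" "[] \<in> S"
    and cover: "\<And>u. u \<in> S \<Longrightarrow> \<exists>w\<in>S. \<exists>M\<in>\<M>. u @ w \<in> M"
  shows "\<exists>M\<in>\<M>. \<exists>u\<in>S. \<forall>v\<in>S. \<exists>w\<in>S. u @ v @ w \<in> M"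
proof (rule ccontr)
  assume "\<not> ?thesis"
  then have neg: "\<And>M u. M \<in> \<M> \<Longrightarrow> u \<in> S \<Longrightarrow> \<exists>v\<in>S. \<forall>w\<in>S. u @ v @ w \<notin> M" by simp
  have "\<exists>u\<in>S. \<forall>M\<in>\<N>. \<forall>w\<in>S. u @ w \<notin> M" if "finite \<N>" "\<N> \<subseteq> \<M>" for \<N>
    using that
  proof (induction rule: finite_induct)
    case (insert M \<N>)
    from insert have "M \<in> \<M>" "\<N> \<subseteq> \<M>" by simp_all
    from insert.IH[OF this(2)] obtain u where u: "u \<in> S" "\<forall>M\<in>\<N>. \<forall>w\<in>S. u @ w \<notin> M" ..
    from neg[OF \<open>M \<in> \<M>\<close> u(1)] obtain v where v: "v \<in> S" "\<forall>w\<in>S. u @ v @ w \<notin> M" ..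
    have "(u @ v) @ w \<notin> M'" if "M' \<in> insert M \<N>" "w \<in> S" for M' w
      using that(1) bspec[OF v(2) that(2)] u(2) S(1)[OF v(1) that(2)] by auto
    then show ?case using S(1)[OF u(1) v(1)] by (intro bexI[of _ "u @ v"]) simp_all
  qed (use S(2) in blast)
  from this[OF assms(1) subset_refl] obtain u where u: "u \<in> S" "\<forall>M\<in>\<M>. \<forall>w\<in>S. u @ w \<notin> M" ..
  from cover[OF u(1)] u(2) show False by blast
qed

text \<open>By \<open>persistent_cover\<close> one \<open>T\<close> remains responsible for all
  continuations of some \<open>u\<close>, so its ordered automaton has to tell live from dead runs
  of \<open>toggle\<close>.\<close>

lemma toggle_lang_not_covered: "\<not> covered F_ORD {5,6,7,8} toggle_lang"
proof
  let ?A = "{5,6,7,8::nat}" and ?S = toggle_lang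
  assume "covered F_ORD ?A ?S"
  then obtain Q N where "finite Q"
    and Q1: "\<forall>(T, p, q)\<in>Q. (\<exists>U. alphabet U \<and> T \<in> F_ORD U) \<and> (\<forall>y\<in>T \<inter> lists ?A. p @ y @ q \<in> ?S)"
    and Q2: "\<forall>x\<in>?S. N \<le> length x \<longrightarrow> (\<exists>(T, p, q)\<in>Q. \<exists>y\<in>T. x = p @ y @ q)"
    unfolding covered_def by blast
  define M :: "nat lang \<times> nat word \<times> nat word \<Rightarrow> nat lang"
    where "M = (\<lambda>(T, p, q). {p @ y @ q |y. y \<in> T})"
  have pad: "wpow [5,7] n \<in> ?S \<and> n \<le> length (wpow [5,7::nat] n)" for n
    by (induction n) (auto simp: wpow_0 wpow_Suc toggle_lang_def)
  have "\<exists>L\<in>M ` Q. \<exists>u\<in>?S. \<forall>v\<in>?S. \<exists>w\<in>?S. u @ v @ w \<in> L"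
  proof (rule persistent_cover)
    fix u assume u: "u \<in> ?S"
    have "u @ wpow [5,7] N \<in> ?S" using u pad toggle_lang_append by blast
    moreover have "N \<le> length (u @ wpow [5,7] N)" using pad[of N] by simp
    ultimately obtain T p q y where "(T, p, q) \<in> Q" "y \<in> T" "u @ wpow [5,7] N = p @ y @ q"
      using bspec[OF Q2, of "u @ wpow [5,7] N"] by blast
    then have "u @ wpow [5,7] N \<in> M (T, p, q)" by (auto simp: M_def)
    then show "\<exists>w\<in>?S. \<exists>L\<in>M ` Q. u @ w \<in> L" using pad \<open>(T, p, q) \<in> Q\<close> by blast
  qed (use \<open>finite Q\<close> toggle_lang_append in \<open>auto simp: toggle_lang_def\<close>)
  then obtain T p q u where TQ: "(T, p, q) \<in> Q" and u: "u \<in> ?S"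
    and alive: "\<And>v. v \<in> ?S \<Longrightarrow> \<exists>w\<in>?S. u @ v @ w \<in> M (T, p, q)" by fastforce
  from bspec[OF Q1 TQ] obtain U where U: "T \<in> F_ORD U" and TS: "\<And>y. y \<in> T \<Longrightarrow> y \<in> lists ?A \<Longrightarrow> p @ y @ q \<in> ?S"
    by auto
  \<comment> \<open>Padding with loops at state 0 keeps \<open>p\<close> inside
    \<open>u @ pd\<close> and \<open>q\<close> inside \<open>pd @ w\<close>, so that
    \<open>v\<close> is read entirely by the automaton of \<open>T\<close>.\<close>
  define pd where "pd = wpow [5,7::nat] (length p + length q)"
  define u1 where "u1 = drop (length p) (u @ pd)"
  have pd: "pd \<in> ?S" "length p + length q \<le> length pd" using pad by (auto simp: pd_def)
  have alive': "u @ pd = p @ u1 \<and> (\<exists>w. set w \<subseteq> ?A \<and> u1 @ v @ w \<in> T)" if "v \<in> ?S" for v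
  proof -
    have "pd @ v @ pd \<in> ?S" using that pd toggle_lang_append by blast
    from alive[OF this] obtain w y where w: "w \<in> ?S" "y \<in> T" "u @ (pd @ v @ pd) @ w = p @ y @ q" by (auto simp: M_def)
    have "take (length p) (u @ (pd @ v @ pd) @ w) = p" unfolding w(3) by simp
    then have "take (length p) (u @ pd) = p" using pd(2) by simp
    then have p: "u @ pd = p @ u1" unfolding u1_def by (metis append_take_drop_id)
    define w' where "w' = take (length (pd @ w) - length q) (pd @ w)"
    have eq: "u1 @ v @ (pd @ w) = y @ q"
    proof -
      have "p @ (u1 @ v @ (pd @ w)) = p @ (y @ q)" using w(3) p by (metis append_assoc)
      then show ?thesis by simp
    qed
    have "drop (length (u1 @ v @ (pd @ w)) - length q) (u1 @ v @ (pd @ w)) = q" unfolding eq by simp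
    then have "drop (length (pd @ w) - length q) (pd @ w) = q" using pd(2) by simp
    then have w': "pd @ w = w' @ q" unfolding w'_def by (metis append_take_drop_id)
    then have "(u1 @ v @ w') @ q = y @ q" using eq by simp
    then have "u1 @ v @ w' \<in> T" using w(2) by simp
    moreover have "set (pd @ w) \<subseteq> ?A" using toggle_lang_letters[OF pd(1)] toggle_lang_letters[OF w(1)] by simp
    then have "set w' \<subseteq> ?A" unfolding w' by simp
    ultimately show ?thesis using p by blast
  qed
  have "[] \<in> ?S" by (simp add: toggle_lang_def)
  from alive'[OF this] have p: "u @ pd = p @ u1" by blast
  have "set (u @ pd) \<subseteq> ?A" using toggle_lang_letters[OF pd(1)] toggle_lang_letters[OF u] by simp
  then have u1A: "set u1 \<subseteq> ?A" unfolding p by simp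
  have TU: "T \<subseteq> lists U" by (rule REG_lists) (use U in \<open>auto simp: F_ORD_def\<close>)
  \<comment> \<open>This word uses all four letters, so they belong to the alphabet of
    \<open>T\<close>.\<close>
  have "[5,8,6,7,6,8] \<in> ?S" by (simp add: toggle_lang_def)
  from alive'[OF this] TU have AU: "?A \<subseteq> U" by (auto dest!: subsetD)
  from ORD_ordered_dfa[OF U] obtain Z z0 F \<delta> f where dfa: "ordered_dfa U Z z0 F \<delta> f" and TD: "T = dfa_lang U z0 F \<delta>" .
  \<comment> \<open>A live word need not be accepted at once; being able to reach acceptance is what
    tells live words from dead ones.\<close>
  define G where "G z \<longleftrightarrow> (\<exists>w. set w \<subseteq> ?A \<and> foldl \<delta> z w \<in> F)" for z
  show False
  proof (rule ordered_dfa_toggle[OF dfa AU, of u1 G])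
    show "set u1 \<subseteq> U" using u1A AU by blast
    fix v assume "run 0 v = 0"
    then have "v \<in> ?S" by (simp add: toggle_lang_def)
    from alive'[OF this] show "G (foldl \<delta> z0 (u1 @ v))" by (auto simp: G_def TD dfa_lang_def)
  next
    fix z w assume "set w \<subseteq> ?A" "G (foldl \<delta> z w)"
    then obtain w' where "set (w @ w') \<subseteq> ?A" "foldl \<delta> z (w @ w') \<in> F" by (auto simp: G_def)
    then show "G z" unfolding G_def by blast
  next
    fix v assume v: "set v \<subseteq> ?A" "run 0 v = 4"
    show "\<not> G (foldl \<delta> z0 (u1 @ v))"
    proof
      assume "G (foldl \<delta> z0 (u1 @ v))"
      then obtain w where w: "set w \<subseteq> ?A" "foldl \<delta> z0 (u1 @ v @ w) \<in> F" by (auto simp: G_def)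
      then have "u1 @ v @ w \<in> T" using v(1) u1A AU by (auto simp: TD dfa_lang_def)
      then have "p @ (u1 @ v @ w) @ q \<in> ?S" using v(1) u1A w(1) by (intro TS) auto
      then have "run 0 ((p @ u1) @ v @ w @ q) = 0" by (simp add: toggle_lang_def)
      then have "run (run (run 0 (u @ pd)) v) (w @ q) = 0" unfolding p[symmetric] by simp
      moreover have "run 0 (u @ pd) = 0" using u pd(1) by (simp add: toggle_lang_def)
      ultimately show False using v(2) run_dead[of "w @ q"] by simp
    qed
  qed
qed

lemma NC_not_ORD: "\<not> IC F_NC \<subseteq> IC (F_ORD :: nat family)"
  using toggle_lang_not_covered toggle_lang_NC toggle_lang_lists MON_NC
  by (intro not_IC_subset[of "{5,6,7,8}" "{5,6,7,8}" toggle_lang]) (auto simp: alphabet_def)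

subsection \<open>The hierarchy\<close>

lemma hierarchy_edge:
  "(F_FIN, F_NIL) \<in> hierarchy_edges" "(F_MON, F_NIL) \<in> hierarchy_edges" "(F_MON, F_COMB) \<in> hierarchy_edges"
  "(F_MON, F_STAR) \<in> hierarchy_edges" "(F_MON, F_INF) \<in> hierarchy_edges" "(F_MON, F_COMM) \<in> hierarchy_edges"
  "(F_COMB, F_DEF) \<in> hierarchy_edges" "(F_COMB, F_SYDEF) \<in> hierarchy_edges" "(F_NIL, F_DEF) \<in> hierarchy_edges"
  "(F_DEF, F_ORD) \<in> hierarchy_edges" "(F_ORD, F_NC) \<in> hierarchy_edges" "(F_NC, F_PS) \<in> hierarchy_edges"
  "(F_SYDEF, F_PS) \<in> hierarchy_edges" "(F_INF, F_SUF) \<in> hierarchy_edges" "(F_INF, F_PRE) \<in> hierarchy_edges"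
  "(F_SUF, F_PS) \<in> hierarchy_edges" "(F_PRE, F_PS) \<in> hierarchy_edges" "(F_PS, F_REG) \<in> hierarchy_edges"
  "(F_STAR, F_REG) \<in> hierarchy_edges" "(F_COMM, F_CIRC) \<in> hierarchy_edges" "(F_CIRC, F_REG) \<in> hierarchy_edges"
  by (simp_all add: hierarchy_edges_def)

lemma IC_hierarchy_edge:
  assumes "(X, Y) \<in> (hierarchy_edges :: nat family rel)"
  shows "IC X \<subseteq> IC Y"
proof (cases "(X, Y) = (F_MON, F_COMB)")
  case True
  then show ?thesis using IC_MON_COMB by simp
next
  case False
  with assms show ?thesis
    by (intro IC_mono, unfold hierarchy_edges_def alphabet_def, elim insertE Pair_inject)
      (simp_all add: FIN_NIL MON_NIL MON_STAR MON_INF MON_COMM COMB_DEF COMB_SYDEF NIL_DEF DEF_ORD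
        ORD_NC NC_PS SYDEF_PS INF_SUF INF_PRE SUF_PS PRE_PS PS_REG STAR_REG COMM_CIRC CIRC_REG)
qed

lemma IC_hierarchy_path:
  "(X, Y) \<in> (hierarchy_edges :: nat family rel)\<^sup>* \<Longrightarrow> IC X \<subseteq> IC Y"
proof (induction rule: rtrancl_induct)
  case (step Y Z)
  then show ?case using IC_hierarchy_edge[of Y Z] by blast
qed simp

lemma IC_not_subset_path:
  assumes "\<not> IC A \<subseteq> IC B" "(A, X) \<in> (hierarchy_edges :: nat family rel)\<^sup>*" "(Y, B) \<in> hierarchy_edges\<^sup>*"
  shows "\<not> IC X \<subseteq> IC Y"
  using assms(1) IC_hierarchy_path[OF assms(2)] IC_hierarchy_path[OF assms(3)] by blast

text \<open>The complete lists of nodes reachable from each node; every pair that is not listed has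
  to be settled by a non-inclusion.\<close>

lemma hierarchy_paths:
  "Y \<in> {F_REG} \<Longrightarrow> (F_REG, Y) \<in> hierarchy_edges\<^sup>*"
  "Y \<in> {F_CIRC, F_REG} \<Longrightarrow> (F_CIRC, Y) \<in> hierarchy_edges\<^sup>*"
  "Y \<in> {F_PS, F_REG} \<Longrightarrow> (F_PS, Y) \<in> hierarchy_edges\<^sup>*"
  "Y \<in> {F_NC, F_PS, F_REG} \<Longrightarrow> (F_NC, Y) \<in> hierarchy_edges\<^sup>*"
  "Y \<in> {F_STAR, F_REG} \<Longrightarrow> (F_STAR, Y) \<in> hierarchy_edges\<^sup>*"
  "Y \<in> {F_COMM, F_CIRC, F_REG} \<Longrightarrow> (F_COMM, Y) \<in> hierarchy_edges\<^sup>*"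
  "Y \<in> {F_PRE, F_PS, F_REG} \<Longrightarrow> (F_PRE, Y) \<in> hierarchy_edges\<^sup>*"
  "Y \<in> {F_SUF, F_PS, F_REG} \<Longrightarrow> (F_SUF, Y) \<in> hierarchy_edges\<^sup>*"
  "Y \<in> {F_INF, F_SUF, F_PRE, F_PS, F_REG} \<Longrightarrow> (F_INF, Y) \<in> hierarchy_edges\<^sup>*"
  "Y \<in> {F_SYDEF, F_PS, F_REG} \<Longrightarrow> (F_SYDEF, Y) \<in> hierarchy_edges\<^sup>*"
  "Y \<in> {F_ORD, F_NC, F_PS, F_REG} \<Longrightarrow> (F_ORD, Y) \<in> hierarchy_edges\<^sup>*"
  "Y \<in> {F_DEF, F_ORD, F_NC, F_PS, F_REG} \<Longrightarrow> (F_DEF, Y) \<in> hierarchy_edges\<^sup>*"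
  "Y \<in> {F_NIL, F_DEF, F_ORD, F_NC, F_PS, F_REG} \<Longrightarrow> (F_NIL, Y) \<in> hierarchy_edges\<^sup>*"
  "Y \<in> {F_COMB, F_DEF, F_ORD, F_SYDEF, F_NC, F_PS, F_REG} \<Longrightarrow> (F_COMB, Y) \<in> hierarchy_edges\<^sup>*"
  "Y \<in> {F_MON, F_COMB, F_NIL, F_DEF, F_ORD, F_SYDEF,
     F_INF, F_SUF, F_PRE, F_COMM, F_STAR, F_NC, F_PS, F_CIRC, F_REG} \<Longrightarrow> (F_MON, Y) \<in> hierarchy_edges\<^sup>*"
  "Y \<in> {F_FIN, F_NIL, F_DEF, F_ORD, F_NC, F_PS, F_REG} \<Longrightarrow> (F_FIN, Y) \<in> hierarchy_edges\<^sup>*"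
  by (elim insertE emptyE; hypsubst;
    blast intro: rtrancl.rtrancl_refl hierarchy_edge[THEN converse_rtrancl_into_rtrancl])+

lemma IC_separations:
  "\<not> IC (F_FIN :: nat family) \<subseteq> IC F_SUF" "\<not> IC (F_FIN :: nat family) \<subseteq> IC F_PRE"
  "\<not> IC (F_FIN :: nat family) \<subseteq> IC F_STAR" "\<not> IC (F_FIN :: nat family) \<subseteq> IC F_CIRC"
  "\<not> IC (F_COMB :: nat family) \<subseteq> IC F_SUF" "\<not> IC (F_COMB :: nat family) \<subseteq> IC F_PRE"
  "\<not> IC (F_COMB :: nat family) \<subseteq> IC F_STAR" "\<not> IC (F_COMB :: nat family) \<subseteq> IC F_CIRC"
  by (simp_all add: FIN_not COMB_not)

lemmas IC_not_subset = IC_separations[THEN IC_not_subset_path]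
  FIN_not_SYDEF[THEN IC_not_subset_path] MON_not_FIN[THEN IC_not_subset_path]
  COMB_not_NIL[THEN IC_not_subset_path] ORD_not_DEF[THEN IC_not_subset_path]
  NC_not_ORD[THEN IC_not_subset_path] SYDEF_not_NC[THEN IC_not_subset_path]
  INF_not_NC[THEN IC_not_subset_path] INF_not_SYDEF[THEN IC_not_subset_path]
  INF_not_STAR[THEN IC_not_subset_path] INF_not_CIRC[THEN IC_not_subset_path]
  SUF_not_PRE[THEN IC_not_subset_path] PRE_not_SUF[THEN IC_not_subset_path]
  STAR_not_PS[THEN IC_not_subset_path] STAR_not_CIRC[THEN IC_not_subset_path]
  COMM_not_PS[THEN IC_not_subset_path] COMM_not_STAR[THEN IC_not_subset_path]
  CIRC_not_COMM[THEN IC_not_subset_path]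

text \<open>The alternative is decided for each of the 256 pairs of nodes; the reflexive path covers
  equal indices.\<close>

lemma IC_hierarchy_dichotomy:
  assumes "X \<in> hierarchy_nodes" "Y \<in> hierarchy_nodes"
  shows "(X, Y) \<in> (hierarchy_edges :: nat family rel)\<^sup>* \<or> \<not> IC X \<subseteq> IC Y"
  using assms unfolding hierarchy_nodes_def
  by (elim insertE emptyE; hypsubst; simp add: hierarchy_paths IC_not_subset)

(* Symbols are drawn from the countably infinite supply nat. *)
theorem theorem33:
  shows "(IC (F_REG :: nat family) = IC F_UF \<and>
          IC (F_UF :: nat family) = IC F_LCOM \<and>
          IC (F_LCOM :: nat family) = IC F_RCOM \<and>
          IC (F_RCOM :: nat family) = IC F_2COM) \<and>
         (\<forall>(X, Y) \<in> (hierarchy_edges :: (nat family \<times> nat family) set). IC X \<subset> IC Y) \<and>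
         (\<forall>X \<in> (hierarchy_nodes :: nat family set). \<forall>Y \<in> hierarchy_nodes.
            X \<noteq> Y \<and> (X, Y) \<notin> hierarchy_edges\<^sup>+ \<and> (Y, X) \<notin> hierarchy_edges\<^sup>+ \<longrightarrow>
            \<not> IC X \<subseteq> IC Y \<and> \<not> IC Y \<subseteq> IC X)"
proof (intro conjI ballI impI)
  show "IC (F_REG :: nat family) = IC F_UF" by (rule IC_REG_UF)
  show "IC (F_UF :: nat family) = IC F_LCOM" by (simp add: IC_LCOM IC_REG_UF)
  show "IC (F_LCOM :: nat family) = IC F_RCOM" by (simp add: IC_LCOM IC_RCOM)
  show "IC (F_RCOM :: nat family) = IC F_2COM" by (simp add: IC_RCOM IC_2COM)
next
  fix e :: "nat family \<times> nat family" assume e: "e \<in> hierarchy_edges"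
  \<comment> \<open>Properness of an edge is one of the collected non-inclusions, taken against the
    direction of the edge.\<close>
  then have "\<not> IC (snd e) \<subseteq> IC (fst e)"
    unfolding hierarchy_edges_def by (elim insertE emptyE; hypsubst; simp add: hierarchy_paths IC_not_subset)
  with e IC_hierarchy_edge[of "fst e" "snd e"] show "case e of (X, Y) \<Rightarrow> IC X \<subset> IC Y"
    by (auto simp: psubset_eq)
next
  fix X Y :: "nat family"
  assume "X \<in> hierarchy_nodes" "Y \<in> hierarchy_nodes"
    "X \<noteq> Y \<and> (X, Y) \<notin> hierarchy_edges\<^sup>+ \<and> (Y, X) \<notin> hierarchy_edges\<^sup>+"
  then show "\<not> IC X \<subseteq> IC Y" "\<not> IC Y \<subseteq> IC X"
    using IC_hierarchy_dichotomy[of X Y] IC_hierarchy_dichotomy[of Y X]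
    unfolding rtrancl_eq_or_trancl by blast+
qed

end
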